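(* Assume that the homogeneous part $\dot x=A(u(t))x$ satisfies the accessibility rank condition on $\mathbb R^n\setminus\{0\}$, that there is a $\sigma$-periodic $u\in\mathcal U_{pc}$ ($\sigma>0$) with $g(u)\in\mathcal S_\sigma\cap\mathrm{int}(\mathcal S)$ and $1\notin\mathrm{spec}(\Phi_u(\sigma,0))$, and that the affine system has at most finitely many control sets with nonvoid interior. Then for every control set ${}_{\mathbb R}D_i^{\hom}\subset\mathbb R^n\setminus\{0\}$ with nonvoid interior of the homogeneous part there is a control set $D\subset\mathbb R^n$ with nonvoid interior of the affine system such that $\partial_\infty(D)\cap e({}_{\mathbb P}D_i^{\hom})\neq\varnothing$, where ${}_{\mathbb P}D_i^{\hom}$ is the control set in $\mathbb P^{n-1}$ containing $\pi_{\mathbb P}({}_{\mathbb R}D_i^{\hom})$.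
   Context: Affine system $\dot x=A(u(t))x+Cu(t)+d$, $u(t)\in\Omega$, $A(u)=A+\sum_iu_iB_i$, $C=(c_1,\dots,c_m)$, $\Omega\subset\mathbb R^m$ bounded with $0\in\Omega$, satisfying the accessibility rank condition on $\mathbb R^n$; $\mathcal U_{pc}$ piecewise constant $\Omega$-valued controls; homogeneous part $\dot x=A(u(t))x$ with solutions $\varphi_{\hom}$ and principal fundamental solution $\Phi_u(t,s)$; it induces systems on $\mathbb R^n\setminus\{0\}$ and on $\mathbb P^{n-1}$ (trajectories $\pi_{\mathbb P}\varphi_{\hom}(t,x,u)$). $\mathcal S$: system semigroup in $\mathbb R^n\ltimes GL(n,\mathbb R)$ generated by time-$t$ maps ($t>0$) of $x\mapsto A(w)x+Cw+d$, $w\in\Omega$; $\mathcal S_\sigma$: elements of total time $\sigma$; interior in the generated group (Lie group topology); $g(u)\in\mathcal S_\sigma$ the element corresponding to $u$ on $[0,\sigma]$, so $g(u)x=\varphi(\sigma,x,u)$. Control set (on any state space): nonvoid maximal $D$ such that each $x\in D$ admits a control keeping the trajectory in $D$ for $t\ge0$ and $D\subset\overline{\mathcal O^+(x)}$ for all $x\in D$. Projective setting: bilinear system on $\mathbb R^{n+1}$, $\frac d{dt}(x,z)=\big(\begin{pmatrix}A&d\\0&0\end{pmatrix}+\sum_iu_i\begin{pmatrix}B_i&c_i\\0&0\end{pmatrix}\big)(x,z)$, projected to $\mathbb P^n$; $\mathbb P^{n,0}=\{[x_1:\cdots:x_n:0]\}$; $e([x_1:\cdots:x_n])=[x_1:\cdots:x_n:0]$;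 for a control set $D\subset\mathbb R^n$, $\partial_\infty(D):=\partial(\{[x_1:\cdots:x_n:1]:x\in D\})\cap\mathbb P^{n,0}$. *)

theory Defs
  imports "HOL-Analysis.Analysis"
begin

section \<open>Affine control system  x' = A(u)x + Cu + d\<close>

text \<open>A(w) = A + sum_i w_i B_i ; the matrix C has columns c_i, so C w = sum_i w_i c_i.\<close>
definition A_of :: "real^'n^'n \<Rightarrow> ('m::finite \<Rightarrow> real^'n^'n) \<Rightarrow> real^'m \<Rightarrow> real^'n^'n" where
  "A_of A B w = A + (\<Sum>i\<in>UNIV. (w $ i) *\<^sub>R B i)"

definition aff_field :: "real^'n^'n \<Rightarrow> ('m::finite \<Rightarrow> real^'n^'n) \<Rightarrow> real^'m^'n \<Rightarrow> real^'n
     \<Rightarrow> real^'m \<Rightarrow> real^'n \<Rightarrow> real^'n" where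
  "aff_field A B C d w x = A_of A B w *v x + C *v w + d"

definition hom_field :: "real^'n^'n \<Rightarrow> ('m::finite \<Rightarrow> real^'n^'n) \<Rightarrow> real^'m \<Rightarrow> real^'n \<Rightarrow> real^'n" where
  "hom_field A B w x = A_of A B w *v x"

text \<open>Piecewise constant controls with values in Omega (on the time axis [0,oo)):
  on every bounded interval [0,T] there are finitely many switching points, and u is
  constant between consecutive switching points (on intervals [s_i, s_(i+1))).\<close>
definition pc_controls :: "'c set \<Rightarrow> (real \<Rightarrow> 'c) set" where
  "pc_controls \<Omega> = {u. (\<forall>t\<ge>0. u t \<in> \<Omega>) \<and>
      (\<forall>T\<ge>0. \<exists>S. finite S \<and>
         (\<forall>t t'. 0 \<le> t \<and> t \<le> t' \<and> t' \<le> T \<and> S \<inter> {t<..t'} = {} \<longrightarrow> u t' = u t))}"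

text \<open>Solution phi(t,x,u) (t >= 0) of x' = F(u(t), x), x(0) = x, in integral (Caratheodory) form.\<close>
definition sol :: "('c \<Rightarrow> 'a::euclidean_space \<Rightarrow> 'a) \<Rightarrow> real \<Rightarrow> 'a \<Rightarrow> (real \<Rightarrow> 'c) \<Rightarrow> 'a" where
  "sol F t x u = (THE y. (\<forall>s<0. y s = x) \<and>
       (\<forall>s\<ge>0. ((\<lambda>r. F (u r) (y r)) has_integral (y s - x)) {0..s})) t"

section \<open>Control sets on an abstract state space (topological space X)\<close>

definition pos_orbit :: "(real \<Rightarrow> 'a \<Rightarrow> 'u \<Rightarrow> 'a) \<Rightarrow> 'u set \<Rightarrow> 'a \<Rightarrow> 'a set" where
  "pos_orbit phi U x = {phi t x u | t u. t \<ge> 0 \<and> u \<in> U}"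

definition cs_prop :: "'a topology \<Rightarrow> (real \<Rightarrow> 'a \<Rightarrow> 'u \<Rightarrow> 'a) \<Rightarrow> 'u set \<Rightarrow> 'a set \<Rightarrow> bool" where
  "cs_prop X phi U D \<longleftrightarrow> D \<noteq> {} \<and> D \<subseteq> topspace X \<and>
     (\<forall>x\<in>D. \<exists>u\<in>U. \<forall>t\<ge>0. phi t x u \<in> D) \<and>
     (\<forall>x\<in>D. D \<subseteq> X closure_of (pos_orbit phi U x))"

definition control_set :: "'a topology \<Rightarrow> (real \<Rightarrow> 'a \<Rightarrow> 'u \<Rightarrow> 'a) \<Rightarrow> 'u set \<Rightarrow> 'a set \<Rightarrow> bool" where
  "control_set X phi U D \<longleftrightarrow> cs_prop X phi U D \<and> (\<forall>D'. cs_prop X phi U D' \<and> D \<subseteq> D' \<longrightarrow> D' = D)"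

section \<open>Projective spaces: points are lines through 0\<close>

definition proj_line :: "'a::real_vector \<Rightarrow> 'a set" where
  "proj_line x = {c *\<^sub>R x | c. True}"

definition proj_space :: "'a::real_vector set set" where
  "proj_space = {proj_line x | x. x \<noteq> 0}"

text \<open>Quotient topology of (V - {0}) under x \<mapsto> [x].\<close>
definition proj_topology :: "'a::real_normed_vector set topology" where
  "proj_topology = topology (\<lambda>W. W \<subseteq> proj_space \<and> open {x. x \<noteq> 0 \<and> proj_line x \<in> W})"

text \<open>Induced system on P^(n-1): the line p is mapped by the (linear) homogeneous flow.\<close>
definition proj_flow :: "(real \<Rightarrow> 'a \<Rightarrow> 'u \<Rightarrow> 'a) \<Rightarrow> real \<Rightarrow> 'a set \<Rightarrow> 'u \<Rightarrow> 'a set" where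
  "proj_flow phi t p u = (\<lambda>y. phi t y u) ` p"

text \<open>e([x]) = [x:0] and the hyperplane at infinity P^(n,0) inside P^n = P(R^n x R).\<close>
definition emb_inf :: "'a::real_vector set \<Rightarrow> ('a \<times> real) set" where
  "emb_inf p = (\<lambda>y. (y, 0)) ` p"

definition P_inf :: "('a::real_vector \<times> real) set set" where
  "P_inf = {proj_line (y, 0) | y. y \<noteq> 0}"

definition boundary_inf :: "'a::real_normed_vector set \<Rightarrow> ('a \<times> real) set set" where
  "boundary_inf D = (proj_topology frontier_of {proj_line (x, 1) | x. x \<in> D}) \<inter> P_inf"

section \<open>Accessibility rank condition\<close>

text \<open>Affine vector fields x \<mapsto> X x + b are encoded as pairs (b, X); Lie bracket.\<close>
definition aff_bracket :: "(real^'n) \<times> (real^'n^'n) \<Rightarrow> (real^'n) \<times> (real^'n^'n) \<Rightarrow> (real^'n) \<times> (real^'n^'n)" where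
  "aff_bracket f g = (snd g *v fst f - snd f *v fst g, snd g ** snd f - snd f ** snd g)"

inductive_set lie_gen :: "((real^'n) \<times> (real^'n^'n)) set \<Rightarrow> ((real^'n) \<times> (real^'n^'n)) set"
  for G where
    gen: "f \<in> G \<Longrightarrow> f \<in> lie_gen G"
  | zero: "0 \<in> lie_gen G"
  | add: "f \<in> lie_gen G \<Longrightarrow> g \<in> lie_gen G \<Longrightarrow> f + g \<in> lie_gen G"
  | scale: "f \<in> lie_gen G \<Longrightarrow> c *\<^sub>R f \<in> lie_gen G"
  | bracket: "f \<in> lie_gen G \<Longrightarrow> g \<in> lie_gen G \<Longrightarrow> aff_bracket f g \<in> lie_gen G"

definition ARC_on :: "((real^'n) \<times> (real^'n^'n)) set \<Rightarrow> (real^'n) set \<Rightarrow> bool" where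
  "ARC_on G M \<longleftrightarrow> (\<forall>x\<in>M. {snd f *v x + fst f | f. f \<in> lie_gen G} = UNIV)"

definition aff_gens :: "real^'n^'n \<Rightarrow> ('m::finite \<Rightarrow> real^'n^'n) \<Rightarrow> real^'m^'n \<Rightarrow> real^'n
     \<Rightarrow> (real^'m) set \<Rightarrow> ((real^'n) \<times> (real^'n^'n)) set" where
  "aff_gens A B C d \<Omega> = {(C *v w + d, A_of A B w) | w. w \<in> \<Omega>}"

definition hom_gens :: "real^'n^'n \<Rightarrow> ('m::finite \<Rightarrow> real^'n^'n) \<Rightarrow> (real^'m) set \<Rightarrow> ((real^'n) \<times> (real^'n^'n)) set" where
  "hom_gens A B \<Omega> = {(0, A_of A B w) | w. w \<in> \<Omega>}"

section \<open>The affine group R^n \<ltimes> GL(n,R) and the system semigroup\<close>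

text \<open>(v, M) acts by x \<mapsto> M x + v; product = composition of the actions.\<close>
definition aff_act :: "(real^'n) \<times> (real^'n^'n) \<Rightarrow> real^'n \<Rightarrow> real^'n" where
  "aff_act g x = snd g *v x + fst g"

definition aff_mult :: "(real^'n) \<times> (real^'n^'n) \<Rightarrow> (real^'n) \<times> (real^'n^'n) \<Rightarrow> (real^'n) \<times> (real^'n^'n)" where
  "aff_mult g h = (fst g + snd g *v fst h, snd g ** snd h)"

definition aff_one :: "(real^'n) \<times> (real^'n^'n)" where
  "aff_one = (0, mat 1)"

definition aff_inv :: "(real^'n) \<times> (real^'n^'n) \<Rightarrow> (real^'n) \<times> (real^'n^'n)" where
  "aff_inv g = (- (matrix_inv (snd g) *v fst g), matrix_inv (snd g))"

definition mat_pow :: "nat \<Rightarrow> real^'n^'n \<Rightarrow> real^'n^'n" where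
  "mat_pow k X = (((**) X) ^^ k) (mat 1)"

definition mexp :: "real^'n^'n \<Rightarrow> real^'n^'n" where
  "mexp X = (\<Sum>k. (1 / fact k) *\<^sub>R mat_pow k X)"

text \<open>Exponential of the affine Lie algebra element (b, X) = time-1 map of x' = X x + b.\<close>
definition aff_exp :: "(real^'n) \<times> (real^'n^'n) \<Rightarrow> (real^'n) \<times> (real^'n^'n)" where
  "aff_exp Z = (integral {0..1} (\<lambda>s. mexp (s *\<^sub>R snd Z) *v fst Z), mexp (snd Z))"

text \<open>Time-t map of x' = A(w)x + Cw + d.\<close>
definition time_map :: "real^'n^'n \<Rightarrow> ('m::finite \<Rightarrow> real^'n^'n) \<Rightarrow> real^'m^'n \<Rightarrow> real^'n
     \<Rightarrow> real \<Rightarrow> real^'m \<Rightarrow> (real^'n) \<times> (real^'n^'n)" where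
  "time_map A B C d t w = aff_exp (t *\<^sub>R (C *v w + d, A_of A B w))"

definition aff_prod :: "((real^'n) \<times> (real^'n^'n)) list \<Rightarrow> (real^'n) \<times> (real^'n^'n)" where
  "aff_prod gs = foldr aff_mult gs aff_one"

text \<open>S_sigma: products of time-t_i maps (t_i > 0) with total time sigma.\<close>
definition sys_sg_time :: "real^'n^'n \<Rightarrow> ('m::finite \<Rightarrow> real^'n^'n) \<Rightarrow> real^'m^'n \<Rightarrow> real^'n
     \<Rightarrow> (real^'m) set \<Rightarrow> real \<Rightarrow> ((real^'n) \<times> (real^'n^'n)) set" where
  "sys_sg_time A B C d \<Omega> \<sigma> = {aff_prod (map (\<lambda>(t, w). time_map A B C d t w) ps) | ps.
      ps \<noteq> [] \<and> (\<forall>(t, w) \<in> set ps. t > 0 \<and> w \<in> \<Omega>) \<and> sum_list (map fst ps) = \<sigma>}"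

definition sys_sg :: "real^'n^'n \<Rightarrow> ('m::finite \<Rightarrow> real^'n^'n) \<Rightarrow> real^'m^'n \<Rightarrow> real^'n
     \<Rightarrow> (real^'m) set \<Rightarrow> ((real^'n) \<times> (real^'n^'n)) set" where
  "sys_sg A B C d \<Omega> = (\<Union>\<sigma>\<in>{0<..}. sys_sg_time A B C d \<Omega> \<sigma>)"

text \<open>The group generated by the semigroup.\<close>
inductive_set gen_group :: "((real^'n) \<times> (real^'n^'n)) set \<Rightarrow> ((real^'n) \<times> (real^'n^'n)) set"
  for S where
    base: "g \<in> S \<Longrightarrow> g \<in> gen_group S"
  | one: "aff_one \<in> gen_group S"
  | mult: "g \<in> gen_group S \<Longrightarrow> h \<in> gen_group S \<Longrightarrow> aff_mult g h \<in> gen_group S"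
  | inv: "g \<in> gen_group S \<Longrightarrow> aff_inv g \<in> gen_group S"

text \<open>Lie algebra of the (analytic) subgroup G: all Z with exp(tZ) \<in> G for all t.\<close>
definition lie_alg_of :: "((real^'n) \<times> (real^'n^'n)) set \<Rightarrow> ((real^'n) \<times> (real^'n^'n)) set" where
  "lie_alg_of G = {Z. \<forall>t. aff_exp (t *\<^sub>R Z) \<in> G}"

text \<open>Interior of S in G w.r.t. the Lie group topology of G: g has a neighbourhood
  g exp(V), V a 0-neighbourhood in the Lie algebra of G, contained in S.\<close>
definition lie_interior :: "((real^'n) \<times> (real^'n^'n)) set \<Rightarrow> ((real^'n) \<times> (real^'n^'n)) set
     \<Rightarrow> ((real^'n) \<times> (real^'n^'n)) set" where
  "lie_interior G S = {g \<in> S. \<exists>\<epsilon>>0. \<forall>Z\<in>lie_alg_of G. norm Z < \<epsilon> \<longrightarrow> aff_mult g (aff_exp Z) \<in> S}"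

end

theory Submission
  imports Defs "HOL-Complex_Analysis.Complex_Analysis"
begin

text \<open>
  Both systems live on \<open>\<real>\<^sup>n \<times> \<real>\<close> as one linear system, the affine one on the level \<open>z = 1\<close> and the
  homogeneous one on the level \<open>z = 0\<close>. By the rank conditions there are arbitrarily short regular words
  \<open>s\<close>, whose endpoints move in all directions under small changes of the switching times; hence a fixed
  point of an element \<open>s k\<close> of the semigroup lies in the interior of a control set, and the points of a
  segment of such fixed points are mutually reachable.

  A point \<open>x'\<close> of the homogeneous control set is fixed by some \<open>h = s s\<^sup>- q\<close>, where \<open>s\<^sup>-\<close> is the reversed word
  with positive times. The family \<open>h\<^sub>l\<close> that lets the times of \<open>s\<^sup>-\<close> run from \<open>-t\<close> to \<open>t\<close>, those of \<open>q\<close> from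
  \<open>0\<close> to \<open>t\<close>, and those of \<open>g(u)\<close> from \<open>t\<close> to \<open>0\<close> is entire in \<open>l\<close> with \<open>h\<^sub>0 = g(u)\<close> and \<open>h\<^sub>1 = h\<close>. As
  \<open>g(u)\<close> has no eigenvalue \<open>1\<close>, neither has \<open>h\<^sub>l\<close> for suitable \<open>l\<close> tending to \<open>1\<close>, so that the affine map
  \<open>h\<^sub>l\<close> has a fixed point \<open>y\<^sub>l\<close>; by finiteness infinitely many \<open>y\<^sub>l\<close> lie in one affine control set \<open>D\<close>.
  If they are unbounded, their directions accumulate at a fixed direction of \<open>h\<close>; if they accumulate at
  \<open>y\<close>, then the line \<open>y + \<real> x'\<close> is fixed by \<open>h\<close> and contained in \<open>D\<close>.
\<close>

section \<open>The Banach algebra of endomorphisms\<close>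

text \<open>The limit map \<open>h_1\<close> fixes \<open>x'\<close> on the level 0, so its linear
  part has the eigenvalue 1 and its affine action may have no fixed point at all. This is why it is
  approached through \<open>l < 1\<close>. For \<open>l < 1/2\<close> the reversed block has
  negative times and the family leaves the semigroup; nothing dynamical is claimed there. Only one
  scalar function is followed along this stretch: the determinant of \<open>1 - h_l\<close> on the
  level 0. It is entire and nonzero at \<open>l = 0\<close>, so its zeros are isolated and it is
  nonzero for all \<open>l\<close> close to but different from 1, where the times are nonnegative
  again. The reversed block exists to cancel \<open>s\<close> at \<open>l = 0\<close> while
  \<open>s\<close> itself keeps its times for every \<open>l\<close>. Thus each \<open>h_l\<close>
  with \<open>1/2 < l \<le> 1\<close> is the same regular word times a semigroup element, and one
  local controllability argument serves all fixed points, those of the limit included. Since the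
  levels 0 and 1 use the same words, a fixed vector on the level 0 can be added to a fixed point on
  the level 1; this produces the invariant line in the bounded case.\<close>

typedef (overloaded) 'a endo = "UNIV :: ('a::euclidean_space \<Rightarrow>\<^sub>L 'a) set"
  morphisms blinfun_of_endo Endo_blinfun by simp

setup_lifting type_definition_endo

text \<open>Composition becomes the ring multiplication, so that \<open>exp\<close> and its calculus
  in Banach algebras apply to the generators of flows.\<close>

instantiation endo :: (euclidean_space) real_normed_algebra_1
begin

lift_definition zero_endo :: "'a endo" is "0" .
lift_definition one_endo :: "'a endo" is "id_blinfun" .
lift_definition plus_endo :: "'a endo \<Rightarrow> 'a endo \<Rightarrow> 'a endo" is "(+)" .
lift_definition minus_endo :: "'a endo \<Rightarrow> 'a endo \<Rightarrow> 'a endo" is "(-)" .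
lift_definition uminus_endo :: "'a endo \<Rightarrow> 'a endo" is "uminus" .
lift_definition times_endo :: "'a endo \<Rightarrow> 'a endo \<Rightarrow> 'a endo" is "(o\<^sub>L)" .
lift_definition scaleR_endo :: "real \<Rightarrow> 'a endo \<Rightarrow> 'a endo" is "scaleR" .
lift_definition norm_endo :: "'a endo \<Rightarrow> real" is "norm" .

definition dist_endo :: "'a endo \<Rightarrow> 'a endo \<Rightarrow> real" where "dist_endo x y = norm (x - y)"
definition sgn_endo :: "'a endo \<Rightarrow> 'a endo" where "sgn_endo x = scaleR (inverse (norm x)) x"
definition uniformity_endo :: "('a endo \<times> 'a endo) filter" where
  "uniformity_endo = (INF e\<in>{0<..}. principal {(x, y). dist x y < e})"
definition open_endo :: "'a endo set \<Rightarrow> bool" where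
  "open_endo S = (\<forall>x\<in>S. \<forall>\<^sub>F (x', y) in uniformity. x' = x \<longrightarrow> y \<in> S)"

instance
proof
  fix a b c :: "'a endo" and r s :: real
  show "dist a b = norm (a - b)" by (rule dist_endo_def)
  show "sgn a = inverse (norm a) *\<^sub>R a" by (rule sgn_endo_def)
  show "norm a = 0 \<longleftrightarrow> a = 0" by transfer simp
  show "norm (a + b) \<le> norm a + norm b" by transfer (rule norm_triangle_ineq)
  show "norm (r *\<^sub>R a) = \<bar>r\<bar> * norm a" by transfer simp
  show "norm (a * b) \<le> norm a * norm b" by transfer (rule norm_blinfun_compose)
  show "norm (1 :: 'a endo) = 1" by transfer simp
  show "(0::'a endo) \<noteq> 1" by transfer (metis norm_blinfun_id norm_zero zero_neq_one)
  show "uniformity = (INF e\<in>{0<..}. principal {(x, y::'a endo). dist x y < e})"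
    by (rule uniformity_endo_def)
  show "open U = (\<forall>x\<in>U. \<forall>\<^sub>F (x', y) in uniformity. x' = x \<longrightarrow> y \<in> U)" for U :: "'a endo set"
    by (rule open_endo_def)
qed (transfer, auto simp: algebra_simps blinfun.bilinear_simps intro!: blinfun_eqI)+

end

instance endo :: (euclidean_space) banach
proof
  fix X :: "nat \<Rightarrow> 'a endo"
  assume C: "Cauchy X"
  have d: "dist (blinfun_of_endo x) (blinfun_of_endo y) = dist x y" for x y :: "'a endo"
    unfolding dist_endo_def dist_norm by transfer simp
  have "Cauchy (\<lambda>n. blinfun_of_endo (X n))"
    using C unfolding Cauchy_def d .
  then obtain l where l: "(\<lambda>n. blinfun_of_endo (X n)) \<longlonglongrightarrow> l"
    using Cauchy_convergent_iff convergent_def by blast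
  have "X \<longlonglongrightarrow> Endo_blinfun l"
    using l unfolding tendsto_iff d[symmetric] by (simp add: Endo_blinfun_inverse)
  then show "convergent X" unfolding convergent_def by blast
qed

lift_definition endo_apply :: "'a::euclidean_space endo \<Rightarrow> 'a \<Rightarrow> 'a" (infixr \<open>\<star>\<close> 75) is blinfun_apply .

lift_definition Endo :: "('a::euclidean_space \<Rightarrow> 'a) \<Rightarrow> 'a endo" is Blinfun .

lemma endo_eqI: "(\<And>v. X \<star> v = Y \<star> v) \<Longrightarrow> X = Y"
  by transfer (rule blinfun_eqI)

lemma Endo_apply: "linear f \<Longrightarrow> Endo f \<star> v = f v"
  by transfer (simp add: bounded_linear_Blinfun_apply linear_conv_bounded_linear)

lemma norm_endo_apply: "norm (X \<star> v) \<le> norm X * norm v"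
  by transfer (rule norm_blinfun)

lemma bounded_bilinear_endo_apply: "bounded_bilinear (\<star>)"
proof
  show "\<exists>K. \<forall>(a::'a endo) b. norm (a \<star> b) \<le> norm a * norm b * K"
    by (intro exI[of _ 1]) (simp add: norm_endo_apply)
qed (transfer; simp add: blinfun.bilinear_simps)+

interpretation endo_apply: bounded_bilinear "(\<star>)"
  by (rule bounded_bilinear_endo_apply)

lemma endo_one_apply [simp]: "1 \<star> v = v"
  by transfer simp

lemma endo_times_apply [simp]: "(X * Y) \<star> v = X \<star> Y \<star> v"
  by transfer simp

lemmas endo_apply_simps = endo_apply.add_left endo_apply.add_right endo_apply.diff_left
  endo_apply.diff_right endo_apply.scaleR_left endo_apply.scaleR_right endo_apply.minus_left
  endo_apply.minus_right endo_apply.zero_left endo_apply.zero_right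
  endo_apply.sum_left endo_apply.sum_right

section \<open>Finite dimension of the space of endomorphisms\<close>

definition elementary_endo :: "'a::euclidean_space \<Rightarrow> 'a \<Rightarrow> 'a endo" where
  "elementary_endo b c = Endo (\<lambda>v. (v \<bullet> b) *\<^sub>R c)"

lemma elementary_endo_apply: "elementary_endo b c \<star> v = (v \<bullet> b) *\<^sub>R c"
  unfolding elementary_endo_def
  by (rule Endo_apply) (simp add: linear_iff algebra_simps inner_add_left)

lemma endo_representation:
  "X = (\<Sum>b\<in>Basis. \<Sum>c\<in>Basis. ((X \<star> b) \<bullet> c) *\<^sub>R elementary_endo b c)"
proof (rule endo_eqI)
  fix v
  have "X \<star> v = X \<star> (\<Sum>b\<in>Basis. (v \<bullet> b) *\<^sub>R b)" by (simp add: euclidean_representation)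
  also have "\<dots> = (\<Sum>b\<in>Basis. (v \<bullet> b) *\<^sub>R (\<Sum>c\<in>Basis. ((X \<star> b) \<bullet> c) *\<^sub>R c))"
    proof -
    have "(\<Sum>c\<in>Basis. ((X \<star> b) \<bullet> c) *\<^sub>R c) = X \<star> b" for b
      by (rule euclidean_representation)
    then show ?thesis by (simp only: endo_apply.sum_right endo_apply.scaleR_right)
  qed
  finally show "X \<star> v = (\<Sum>b\<in>Basis. \<Sum>c\<in>Basis. ((X \<star> b) \<bullet> c) *\<^sub>R elementary_endo b c) \<star> v"
    by (simp add: endo_apply_simps elementary_endo_apply scaleR_sum_right mult.commute)
qed

lemma endo_finite_span: "\<exists>S::'a::euclidean_space endo set. finite S \<and> span S = UNIV"
proof (intro exI conjI)
  let ?S = "(\<lambda>(b,c). elementary_endo b c) ` (Basis \<times> Basis) :: 'a endo set"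
  show "finite ?S" by simp
  have "X \<in> span ?S" for X :: "'a endo"
    by (subst endo_representation) (intro span_sum span_scale span_base; auto)
  then show "span ?S = UNIV" by auto
qed

lemma bounded_linear_endo_functional:
  fixes f :: "'a::euclidean_space endo \<Rightarrow> real"
  assumes "linear f"
  shows "bounded_linear f"
proof -
  have "f X = (\<Sum>b\<in>Basis. \<Sum>c\<in>Basis. ((X \<star> b) \<bullet> c) *\<^sub>R f (elementary_endo b c))" for X
    by (subst endo_representation[of X]) (simp add: linear_sum[OF assms] linear_scale[OF assms])
  then have "f = (\<lambda>X. \<Sum>b\<in>Basis. \<Sum>c\<in>Basis. ((X \<star> b) \<bullet> c) *\<^sub>R f (elementary_endo b c))"
    by (rule ext)
  moreover have "bounded_linear \<dots>"
    by (intro bounded_linear_sum bounded_linear_scaleR_const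
        bounded_linear_compose[OF bounded_linear_inner_left] endo_apply.bounded_linear_left)
  ultimately show ?thesis by simp
qed

lemma endo_finite_dim:
  obtains B :: "'a::euclidean_space endo set" where "finite_dimensional_vector_space scaleR B"
proof -
  obtain S :: "'a endo set" where S: "finite S" "span S = UNIV" using endo_finite_span by blast
  obtain B where B: "B \<subseteq> S" "independent B" "S \<subseteq> span B"
    using maximal_independent_subset by blast
  have "span B = UNIV" using B S by (metis span_mono span_span top.extremum_unique)
  then have "finite_dimensional_vector_space scaleR B"
    using B S(1) by unfold_locales (auto simp: dependent_raw_def span_raw_def finite_subset)
  then show thesis by (rule that)
qed

text \<open>This is how a tangent space of maximal dimension refuses further directions.\<close>

lemma endo_subspace_dim_le:
  fixes S T :: "'a::euclidean_space endo set"
  assumes "subspace S" "subspace T" "S \<subseteq> T" "dim T \<le> dim S"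
  shows "S = T"
proof -
  obtain B :: "'a endo set" where "finite_dimensional_vector_space scaleR B" by (rule endo_finite_dim)
  then interpret E: finite_dimensional_vector_space "scaleR :: real \<Rightarrow> 'a endo \<Rightarrow> 'a endo" B .
  show ?thesis
    using E.subspace_dim_equal[of S T] assms unfolding subspace_raw_def dim_raw_def by blast
qed

lemma endo_dim_bounded: "\<exists>N. \<forall>S::'a::euclidean_space endo set. dim S \<le> N"
proof -
  obtain B :: "'a endo set" where "finite_dimensional_vector_space scaleR B" by (rule endo_finite_dim)
  then interpret E: finite_dimensional_vector_space "scaleR :: real \<Rightarrow> 'a endo \<Rightarrow> 'a endo" B .
  show ?thesis using E.dim_subset_UNIV unfolding dim_raw_def by blast
qed

text \<open>A point off \<open>S\<close> is separated from \<open>S\<close> by a linear functional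
  vanishing on \<open>S\<close>. Such functionals are continuous, so \<open>S\<close> is an
  intersection of closed kernels. Limits of difference quotients therefore stay in
  \<open>S\<close>.\<close>

lemma closed_endo_subspace:
  fixes S :: "'a::euclidean_space endo set"
  assumes "subspace S" shows "closed S"
proof -
  have "\<exists>f. linear f \<and> S \<subseteq> f -` {0::real} \<and> f x \<noteq> 0" if "x \<notin> S" for x
  proof -
    obtain B where B: "B \<subseteq> S" "independent B" "S \<subseteq> span B"
      using maximal_independent_subset by blast
    have sp: "span B = S" using B assms by (metis span_minimal subset_antisym)
    then have i: "independent (insert x B)" and n: "x \<notin> B"
      using that B independent_insert by (metis, blast)
    obtain f where f: "linear f" "\<forall>y\<in>insert x B. f y = (if y = x then 1 else 0::real)"
      using linear_independent_extend[OF i, of "\<lambda>y. if y = x then 1 else 0"] by blast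
    have "f y = 0" if "y \<in> span B" for y
      using n f(2) by (intro linear_eq_0_on_span[OF f(1) _ that]) auto
    then show ?thesis using f sp by (intro exI[of _ f]) auto
  qed
  then obtain f where f: "\<And>x. x \<notin> S \<Longrightarrow> linear (f x) \<and> S \<subseteq> f x -` {0::real} \<and> f x x \<noteq> 0"
    by metis
  have "S = (\<Inter>x\<in>-S. f x -` {0})"
  proof
    show "(\<Inter>x\<in>-S. f x -` {0}) \<subseteq> S" using f by fastforce
  qed (use f in blast)
  moreover have "closed (f -` {0::real})" if "linear f" for f :: "'a endo \<Rightarrow> real"
    using bounded_linear_endo_functional[OF that]
    by (intro continuous_closed_vimage) (auto intro: linear_continuous_at)
  ultimately show ?thesis using f by (metis closed_INT ComplD)
qed

section \<open>Products of exponentials and their tangent spaces\<close>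

text \<open>The head of the list is the leftmost factor, hence the last one to act in time.\<close>

fun word_prod :: "(real \<times> 'a::euclidean_space endo) list \<Rightarrow> 'a endo" where
  "word_prod [] = 1"
| "word_prod ((t, M) # ps) = exp (t *\<^sub>R M) * word_prod ps"

fun word_inv :: "(real \<times> 'a::euclidean_space endo) list \<Rightarrow> 'a endo" where
  "word_inv [] = 1"
| "word_inv ((t, M) # ps) = word_inv ps * exp (- (t *\<^sub>R M))"

text \<open>Absolute values make the weight insensitive to the sign of the times, so the inverse of
  a short word is short as well.\<close>

fun weight :: "(real \<times> 'a::euclidean_space endo) list \<Rightarrow> real" where
  "weight [] = 0"
| "weight ((t, M) # ps) = \<bar>t\<bar> * norm M + weight ps"

text \<open>The right-trivialised image of the derivative of \<^const>\<open>word_prod\<close> with respect to the times.\<close>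

fun tangent :: "(real \<times> 'a::euclidean_space endo) list \<Rightarrow> 'a endo set" where
  "tangent [] = {0}"
| "tangent ((t, M) # ps) = {c *\<^sub>R M + exp (t *\<^sub>R M) * D * exp (- (t *\<^sub>R M)) | c D. D \<in> tangent ps}"

text \<open>Positive times leave room for small changes in both directions. In contrast,
  \<open>semigroup_of\<close> admits time zero and so contains the identity.\<close>

definition words :: "'a::euclidean_space endo set \<Rightarrow> (real \<times> 'a endo) list set" where
  "words Ms = {ps. \<forall>(t, M)\<in>set ps. 0 < t \<and> M \<in> Ms}"

definition semigroup_of :: "'a::euclidean_space endo set \<Rightarrow> 'a endo set" where
  "semigroup_of Ms = word_prod ` {ps. \<forall>(t, M)\<in>set ps. 0 \<le> t \<and> M \<in> Ms}"

inductive_set lie_hull :: "'a::euclidean_space endo set \<Rightarrow> 'a endo set" for Ms where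
  gen: "X \<in> Ms \<Longrightarrow> X \<in> lie_hull Ms"
| zero: "0 \<in> lie_hull Ms"
| add: "X \<in> lie_hull Ms \<Longrightarrow> Y \<in> lie_hull Ms \<Longrightarrow> X + Y \<in> lie_hull Ms"
| scale: "X \<in> lie_hull Ms \<Longrightarrow> c *\<^sub>R X \<in> lie_hull Ms"
| bracket: "X \<in> lie_hull Ms \<Longrightarrow> Y \<in> lie_hull Ms \<Longrightarrow> X * Y - Y * X \<in> lie_hull Ms"

text \<open>Conjugating \<open>tangent ps\<close> back by the word gives the left-trivialised image
  of the derivative. The condition says that this image contains the whole Lie algebra generated by
  \<open>Ms\<close>.\<close>

definition regular_word :: "'a::euclidean_space endo set \<Rightarrow> (real \<times> 'a endo) list \<Rightarrow> bool" where
  "regular_word Ms ps \<longleftrightarrow> ps \<in> words Ms \<and> (\<forall>Y\<in>lie_hull Ms. word_prod ps * Y * word_inv ps \<in> tangent ps)"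

lemma exp_minus_cancel [simp]:
  fixes X :: "'a::euclidean_space endo"
  shows "exp X * exp (- X) = 1" "exp (- X) * exp X = 1"
    "exp X * (exp (- X) * Y) = Y" "exp (- X) * (exp X * Y) = Y"
  using exp_minus_inverse[of X] exp_minus_inverse[of "- X"]
  by (simp_all add: mult.assoc[symmetric])

lemma word_prod_inv:
  "word_prod ps * word_inv ps = 1" "word_inv ps * word_prod ps = 1"
proof (induction ps)
  case (Cons a ps)
  obtain t M where a: "a = (t, M)" by (cases a)
  { case 1
    have "exp (t *\<^sub>R M) * word_prod ps * (word_inv ps * exp (- (t *\<^sub>R M)))
        = exp (t *\<^sub>R M) * (word_prod ps * word_inv ps) * exp (- (t *\<^sub>R M))" by (simp only: mult.assoc)
    then show ?case using Cons.IH(1) a by simp }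
  { case 2
    have "word_inv ps * exp (- (t *\<^sub>R M)) * (exp (t *\<^sub>R M) * word_prod ps)
        = word_inv ps * (exp (- (t *\<^sub>R M)) * exp (t *\<^sub>R M)) * word_prod ps" by (simp only: mult.assoc)
    then show ?case using Cons.IH(2) a by simp }
qed simp_all

lemma word_prod_append: "word_prod (ps @ qs) = word_prod ps * word_prod qs"
  by (induction ps rule: word_prod.induct) (simp_all add: mult.assoc)

lemma weight_append: "weight (ps @ qs) = weight ps + weight qs"
  by (induction ps rule: weight.induct) simp_all

lemma weight_rev: "weight (rev ps) = weight ps"
  by (induction ps rule: weight.induct) (simp_all add: weight_append)

definition negate_times :: "(real \<times> 'a::euclidean_space endo) list \<Rightarrow> (real \<times> 'a endo) list" where
  "negate_times ps = map (\<lambda>(t, M). (- t, M)) ps"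

lemma weight_negate_times: "weight (negate_times ps) = weight ps"
  unfolding negate_times_def by (induction ps rule: weight.induct) simp_all

lemma word_prod_negate_times: "word_prod (negate_times (rev ps)) = word_inv ps"
  unfolding negate_times_def by (induction ps rule: word_prod.induct) (simp_all add: word_prod_append)

lemma words_nonneg: "ps \<in> words Ms \<Longrightarrow> \<forall>(t, M)\<in>set ps. 0 \<le> t \<and> M \<in> Ms"
  unfolding words_def by force

lemma word_prod_in_semigroup: "ps \<in> words Ms \<Longrightarrow> word_prod ps \<in> semigroup_of Ms"
  unfolding semigroup_of_def using words_nonneg by blast

lemma semigroup_of_one: "1 \<in> semigroup_of Ms"
  unfolding semigroup_of_def by (intro image_eqI[of _ _ "[]"]) auto

lemma semigroup_of_mult:
  assumes "X \<in> semigroup_of Ms" "Y \<in> semigroup_of Ms" shows "X * Y \<in> semigroup_of Ms"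
proof -
  obtain ps qs where "X = word_prod ps" "Y = word_prod qs" "\<forall>(t, M)\<in>set ps. 0 \<le> t \<and> M \<in> Ms"
    "\<forall>(t, M)\<in>set qs. 0 \<le> t \<and> M \<in> Ms"
    using assms unfolding semigroup_of_def by blast
  then show ?thesis unfolding semigroup_of_def
    by (intro image_eqI[of _ _ "ps @ qs"]) (auto simp: word_prod_append)
qed

lemma semigroup_of_exp: "M \<in> Ms \<Longrightarrow> 0 \<le> t \<Longrightarrow> exp (t *\<^sub>R M) \<in> semigroup_of Ms"
  unfolding semigroup_of_def by (intro image_eqI[of _ _ "[(t, M)]"]) auto

lemma semigroup_of_left_inverse: "X \<in> semigroup_of Ms \<Longrightarrow> \<exists>Y. Y * X = 1"
  unfolding semigroup_of_def using word_prod_inv by blast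

lemma subspace_tangent: "subspace (tangent ps)"
proof (induction ps)
  case (Cons a ps)
  obtain t M where a: "a = (t, M)" by (cases a)
  show ?case
    unfolding a subspace_def
  proof (intro conjI ballI allI)
    show "0 \<in> tangent ((t, M) # ps)"
      using subspace_0[OF Cons.IH] by (force intro!: exI[of _ 0])
    fix X Y assume "X \<in> tangent ((t, M) # ps)" "Y \<in> tangent ((t, M) # ps)"
    then obtain c D c' D' where "X = c *\<^sub>R M + exp (t *\<^sub>R M) * D * exp (- (t *\<^sub>R M))" "D \<in> tangent ps"
      "Y = c' *\<^sub>R M + exp (t *\<^sub>R M) * D' * exp (- (t *\<^sub>R M))" "D' \<in> tangent ps" by auto
    then show "X + Y \<in> tangent ((t, M) # ps)"
      using subspace_add[OF Cons.IH, of D D'] by (auto simp: algebra_simps intro!: exI[of _ "c + c'"] exI[of _ "D + D'"])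
  next
    fix r X assume "X \<in> tangent ((t, M) # ps)"
    then obtain c D where "X = c *\<^sub>R M + exp (t *\<^sub>R M) * D * exp (- (t *\<^sub>R M))" "D \<in> tangent ps" by auto
    then show "r *\<^sub>R X \<in> tangent ((t, M) # ps)"
      using subspace_scale[OF Cons.IH, of D r] by (auto simp: algebra_simps intro!: exI[of _ "r * c"] exI[of _ "r *\<^sub>R D"])
  qed
qed simp

lemma tangent_append_left: "D \<in> tangent ps \<Longrightarrow> D \<in> tangent (ps @ qs)"
  by (induction ps arbitrary: D rule: tangent.induct) (auto simp: subspace_0[OF subspace_tangent])

lemma tangent_append_right: "D \<in> tangent qs \<Longrightarrow> word_prod ps * D * word_inv ps \<in> tangent (ps @ qs)"
proof (induction ps)
  case (Cons a ps)
  obtain t M where a: "a = (t, M)" by (cases a)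
  show ?case using Cons a by (auto simp: mult.assoc intro!: exI[of _ "0::real"] exI[of _ "word_prod ps * (D * word_inv ps)"])
qed simp

lemma conj_exp_derivative:
  fixes M D :: "'a::euclidean_space endo"
  shows "((\<lambda>t. exp (t *\<^sub>R M) * D * exp (- (t *\<^sub>R M))) has_vector_derivative (M * D - D * M)) (at 0)"
proof -
  have 1: "((\<lambda>t. exp (t *\<^sub>R M)) has_vector_derivative M) (at 0)"
    using exp_scaleR_has_vector_derivative_left[of M 0] by simp
  have 2: "((\<lambda>t. exp (- (t *\<^sub>R M))) has_vector_derivative (- M)) (at 0)"
    using exp_scaleR_has_vector_derivative_left[of "- M" 0] by simp
  show ?thesis
    using has_vector_derivative_mult[OF has_vector_derivative_mult[OF 1 has_vector_derivative_const[of D]] 2]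
    by simp
qed

lemma continuous_on_exp_scaleR:
  fixes M :: "'a::euclidean_space endo"
  shows "continuous_on S (\<lambda>t. exp (t *\<^sub>R M))"
  using exp_scaleR_has_vector_derivative_left[of M]
  by (metis continuous_at_imp_continuous_on has_vector_derivative_continuous)

text \<open>Stability under brackets with generators suffices: the induction carries along that
  bracketing with \<open>X\<close> preserves \<open>U\<close>, and the Jacobi identity passes this
  on to brackets.\<close>

lemma lie_hull_minimal:
  assumes U: "subspace U" "Ms \<subseteq> U" and ad: "\<And>M D. M \<in> Ms \<Longrightarrow> D \<in> U \<Longrightarrow> M * D - D * M \<in> U"
  shows "lie_hull Ms \<subseteq> U"
proof -
  have "X \<in> U \<and> (\<forall>D\<in>U. X * D - D * X \<in> U)" if "X \<in> lie_hull Ms" for X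
    using that
  proof induction
    case (gen X) then show ?case using U ad by auto
  next
    case zero then show ?case using subspace_0[OF U(1)] by simp
  next
    case (add X Y)
    have "(X + Y) * D - D * (X + Y) = (X * D - D * X) + (Y * D - D * Y)" for D by (simp add: algebra_simps)
    then show ?case using add subspace_add[OF U(1)] by metis
  next
    case (scale X c)
    have "(c *\<^sub>R X) * D - D * (c *\<^sub>R X) = c *\<^sub>R (X * D - D * X)" for D by (simp add: algebra_simps)
    then show ?case using scale subspace_scale[OF U(1)] by metis
  next
    case (bracket X Y)
    have "(X * Y - Y * X) * D - D * (X * Y - Y * X)
      = (X * (Y * D - D * Y) - (Y * D - D * Y) * X) - (Y * (X * D - D * X) - (X * D - D * X) * Y)" for D
      by (simp add: algebra_simps)
    then show ?case using bracket subspace_diff[OF U(1)] by metis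
  qed
  then show ?thesis by blast
qed

text \<open>Among the words of small weight choose one whose tangent space has maximal dimension. Appending
  further letters then adds no directions, so the tangent space absorbs the conjugates of all short
  tangent spaces, and these span a space that is stable under brackets with the generators.\<close>

lemma regular_word_exists:
  fixes Ms :: "'a::euclidean_space endo set"
  assumes "0 < e"
  shows "\<exists>ps. regular_word Ms ps \<and> weight ps < e"
proof -
  obtain N where N: "\<And>S::'a endo set. dim S \<le> N" using endo_dim_bounded by blast
  have "\<exists>ps. (ps \<in> words Ms \<and> weight ps < e) \<and>
      (\<forall>qs. (qs \<in> words Ms \<and> weight qs < e) \<longrightarrow> dim (tangent qs) \<le> dim (tangent ps))"
    by (rule ex_has_greatest_nat[of _ "[]" _ "Suc N"]) (auto simp: words_def assms N le_imp_less_Suc)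
  then obtain ps where ps: "ps \<in> words Ms" "weight ps < e"
    and mx: "\<And>qs. qs \<in> words Ms \<Longrightarrow> weight qs < e \<Longrightarrow> dim (tangent qs) \<le> dim (tangent ps)" by blast
  \<comment> \<open>The weight that may still be appended to \<open>ps\<close> within the bound
    \<open>e\<close>.\<close>
  define \<delta> where "\<delta> = e - weight ps"
  define U where "U = span (\<Union>{tangent qs | qs. qs \<in> words Ms \<and> weight qs < \<delta>})"
  have base: "D \<in> U" if "D \<in> tangent qs" "qs \<in> words Ms" "weight qs < \<delta>" for D qs
    unfolding U_def using that by (auto intro!: span_base)
  have subU: "subspace U" unfolding U_def by simp
  have absorb: "word_prod ps * D * word_inv ps \<in> tangent ps" if "D \<in> U" for D
    using that unfolding U_def
  proof (induction rule: span_induct)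
    case base
    show ?case unfolding subspace_def
      using subspace_add[OF subspace_tangent] subspace_scale[OF subspace_tangent] subspace_0[OF subspace_tangent]
      by (auto simp: distrib_left distrib_right)
  next
    case (step D)
    then obtain qs where qs: "D \<in> tangent qs" "qs \<in> words Ms" "weight qs < \<delta>" by blast
    have "tangent ps = tangent (ps @ qs)"
    proof (rule endo_subspace_dim_le[OF subspace_tangent subspace_tangent])
      show "tangent ps \<subseteq> tangent (ps @ qs)" using tangent_append_left by blast
      show "dim (tangent (ps @ qs)) \<le> dim (tangent ps)"
        using qs ps by (intro mx) (auto simp: words_def \<delta>_def weight_append)
    qed
    then show ?case using tangent_append_right[OF qs(1)] by blast
  qed
  have ad: "M * D - D * M \<in> U" if M: "M \<in> Ms" and D: "D \<in> U" for M D
    using D unfolding U_def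
  proof (induction rule: span_induct)
    case base
    have *: "M * (x + y) - (x + y) * M = (M * x - x * M) + (M * y - y * M)"
      "M * (c *\<^sub>R x) - (c *\<^sub>R x) * M = c *\<^sub>R (M * x - x * M)" for x y c by (simp_all add: algebra_simps)
    show ?case unfolding subspace_def mem_Collect_eq *
      using subspace_add[OF subspace_span] subspace_scale[OF subspace_span] subspace_0[OF subspace_span]
      by auto
  next
    case (step D)
    then obtain qs where qs: "D \<in> tangent qs" "qs \<in> words Ms" "weight qs < \<delta>" by blast
    \<comment> \<open>Prefixing the letter \<open>M\<close> with a small time \<open>t\<close> to
      \<open>qs\<close> keeps the weight below \<delta>, so \<open>?f t\<close> lies in
      \<open>U\<close>. The bracket is the limit of its difference quotients in the closed space
      \<open>U\<close>; the limit is one-sided because times of words are positive.\<close>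
    let ?f = "\<lambda>t. exp (t *\<^sub>R M) * D * exp (- (t *\<^sub>R M))"
    have lim: "((\<lambda>t. (?f t - D) /\<^sub>R t) \<longlongrightarrow> M * D - D * M) (at_right 0)"
    proof -
      have "((\<lambda>t. (?f t - D - t *\<^sub>R (M * D - D * M)) /\<^sub>R norm t) \<longlongrightarrow> 0) (at 0)"
      proof (rule tendsto_norm_zero_cancel)
        have "norm (Y /\<^sub>R norm t) = norm Y / norm t" for Y :: "'a endo" and t :: real
          by (simp add: divide_inverse_commute)
        then show "((\<lambda>t. norm ((?f t - D - t *\<^sub>R (M * D - D * M)) /\<^sub>R norm t)) \<longlongrightarrow> 0) (at 0)"
          using conj_exp_derivative[of M D] unfolding has_vector_derivative_def has_derivative_at by simp
      qed
      then have "((\<lambda>t. (?f t - D - t *\<^sub>R (M * D - D * M)) /\<^sub>R norm t + (M * D - D * M)) \<longlongrightarrow> 0 + (M * D - D * M)) (at_right 0)"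
        by (intro tendsto_add tendsto_const) (auto intro: tendsto_mono[OF at_le])
      moreover have "\<forall>\<^sub>F t in at_right 0. (?f t - D - t *\<^sub>R (M * D - D * M)) /\<^sub>R norm t + (M * D - D * M) = (?f t - D) /\<^sub>R t"
        using eventually_at_right_less[of "0::real"]
        by eventually_elim (simp add: scaleR_diff_right)
      ultimately show ?thesis by (simp add: tendsto_cong)
    qed
    have "((\<lambda>t. t * norm M + weight qs) \<longlongrightarrow> 0 * norm M + weight qs) (at_right 0)"
      by (intro tendsto_intros)
    then have "\<forall>\<^sub>F t in at_right 0. t * norm M + weight qs < \<delta>"
      using qs(3) by (auto dest: order_tendstoD)
    moreover have "\<forall>\<^sub>F t in at_right (0::real). 0 < t"
      by (simp add: eventually_at_right_less)
    ultimately have "\<forall>\<^sub>F t in at_right 0. (?f t - D) /\<^sub>R t \<in> U"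
    proof eventually_elim
      case (elim t)
      have "?f t \<in> U"
        using qs M elim by (intro base[of _ "(t, M) # qs"]) (auto simp: words_def intro!: exI[of _ "0::real"] exI[of _ D])
      then show ?case using base[OF qs] by (intro subspace_scale[OF subU] subspace_diff[OF subU])
    qed
    then show ?case unfolding U_def[symmetric]
      by (intro Lim_in_closed_set[OF closed_endo_subspace[OF subU] _ _ lim]) (auto simp: trivial_limit_at_right_real)
  qed
  have "Ms \<subseteq> U"
  proof
    fix M assume M: "M \<in> Ms"
    have "0 < \<delta>" using ps by (simp add: \<delta>_def)
    then have "\<exists>t>0. t * norm M < \<delta>"
      by (intro exI[of _ "\<delta> / (norm M + 1)"]) (auto simp: field_simps add_pos_nonneg)
    then obtain t where "0 < t" "t * norm M < \<delta>" by blast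
    then show "M \<in> U"
      using M by (intro base[of _ "[(t, M)]"]) (auto simp: words_def intro!: exI[of _ 1])
  qed
  then have "lie_hull Ms \<subseteq> U" using lie_hull_minimal[OF subU] ad by blast
  then show ?thesis unfolding regular_word_def using ps absorb by blast
qed

lemma norm_exp_minus_one:
  fixes X :: "'a::euclidean_space endo"
  shows "norm (exp X - 1) \<le> exp (norm X) - 1"
proof -
  have le: "norm (inverse (fact (Suc n)) *\<^sub>R X ^ Suc n) \<le> inverse (fact (Suc n)) *\<^sub>R norm X ^ Suc n" for n
    using norm_power_ineq[of X "Suc n"] by (simp add: mult_left_mono del: power_Suc fact_Suc)
  have sum: "summable (\<lambda>n. inverse (fact (Suc n)) *\<^sub>R norm X ^ Suc n)"
    using summable_exp_generic[of "norm X"] by (subst summable_Suc_iff) (simp add: scaleR_conv_of_real)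
  have "exp X - 1 = (\<Sum>n. inverse (fact (Suc n)) *\<^sub>R X ^ Suc n)"
    by (subst exp_first_term) simp
  also have "norm \<dots> \<le> (\<Sum>n. inverse (fact (Suc n)) *\<^sub>R norm X ^ Suc n)"
    by (rule norm_suminf_le[OF le sum])
  also have "\<dots> = exp (norm X) - 1"
    using exp_first_term[of "norm X"] by (simp del: power_Suc fact_Suc)
  finally show ?thesis .
qed

text \<open>With \<open>E\<close> the first factor and \<open>P\<close> the rest,
  \<open>E P - 1 = E (P - 1) + (E - 1)\<close>, and the bounds multiply because weights add. Hence
  short words and their inverses displace points only a little.\<close>

lemma norm_word_prod_minus_one: "norm (word_prod ps - 1) \<le> exp (weight ps) - 1"
proof (induction ps)
  case (Cons a ps)
  obtain t M where a: "a = (t, M)" by (cases a)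
  let ?E = "exp (t *\<^sub>R M)"
  have "word_prod (a # ps) - 1 = ?E * (word_prod ps - 1) + (?E - 1)" by (simp add: a algebra_simps)
  also have "norm \<dots> \<le> norm ?E * norm (word_prod ps - 1) + norm (?E - 1)"
    by (metis (no_types, opaque_lifting) add_mono_thms_linordered_semiring(3) norm_mult_ineq norm_triangle_ineq order_trans)
  also have "\<dots> \<le> exp (\<bar>t\<bar> * norm M) * (exp (weight ps) - 1) + (exp (\<bar>t\<bar> * norm M) - 1)"
    using norm_exp[of "t *\<^sub>R M"] norm_exp_minus_one[of "t *\<^sub>R M"] Cons a
    by (intro add_mono mult_mono) auto
  also have "\<dots> = exp (weight (a # ps)) - 1" by (simp add: a exp_add algebra_simps)
  finally show ?case .
qed simp

section \<open>Perturbation of words\<close>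

text \<open>\<open>P v\<close> is the word with its times changed by amounts linear in
  \<open>v\<close>, chosen so that \<open>Z\<close> becomes the right-trivialised derivative;
  \<open>R v\<close> is its inverse. Continuity and a derivative at 0 are all that the open mapping
  theorem applied later asks for.\<close>

lemma word_perturbation:
  fixes Z :: "'b::euclidean_space \<Rightarrow> 'a::euclidean_space endo"
  assumes "linear Z" "\<And>v. Z v \<in> tangent ps" "ps \<in> words Ms"
  shows "\<exists>P R. continuous_on UNIV P \<and> continuous_on UNIV R \<and> P 0 = word_prod ps \<and> R 0 = word_inv ps
    \<and> (\<forall>v. P v * R v = 1 \<and> R v * P v = 1)
    \<and> (P has_derivative (\<lambda>v. Z v * word_prod ps)) (at 0)
    \<and> (R has_derivative (\<lambda>v. - (word_inv ps * Z v))) (at 0)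
    \<and> (\<exists>e>0. \<forall>v\<in>ball 0 e. P v \<in> semigroup_of Ms)"
  using assms
proof (induction ps arbitrary: Z)
  case Nil
  then have "Z = (\<lambda>v. 0)" by auto
  then show ?case
    by (intro exI[of _ "\<lambda>_. 1"]) (auto simp: semigroup_of_one intro!: exI[of _ "1::real"])
next
  case (Cons a ps)
  obtain t M where a: "a = (t, M)" by (cases a)
  let ?E = "exp (t *\<^sub>R M)" and ?E' = "exp (- (t *\<^sub>R M))"
  have t: "0 < t" "M \<in> Ms" "ps \<in> words Ms" using Cons.prems(3) by (auto simp: a words_def)
  \<comment> \<open>The splitting of a tangent vector need not be unique; fixing it on the basis and
    extending makes both parts linear in \<open>v\<close>.\<close>
  have "\<exists>c D. D \<in> tangent ps \<and> Z b = c *\<^sub>R M + ?E * D * ?E'" for b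
    using Cons.prems(2)[of b] unfolding a by auto
  then obtain c0 D0 where 0: "\<And>b. D0 b \<in> tangent ps" "\<And>b. Z b = c0 b *\<^sub>R M + ?E * D0 b * ?E'" by metis
  define c where "c v = (\<Sum>b\<in>Basis. (v \<bullet> b) * c0 b)" for v
  define D where "D v = (\<Sum>b\<in>Basis. (v \<bullet> b) *\<^sub>R D0 b)" for v
  have lc: "linear c" unfolding c_def linear_iff
    by (auto simp: inner_add_left algebra_simps sum.distrib sum_distrib_left)
  have lD: "linear D" unfolding D_def linear_iff
    by (auto simp: inner_add_left algebra_simps sum.distrib scaleR_sum_right)
  have Dt: "D v \<in> tangent ps" for v unfolding D_def
    by (intro subspace_sum[OF subspace_tangent] subspace_scale[OF subspace_tangent] 0)
  have Zv: "Z v = c v *\<^sub>R M + ?E * D v * ?E'" for v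
  proof -
    have "Z v = Z (\<Sum>b\<in>Basis. (v \<bullet> b) *\<^sub>R b)" by (simp add: euclidean_representation)
    also have "\<dots> = (\<Sum>b\<in>Basis. (v \<bullet> b) *\<^sub>R (c0 b *\<^sub>R M + ?E * D0 b * ?E'))"
      by (simp add: linear_sum[OF Cons.prems(1)] linear_scale[OF Cons.prems(1)] 0(2)[symmetric])
    also have "\<dots> = c v *\<^sub>R M + ?E * D v * ?E'"
      by (simp add: c_def D_def scaleR_add_right sum.distrib scaleR_sum_left sum_distrib_left sum_distrib_right)
    finally show ?thesis .
  qed
  obtain P R e where PR: "continuous_on UNIV P" "continuous_on UNIV R" "P 0 = word_prod ps" "R 0 = word_inv ps"
    "\<And>v. P v * R v = 1" "\<And>v. R v * P v = 1"
    "(P has_derivative (\<lambda>v. D v * word_prod ps)) (at 0)"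
    "(R has_derivative (\<lambda>v. - (word_inv ps * D v))) (at 0)"
    "e > 0" "\<And>v. v \<in> ball 0 e \<Longrightarrow> P v \<in> semigroup_of Ms"
    using Cons.IH[OF lD Dt t(3)] by metis
  define F where "F v = exp ((t + c v) *\<^sub>R M)" for v
  define G where "G v = exp (- ((t + c v) *\<^sub>R M))" for v
  have bc: "bounded_linear c" using lc by (simp add: linear_conv_bounded_linear)
  have cc: "continuous_on UNIV c" using bc by (simp add: linear_continuous_on)
  have c0: "c 0 = 0" using lc by (simp add: linear_0)
  have dc: "((\<lambda>v. t + c v) has_derivative c) (at 0)"
    using bounded_linear_imp_has_derivative[OF bc, of "at 0"] by (auto intro!: derivative_eq_intros)
  have dF: "(F has_derivative (\<lambda>v. c v *\<^sub>R (M * ?E))) (at 0)"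
    using diff_chain_at[OF dc, of "\<lambda>t. exp (t *\<^sub>R M)"] exp_scaleR_has_vector_derivative_left[of M t]
    unfolding F_def has_vector_derivative_def o_def c0 by simp
  have dG: "(G has_derivative (\<lambda>v. - (c v *\<^sub>R (?E' * M)))) (at 0)"
    using diff_chain_at[OF dc, of "\<lambda>t. exp (t *\<^sub>R (-M))" "\<lambda>x. x *\<^sub>R (exp (t *\<^sub>R - M) * - M)"]
      exp_scaleR_has_vector_derivative_right[of "- M" t]
    unfolding G_def has_vector_derivative_def o_def c0 by simp
  have cF: "continuous_on UNIV F" "continuous_on UNIV G"
    using continuous_on_compose2[OF continuous_on_exp_scaleR[of UNIV M], of UNIV "\<lambda>v. t + c v"]
      continuous_on_compose2[OF continuous_on_exp_scaleR[of UNIV "- M"], of UNIV "\<lambda>v. t + c v"] cc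
    unfolding F_def G_def by (simp_all add: continuous_intros)
  have F0: "F 0 = ?E" "G 0 = ?E'" by (simp_all add: F_def G_def c0)
  \<comment> \<open>The head time is positive at \<open>v = 0\<close>, so it stays positive nearby
    and the perturbed word remains in the semigroup.\<close>
  have "((\<lambda>v. t + c v) \<longlongrightarrow> t + c 0) (at 0)"
    using cc by (intro tendsto_intros) (simp add: continuous_on_def)
  then have "\<forall>\<^sub>F v in at 0. 0 < t + c v" using t(1) c0 by (auto dest: order_tendstoD)
  then obtain e' where e': "e' > 0" "\<And>v. v \<noteq> 0 \<Longrightarrow> dist v 0 < e' \<Longrightarrow> 0 < t + c v"
    unfolding eventually_at by auto
  have e'': "0 < t + c v" if "v \<in> ball 0 e'" for v
    using e'(2)[of v] that t(1) c0 by (cases "v = 0") (auto simp: dist_commute)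
  show ?case
  proof (intro exI conjI allI ballI)
    show "continuous_on UNIV (\<lambda>v. F v * P v)" "continuous_on UNIV (\<lambda>v. R v * G v)"
      using cF PR by (auto intro!: continuous_intros)
    show "F 0 * P 0 = word_prod (a # ps)" "R 0 * G 0 = word_inv (a # ps)" by (simp_all add: F0 PR a)
    have FG: "F v * G v = 1" "G v * F v = 1" for v unfolding F_def G_def by simp_all
    have "F v * P v * (R v * G v) = F v * (P v * R v) * G v" for v by (simp only: mult.assoc)
    then show "F v * P v * (R v * G v) = 1" for v by (simp add: FG PR)
    have "R v * G v * (F v * P v) = R v * (G v * F v) * P v" for v by (simp only: mult.assoc)
    then show "R v * G v * (F v * P v) = 1" for v by (simp add: FG PR)
    show "((\<lambda>v. F v * P v) has_derivative (\<lambda>v. Z v * word_prod (a # ps))) (at 0)"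
      using has_derivative_mult[OF dF PR(7)]
      by (rule has_derivative_eq_rhs) (auto simp: fun_eq_iff Zv a F0 PR algebra_simps)
    show "((\<lambda>v. R v * G v) has_derivative (\<lambda>v. - (word_inv (a # ps) * Z v))) (at 0)"
      using has_derivative_mult[OF PR(8) dG]
      by (rule has_derivative_eq_rhs) (auto simp: fun_eq_iff Zv a F0 PR algebra_simps)
    show "0 < min e e'" using PR e' by simp
    show "F v * P v \<in> semigroup_of Ms" if "v \<in> ball 0 (min e e')" for v
      unfolding F_def using that t e''[of v] PR(10)[of v]
      by (intro semigroup_of_mult semigroup_of_exp) auto
  qed
qed

section \<open>Local controllability of lifted systems\<close>

text \<open>An affine field \<open>x \<mapsto> X x + b\<close> is represented by the linear field
  \<open>(x, z) \<mapsto> (X x + z b, 0)\<close>: its flow preserves the last coordinate and is the affine flow on the level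
  \<open>z = 1\<close> and the homogeneous flow on the level \<open>z = 0\<close>.\<close>

locale lifted_system =
  fixes Ms :: "('b::euclidean_space \<times> real) endo set"
  assumes snd_generator: "M \<in> Ms \<Longrightarrow> snd (M \<star> v) = 0"
    and rank_condition: "p \<noteq> 0 \<Longrightarrow> \<exists>Y\<in>lie_hull Ms. Y \<star> p = (y, 0)"
begin

definition reach :: "'b \<times> real \<Rightarrow> 'b \<times> real \<Rightarrow> bool" where
  "reach p q \<longleftrightarrow> (\<exists>H\<in>semigroup_of Ms. H \<star> p = q)"

lemma reach_refl: "reach p p"
  unfolding reach_def using semigroup_of_one by force

lemma reach_trans: "reach p q \<Longrightarrow> reach q r \<Longrightarrow> reach p r"
  unfolding reach_def using semigroup_of_mult by (metis endo_times_apply)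

lemma snd_exp_generator:
  assumes "M \<in> Ms" shows "snd (exp (t *\<^sub>R M) \<star> v) = snd v"
proof -
  have "((\<lambda>t. snd (exp (t *\<^sub>R M) \<star> v)) has_real_derivative 0) (at t)" for t
  proof -
    have "bounded_linear (\<lambda>X. snd (X \<star> v))"
      by (intro bounded_linear_compose[OF bounded_linear_snd] endo_apply.bounded_linear_left)
    from bounded_linear.has_vector_derivative[OF this exp_scaleR_has_vector_derivative_left[of M t]]
    show ?thesis
      using snd_generator[OF assms] by (simp add: has_real_derivative_iff_has_vector_derivative)
  qed
  from DERIV_isconst_all[OF allI[OF this], of t 0] show ?thesis by simp
qed

lemma snd_word:
  assumes "snd ` set ps \<subseteq> Ms"
  shows "snd (word_prod ps \<star> v) = snd v" "snd (word_inv ps \<star> v) = snd v"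
  using assms
proof (induction ps arbitrary: v)
  case (Cons a ps)
  obtain t M where a: "a = (t, M)" by (cases a)
  { case 1 then show ?case using Cons.IH(1) snd_exp_generator[of M t] a by simp }
  { case 2 then show ?case using Cons.IH(2) snd_exp_generator[of M "-t"] a by simp }
qed simp_all

lemma words_snd: "ps \<in> words Ms \<Longrightarrow> snd ` set ps \<subseteq> Ms"
  by (auto simp: words_def)

lemma snd_semigroup: "H \<in> semigroup_of Ms \<Longrightarrow> snd (H \<star> v) = snd v"
  unfolding semigroup_of_def by (auto intro!: snd_word)

lemma reach_zero_iff: "reach p q \<Longrightarrow> q = 0 \<longleftrightarrow> p = 0"
  unfolding reach_def using semigroup_of_left_inverse
  by (metis endo_apply.zero_right endo_one_apply endo_times_apply)

lemma linear_selection: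
  fixes f :: "'b \<Rightarrow> 'b \<times> real"
  assumes T: "subspace T" and f: "linear f" and ex: "\<And>v. \<exists>W\<in>T. W \<star> q = f v"
  obtains Z where "linear Z" "\<And>v. Z v \<in> T" "\<And>v. Z v \<star> q = f v"
proof -
  obtain W where W: "\<And>v. W v \<in> T" "\<And>v. W v \<star> q = f v" using ex by metis
  show thesis
  proof
    let ?Z = "\<lambda>v. \<Sum>b\<in>Basis. (v \<bullet> b) *\<^sub>R W b"
    show "linear ?Z" unfolding linear_iff
      by (auto simp: inner_add_left algebra_simps sum.distrib scaleR_sum_right)
    show "?Z v \<in> T" for v by (intro subspace_sum[OF T] subspace_scale[OF T] W)
    have "?Z v \<star> q = f (\<Sum>b\<in>Basis. (v \<bullet> b) *\<^sub>R b)" for v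
      by (simp add: endo_apply.sum_left endo_apply.scaleR_left W linear_sum[OF f] linear_scale[OF f])
    then show "?Z v \<star> q = f v" for v by (simp add: euclidean_representation)
  qed
qed

text \<open>Pull \<open>p\<close> and \<open>q\<close> back by \<open>word_inv ps\<close>, apply the
  rank condition there, and conjugate the result forward into the tangent space.\<close>

lemma regular_word_surjective:
  assumes ps: "regular_word Ms ps" and p: "p \<noteq> 0" and q: "snd q = 0"
  shows "\<exists>W\<in>tangent ps. W \<star> p = q"
proof -
  have w: "snd ` set ps \<subseteq> Ms" using ps words_snd by (auto simp: regular_word_def)
  have ip: "word_prod ps \<star> word_inv ps \<star> v = v" for v
    by (metis endo_one_apply endo_times_apply word_prod_inv(1))
  have "word_inv ps \<star> p \<noteq> 0" using p ip by (metis endo_apply.zero_right)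
  moreover have "snd (word_inv ps \<star> q) = 0" using q snd_word(2)[OF w] by simp
  ultimately obtain Y where Y: "Y \<in> lie_hull Ms" "Y \<star> word_inv ps \<star> p = word_inv ps \<star> q"
    using rank_condition[of _ "fst (word_inv ps \<star> q)"] by (metis prod.collapse)
  show ?thesis
    by (rule bexI[of _ "word_prod ps * Y * word_inv ps"])
      (use ps Y in \<open>auto simp: regular_word_def ip\<close>)
qed

text \<open>The endpoint \<open>P v \<star> p\<close> has derivative
  \<open>Z v \<star> word_prod ps \<star> p\<close> at 0; choosing \<open>Z\<close> so that this is
  \<open>(v, 0)\<close> makes the endpoint map open at 0.\<close>

lemma forward_open:
  assumes ps: "regular_word Ms ps" and p: "p \<noteq> 0"
  shows "\<exists>e>0. \<forall>y. dist y (fst (word_prod ps \<star> p)) < e \<longrightarrow> reach p (y, snd p)"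
proof -
  let ?q = "word_prod ps \<star> p"
  have w: "ps \<in> words Ms" using ps by (simp add: regular_word_def)
  have q0: "?q \<noteq> 0" using p by (metis endo_apply.zero_right endo_one_apply endo_times_apply word_prod_inv(2))
  obtain Z where Z: "linear Z" "\<And>v. Z v \<in> tangent ps" "\<And>v. Z v \<star> ?q = (v, 0)"
    by (rule linear_selection[OF subspace_tangent[of ps], of "\<lambda>v. (v, 0)" ?q])
      (auto simp: linear_iff intro: regular_word_surjective[OF ps q0])
  obtain P R e where PR: "continuous_on UNIV P" "P 0 = word_prod ps"
    "(P has_derivative (\<lambda>v. Z v * word_prod ps)) (at 0)"
    "e > 0" "\<And>v. v \<in> ball 0 e \<Longrightarrow> P v \<in> semigroup_of Ms"
    using word_perturbation[OF Z(1,2) w] by metis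
  let ?f = "\<lambda>v. fst (P v \<star> p)"
  have bl: "bounded_linear (\<lambda>X. fst (X \<star> p))"
    by (intro bounded_linear_compose[OF bounded_linear_fst] endo_apply.bounded_linear_left)
  have "?f 0 \<in> interior (?f ` ball 0 e)"
  proof (rule sussmann_open_mapping[OF open_UNIV])
    show "continuous_on UNIV ?f"
      by (rule continuous_on_compose2[OF linear_continuous_on[OF bl, of UNIV] PR(1)]) auto
    show "(?f has_derivative (\<lambda>v. v)) (at 0)"
      using bounded_linear.has_derivative[OF bl PR(3)] Z(3) by simp
  qed (use PR in auto)
  then obtain d where d: "d > 0" "ball (?f 0) d \<subseteq> ?f ` ball 0 e"
    using mem_interior by blast
  show ?thesis
  proof (intro exI[of _ d] conjI allI impI d(1))
    fix y assume "dist y (fst ?q) < d"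
    then have "y \<in> ball (?f 0) d" using PR(2) by (simp add: dist_commute)
    then obtain v where v: "v \<in> ball 0 e" "y = ?f v" using d by blast
    then show "reach p (y, snd p)"
      unfolding reach_def using PR(5) snd_semigroup by (metis prod.collapse)
  qed
qed

text \<open>The perturbed word \<open>P v\<close> sends \<open>R v \<star> p\<close> to
  \<open>p\<close>, and these starting points fill a neighbourhood of
  \<open>word_inv ps \<star> p\<close>.\<close>

lemma backward_open:
  assumes ps: "regular_word Ms ps" and p: "p \<noteq> 0"
  shows "\<exists>e>0. \<forall>y. dist y (fst (word_inv ps \<star> p)) < e \<longrightarrow> reach (y, snd p) p"
proof -
  have w: "ps \<in> words Ms" using ps by (simp add: regular_word_def)
  have ip: "word_inv ps \<star> word_prod ps \<star> v = v" for v
    by (metis endo_one_apply endo_times_apply word_prod_inv(2))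
  \<comment> \<open>The derivative of \<open>R\<close> contributes the factor
    \<open>- word_inv ps\<close>; prescribing this value for \<open>Z v \<star> p\<close> turns it
    into \<open>(v, 0)\<close>.\<close>
  have lin: "linear (\<lambda>v. word_prod ps \<star> (- v, 0))"
    by (simp add: linear_iff flip: endo_apply.scaleR_right endo_apply.add_right)
  obtain Z where Z: "linear Z" "\<And>v. Z v \<in> tangent ps" "\<And>v. Z v \<star> p = word_prod ps \<star> (- v, 0)"
    by (rule linear_selection[OF subspace_tangent[of ps] lin, of p])
      (auto intro!: regular_word_surjective[OF ps p] simp: snd_word[OF words_snd[OF w]])
  obtain P R e where PR: "continuous_on UNIV R" "R 0 = word_inv ps" "\<And>v. P v * R v = 1"
    "(R has_derivative (\<lambda>v. - (word_inv ps * Z v))) (at 0)"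
    "e > 0" "\<And>v. v \<in> ball 0 e \<Longrightarrow> P v \<in> semigroup_of Ms"
    using word_perturbation[OF Z(1,2) w] by metis
  let ?f = "\<lambda>v. fst (R v \<star> p)"
  have bl: "bounded_linear (\<lambda>X. fst (X \<star> p))"
    by (intro bounded_linear_compose[OF bounded_linear_fst] endo_apply.bounded_linear_left)
  have "?f 0 \<in> interior (?f ` ball 0 e)"
  proof (rule sussmann_open_mapping[OF open_UNIV])
    show "continuous_on UNIV ?f"
      by (rule continuous_on_compose2[OF linear_continuous_on[OF bl, of UNIV] PR(1)]) auto
    show "(?f has_derivative (\<lambda>v. v)) (at 0)"
      using bounded_linear.has_derivative[OF bl PR(4)] by (simp add: Z(3) ip endo_apply_simps)
  qed (use PR in auto)
  then obtain d where d: "d > 0" "ball (?f 0) d \<subseteq> ?f ` ball 0 e"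
    using mem_interior by blast
  show ?thesis
  proof (intro exI[of _ d] conjI allI impI d(1))
    fix y assume "dist y (fst (word_inv ps \<star> p)) < d"
    then have "y \<in> ball (?f 0) d" using PR(2) by (simp add: dist_commute)
    then obtain v where v: "v \<in> ball 0 e" "y = ?f v" using d by blast
    have "P v \<star> R v \<star> p = p" by (metis PR(3) endo_one_apply endo_times_apply)
    moreover from this have "R v \<star> p = (y, snd p)"
      using snd_semigroup[OF PR(6)[OF v(1)], of "R v \<star> p"] v(2) by (metis prod.collapse)
    ultimately show "reach (y, snd p) p"
      unfolding reach_def using PR(6)[OF v(1)] by metis
  qed
qed

definition mutual :: "'b \<times> real \<Rightarrow> 'b \<times> real \<Rightarrow> bool" where
  "mutual p q \<longleftrightarrow> reach p q \<and> reach q p"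

lemma mutual_refl: "mutual p p"
  by (simp add: mutual_def reach_refl)

lemma mutual_sym: "mutual p q \<Longrightarrow> mutual q p"
  by (simp add: mutual_def)

lemma mutual_trans: "mutual p q \<Longrightarrow> mutual q r \<Longrightarrow> mutual p r"
  unfolding mutual_def using reach_trans by blast

text \<open>Forwards, \<open>p\<close> goes to \<open>k \<star> p\<close> and from there the
  perturbed word covers a neighbourhood of \<open>p\<close>. Backwards, \<open>k\<close> takes
  points near \<open>p\<close> close to \<open>k \<star> p = word_inv ps \<star> p\<close>, from
  where a perturbed word hits \<open>p\<close> exactly.\<close>

lemma fixed_point_locally_controllable:
  assumes ps: "regular_word Ms ps" and k: "k \<in> semigroup_of Ms"
    and fix_p: "(word_prod ps * k) \<star> p = p" and p: "p \<noteq> 0"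
  shows "\<exists>e>0. \<forall>y. dist y (fst p) < e \<longrightarrow> mutual p (y, snd p)"
proof -
  have pk: "reach p (k \<star> p)" unfolding reach_def using k by blast
  have kp: "k \<star> p \<noteq> 0" "word_prod ps \<star> k \<star> p = p" "snd (k \<star> p) = snd p"
    using reach_zero_iff[OF pk] p fix_p snd_semigroup[OF k] by auto
  then have ki: "word_inv ps \<star> p = k \<star> p"
    by (metis endo_one_apply endo_times_apply word_prod_inv(2))
  obtain e1 where e1: "e1 > 0" "\<And>y. dist y (fst p) < e1 \<Longrightarrow> reach (k \<star> p) (y, snd p)"
    using forward_open[OF ps kp(1)] kp by auto
  obtain e2 where e2: "e2 > 0" "\<And>y. dist y (fst (k \<star> p)) < e2 \<Longrightarrow> reach (y, snd p) p"
    using backward_open[OF ps p] ki by auto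
  have "((\<lambda>y. fst (k \<star> (y, snd p))) \<longlongrightarrow> fst (k \<star> (fst p, snd p))) (at (fst p))"
    by (intro tendsto_intros endo_apply.tendsto)
  then obtain e3 where e3: "e3 > 0" "\<And>y. y \<noteq> fst p \<Longrightarrow> dist y (fst p) < e3 \<Longrightarrow> dist (fst (k \<star> (y, snd p))) (fst (k \<star> p)) < e2"
    using e2(1) unfolding tendsto_iff eventually_at by auto
  show ?thesis
  proof (intro exI[of _ "min e1 e3"] conjI allI impI)
    fix y assume y: "dist y (fst p) < min e1 e3"
    have "reach (k \<star> (y, snd p)) p"
    proof -
      have "dist (fst (k \<star> (y, snd p))) (fst (k \<star> p)) < e2"
        using e3(2)[of y] y e2(1) by (cases "y = fst p") auto
      from e2(2)[OF this] show ?thesis using snd_semigroup[OF k, of "(y, snd p)"] by (metis prod.collapse snd_conv)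
    qed
    moreover have "reach (y, snd p) (k \<star> (y, snd p))" unfolding reach_def using k by blast
    ultimately have "reach (y, snd p) p" using reach_trans by blast
    then show "mutual p (y, snd p)" unfolding mutual_def using e1(2)[of y] y reach_trans[OF pk] by auto
  qed (use e1 e3 in simp)
qed

text \<open>Fixed points of a linear map form a subspace, so the whole segment is fixed and each of
  its points is locally controllable; connectedness joins the local classes. Avoiding 0 is a real
  restriction only on the level 0.\<close>

lemma fixed_segment_mutual:
  assumes ps: "regular_word Ms ps" and k: "k \<in> semigroup_of Ms"
    and fix_p: "(word_prod ps * k) \<star> p = p" and fix_q: "(word_prod ps * k) \<star> q = q"
    and pq: "snd q = snd p" and nz: "0 \<notin> closed_segment p q"
  shows "mutual p q"
proof (rule connected_equivalence_relation[of "closed_segment p q" p q mutual])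
  fix a assume a: "a \<in> closed_segment p q"
  have fx: "(word_prod ps * k) \<star> r = r" "snd r = snd p" if r: "r \<in> closed_segment p q" for r
  proof -
    obtain s where r: "r = (1 - s) *\<^sub>R p + s *\<^sub>R q" using r by (auto simp: in_segment)
    have "(word_prod ps * k) \<star> r = (1 - s) *\<^sub>R ((word_prod ps * k) \<star> p) + s *\<^sub>R ((word_prod ps * k) \<star> q)"
      unfolding r by (simp only: endo_apply.add_right endo_apply.scaleR_right)
    then show "(word_prod ps * k) \<star> r = r" by (simp only: fix_p fix_q r)
    show "snd r = snd p" using pq by (simp add: r algebra_simps)
  qed
  have "a \<noteq> 0" using a nz by blast
  from fixed_point_locally_controllable[OF ps k fx(1)[OF a] this]
  obtain e where e: "e > 0" "\<And>y. dist y (fst a) < e \<Longrightarrow> mutual a (y, snd a)" by blast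
  show "\<exists>T. openin (top_of_set (closed_segment p q)) T \<and> a \<in> T \<and> (\<forall>x\<in>T. mutual a x)"
  proof (intro exI[of _ "closed_segment p q \<inter> ball a e"] conjI ballI)
    fix x assume x: "x \<in> closed_segment p q \<inter> ball a e"
    have "dist (fst x) (fst a) \<le> dist x a" by (rule dist_fst_le)
    then have "mutual a (fst x, snd a)" using x e(2)[of "fst x"] by (auto simp: dist_commute)
    then show "mutual a x" using fx(2)[OF a] fx(2)[of x] x by (metis IntD1 prod.collapse)
  qed (use a e in auto)
qed (auto intro: mutual_sym mutual_trans)

end

section \<open>Piecewise constant controls\<close>

lemma pc_controlsD:
  assumes "u \<in> pc_controls \<Omega>"
  shows "0 \<le> t \<Longrightarrow> u t \<in> \<Omega>"
    and "0 \<le> T \<Longrightarrow> \<exists>S. finite S \<and>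
         (\<forall>t t'. 0 \<le> t \<and> t \<le> t' \<and> t' \<le> T \<and> S \<inter> {t<..t'} = {} \<longrightarrow> u t' = u t)"
  using assms unfolding pc_controls_def by auto

lemma pc_controls_const: "w \<in> \<Omega> \<Longrightarrow> (\<lambda>_. w) \<in> pc_controls \<Omega>"
  unfolding pc_controls_def by auto

lemma pc_controls_shift:
  assumes u: "u \<in> pc_controls \<Omega>" and a: "0 \<le> a"
  shows "(\<lambda>r. u (r + a)) \<in> pc_controls \<Omega>"
  unfolding pc_controls_def mem_Collect_eq
proof (intro conjI allI impI)
  show "u (t + a) \<in> \<Omega>" if "0 \<le> t" for t using pc_controlsD(1)[OF u] a that by simp
  fix T :: real assume T: "0 \<le> T"
  have "0 \<le> T + a" using T a by simp
  then obtain S where S: "finite S" "\<And>t t'. 0 \<le> t \<Longrightarrow> t \<le> t' \<Longrightarrow> t' \<le> T + a \<Longrightarrow> S \<inter> {t<..t'} = {} \<Longrightarrow> u t' = u t"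
    using pc_controlsD(2)[OF u] by metis
  show "\<exists>S. finite S \<and> (\<forall>t t'. 0 \<le> t \<and> t \<le> t' \<and> t' \<le> T \<and> S \<inter> {t<..t'} = {} \<longrightarrow> u (t' + a) = u (t + a))"
  proof (intro exI[of _ "(\<lambda>s. s - a) ` S"] conjI allI impI)
    fix t t' assume t: "0 \<le> t \<and> t \<le> t' \<and> t' \<le> T \<and> (\<lambda>s. s - a) ` S \<inter> {t<..t'} = {}"
    have "S \<inter> {t + a<..t' + a} = {}"
    proof (rule equals0I)
      fix s assume "s \<in> S \<inter> {t + a<..t' + a}"
      then have "s - a \<in> (\<lambda>s. s - a) ` S \<inter> {t<..t'}" by auto
      then show False using t by blast
    qed
    then show "u (t' + a) = u (t + a)" using t a by (intro S(2)) auto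
  qed (use S in simp)
qed

lemma pc_controls_switch:
  assumes u: "u \<in> pc_controls \<Omega>" and w: "w \<in> \<Omega>"
  shows "(\<lambda>r. if r < \<tau> then u r else w) \<in> pc_controls \<Omega>"
  unfolding pc_controls_def mem_Collect_eq
proof (intro conjI allI impI)
  show "(if t < \<tau> then u t else w) \<in> \<Omega>" if "0 \<le> t" for t using pc_controlsD(1)[OF u] w that by simp
  fix T :: real assume T: "0 \<le> T"
  then obtain S where S: "finite S" "\<And>t t'. 0 \<le> t \<Longrightarrow> t \<le> t' \<Longrightarrow> t' \<le> T \<Longrightarrow> S \<inter> {t<..t'} = {} \<Longrightarrow> u t' = u t"
    using pc_controlsD(2)[OF u] by metis
  show "\<exists>S. finite S \<and> (\<forall>t t'. 0 \<le> t \<and> t \<le> t' \<and> t' \<le> T \<and> S \<inter> {t<..t'} = {} \<longrightarrow>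
      (if t' < \<tau> then u t' else w) = (if t < \<tau> then u t else w))"
  proof (intro exI[of _ "insert \<tau> S"] conjI allI impI)
    fix t t' assume t: "0 \<le> t \<and> t \<le> t' \<and> t' \<le> T \<and> insert \<tau> S \<inter> {t<..t'} = {}"
    then have "u t' = u t" by (intro S(2)) auto
    moreover have "t' < \<tau> \<longleftrightarrow> t < \<tau>" using t by (auto simp: not_less)
    ultimately show "(if t' < \<tau> then u t' else w) = (if t < \<tau> then u t else w)" by simp
  qed (use S in simp)
qed

definition periodic_ext :: "real \<Rightarrow> (real \<Rightarrow> 'c) \<Rightarrow> real \<Rightarrow> 'c" where
  "periodic_ext \<sigma> u t = u (t - \<sigma> * of_int \<lfloor>t / \<sigma>\<rfloor>)"

lemma periodic_ext_eq: "0 \<le> t \<Longrightarrow> t < \<sigma> \<Longrightarrow> periodic_ext \<sigma> u t = u t"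
proof -
  assume "0 \<le> t" "t < \<sigma>"
  then have "\<lfloor>t / \<sigma>\<rfloor> = 0" by (simp add: floor_eq_iff)
  then show ?thesis by (simp add: periodic_ext_def)
qed

lemma periodic_ext_period: "\<sigma> \<noteq> 0 \<Longrightarrow> periodic_ext \<sigma> u (t + \<sigma>) = periodic_ext \<sigma> u t"
  by (simp add: periodic_ext_def add_divide_distrib algebra_simps)

lemma pc_controls_periodic_ext:
  assumes u: "u \<in> pc_controls \<Omega>" and \<sigma>: "0 < \<sigma>"
  shows "periodic_ext \<sigma> u \<in> pc_controls \<Omega>"
  unfolding pc_controls_def mem_Collect_eq
proof (intro conjI allI impI)
  have fl: "\<sigma> * of_int \<lfloor>t / \<sigma>\<rfloor> \<le> t" "t < \<sigma> * of_int \<lfloor>t / \<sigma>\<rfloor> + \<sigma>" for t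
    using mult_left_mono[OF of_int_floor_le[of "t / \<sigma>"], of \<sigma>] floor_correct[of "t / \<sigma>"] \<sigma>
    by (simp, simp add: field_simps)
  show "periodic_ext \<sigma> u t \<in> \<Omega>" if "0 \<le> t" for t
    unfolding periodic_ext_def using fl(1)[of t] by (intro pc_controlsD(1)[OF u]) simp
  fix T :: real assume T: "0 \<le> T"
  obtain S where S: "finite S" "\<And>t t'. 0 \<le> t \<Longrightarrow> t \<le> t' \<Longrightarrow> t' \<le> \<sigma> \<Longrightarrow> S \<inter> {t<..t'} = {} \<Longrightarrow> u t' = u t"
    using pc_controlsD(2)[OF u, of \<sigma>] \<sigma> by (metis less_imp_le)
  \<comment> \<open>\<open>insert 0\<close> makes the beginnings of the periods switching points
    too.\<close>
  let ?S = "(\<lambda>(k, s). \<sigma> * of_int k + s) ` ({0..\<lfloor>T / \<sigma>\<rfloor>} \<times> insert 0 S)"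
  show "\<exists>S. finite S \<and> (\<forall>t t'. 0 \<le> t \<and> t \<le> t' \<and> t' \<le> T \<and> S \<inter> {t<..t'} = {} \<longrightarrow>
      periodic_ext \<sigma> u t' = periodic_ext \<sigma> u t)"
  proof (intro exI[of _ ?S] conjI allI impI)
    fix t t' assume t: "0 \<le> t \<and> t \<le> t' \<and> t' \<le> T \<and> ?S \<inter> {t<..t'} = {}"
    let ?k = "\<lfloor>t' / \<sigma>\<rfloor>"
    have k: "0 \<le> ?k" "?k \<le> \<lfloor>T / \<sigma>\<rfloor>" using t \<sigma> by (auto intro!: floor_mono divide_right_mono)
    have no: "\<not> (t < \<sigma> * of_int ?k + s \<and> \<sigma> * of_int ?k + s \<le> t')" if "s \<in> insert 0 S" for s
    proof
      assume "t < \<sigma> * of_int ?k + s \<and> \<sigma> * of_int ?k + s \<le> t'"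
      then have "\<sigma> * of_int ?k + s \<in> ?S \<inter> {t<..t'}" using k that by (auto intro!: image_eqI[of _ _ "(?k, s)"])
      then show False using t by blast
    qed
    have "\<sigma> * of_int ?k \<le> t" using no[of 0] fl(1)[of t'] by auto
    then have "\<lfloor>t / \<sigma>\<rfloor> = ?k" using t \<sigma> fl(2)[of t'] by (auto simp: floor_eq_iff field_simps)
    moreover have "u (t' - \<sigma> * of_int ?k) = u (t - \<sigma> * of_int ?k)"
    proof (rule S(2))
      show "0 \<le> t - \<sigma> * of_int ?k" "t - \<sigma> * of_int ?k \<le> t' - \<sigma> * of_int ?k" "t' - \<sigma> * of_int ?k \<le> \<sigma>"
        using t fl(2)[of t'] \<open>\<sigma> * of_int ?k \<le> t\<close> by auto
      show "S \<inter> {t - \<sigma> * of_int ?k<..t' - \<sigma> * of_int ?k} = {}"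
        using no by (auto simp: algebra_simps)
    qed
    ultimately show "periodic_ext \<sigma> u t' = periodic_ext \<sigma> u t" by (simp add: periodic_ext_def)
  qed (use S in simp)
qed

section \<open>Solutions\<close>

text \<open>The integral equation inside \<open>sol\<close>, cut off at a finite horizon so that
  solutions can be built and compared on intervals.\<close>

definition solves :: "('c \<Rightarrow> 'a::euclidean_space \<Rightarrow> 'a) \<Rightarrow> (real \<Rightarrow> 'c) \<Rightarrow> 'a \<Rightarrow> real \<Rightarrow> (real \<Rightarrow> 'a) \<Rightarrow> bool" where
  "solves F u x T y \<longleftrightarrow> (\<forall>s\<in>{0..T}. ((\<lambda>r. F (u r) (y r)) has_integral (y s - x)) {0..s})"

lemma solves_continuous:
  assumes "solves F u x T y" shows "continuous_on {0..T} y"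
proof (cases "0 \<le> T")
  case True
  let ?f = "\<lambda>r. F (u r) (y r)"
  have "?f integrable_on {0..T}" using assms True unfolding solves_def by (metis atLeastAtMost_iff has_integral_integrable order_refl)
  then have "continuous_on {0..T} (\<lambda>s. integral {0..s} ?f + x)"
    by (intro continuous_intros indefinite_integral_continuous_1)
  moreover have "integral {0..s} ?f + x = y s" if "s \<in> {0..T}" for s
    using assms that unfolding solves_def by (metis diff_add_cancel integral_unique)
  ultimately show ?thesis by (metis (no_types, lifting) continuous_on_cong)
qed simp

text \<open>Iterate the Lipschitz bound: the difference is continuous, hence bounded by some
  \<open>C\<close>, and \<open>n\<close> integrations improve this to \<open>C (K s)^n / n!\<close>,
  which tends to 0.\<close>

lemma solves_unique:
  fixes F :: "'c \<Rightarrow> 'a::euclidean_space \<Rightarrow> 'a"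
  assumes lip: "\<And>w x y. w \<in> \<Omega> \<Longrightarrow> norm (F w x - F w y) \<le> K * norm (x - y)" and K: "0 \<le> K"
    and u: "\<And>t. 0 \<le> t \<Longrightarrow> u t \<in> \<Omega>"
    and y: "solves F u x T y" and z: "solves F u x T z" and t: "t \<in> {0..T}"
  shows "y t = z t"
proof -
  define e where "e s = y s - z s" for s
  have "continuous_on {0..T} e" unfolding e_def
    by (intro continuous_intros solves_continuous[OF y] solves_continuous[OF z])
  then have "bounded (e ` {0..T})" by (intro compact_imp_bounded compact_continuous_image) auto
  then obtain C where C: "\<And>s. s \<in> {0..T} \<Longrightarrow> norm (e s) \<le> C" unfolding bounded_iff by (metis imageI)
  have ei: "((\<lambda>r. F (u r) (y r) - F (u r) (z r)) has_integral e s) {0..s}" if "s \<in> {0..T}" for s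
    using has_integral_diff[OF y[unfolded solves_def, rule_format, OF that] z[unfolded solves_def, rule_format, OF that]]
    by (simp add: e_def)
  have bound: "norm (e s) \<le> C * (K * s) ^ n / fact n" if "s \<in> {0..T}" for s n
    using that
  proof (induction n arbitrary: s)
    case (Suc n)
    let ?g = "\<lambda>r. K * (C * (K * r) ^ n / fact n)"
    let ?G = "\<lambda>r. C * (K * r) ^ Suc n / fact (Suc n)"
    have d: "(?G has_vector_derivative ?g r) (at r within {0..s})" for r
    proof -
      have "((\<lambda>r. (K * r) ^ Suc n) has_real_derivative real (Suc n) * (K * r) ^ n * K) (at r within {0..s})"
        using DERIV_power_Suc[OF DERIV_cmult_Id[of K r "{0..s}"], of n] by (simp add: algebra_simps)
      then have "(?G has_real_derivative C * (real (Suc n) * (K * r) ^ n * K) / fact (Suc n)) (at r within {0..s})"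
        by (intro DERIV_cdivide DERIV_cmult)
      moreover have "C * (real (Suc n) * (K * r) ^ n * K) / fact (Suc n) = ?g r"
        unfolding fact_Suc by (simp add: divide_simps del: of_nat_Suc)
      ultimately show ?thesis by (simp only: has_real_derivative_iff_has_vector_derivative)
    qed
    have g: "(?g has_integral (?G s - ?G 0)) {0..s}"
      using Suc.prems by (intro fundamental_theorem_of_calculus d) auto
    have "norm (integral {0..s} (\<lambda>r. F (u r) (y r) - F (u r) (z r))) \<le> integral {0..s} ?g"
    proof (rule integral_norm_bound_integral)
      fix r assume r: "r \<in> {0..s}"
      then have "norm (F (u r) (y r) - F (u r) (z r)) \<le> K * norm (e r)"
        unfolding e_def using u by (intro lip) auto
      also have "\<dots> \<le> ?g r" using Suc r K by (intro mult_left_mono) auto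
      finally show "norm (F (u r) (y r) - F (u r) (z r)) \<le> ?g r" .
    qed (use ei[OF Suc.prems] g in \<open>auto simp: has_integral_integrable\<close>)
    then show ?case using integral_unique[OF ei[OF Suc.prems]] integral_unique[OF g] by simp
  qed (use C in simp)
  have "(\<lambda>n. C * (inverse (fact n) * (K * t) ^ n)) \<longlonglongrightarrow> C * 0"
    by (intro tendsto_intros summable_LIMSEQ_zero summable_exp)
  then have "(\<lambda>n. C * (K * t) ^ n / fact n) \<longlonglongrightarrow> 0" by (simp add: field_simps)
  then have "norm (e t) \<le> 0"
    by (rule LIMSEQ_le_const) (use bound[OF t] in auto)
  then show ?thesis by (simp add: e_def)
qed

lemma sol_eqI:
  fixes F :: "'c \<Rightarrow> 'a::euclidean_space \<Rightarrow> 'a"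
  assumes lip: "\<And>w x y. w \<in> \<Omega> \<Longrightarrow> norm (F w x - F w y) \<le> K * norm (x - y)" and K: "0 \<le> K"
    and u: "\<And>t. 0 \<le> t \<Longrightarrow> u t \<in> \<Omega>" and y: "\<And>T. solves F u x T y" and t: "0 \<le> t"
  shows "sol F t x u = y t"
proof -
  \<comment> \<open>\<open>sol\<close> prescribes the value \<open>x\<close> at negative times, so
    the function it describes is unique on the whole real line.\<close>
  let ?y = "\<lambda>s. if s < 0 then x else y s"
  have "(THE y. (\<forall>s<0. y s = x) \<and> (\<forall>s\<ge>0. ((\<lambda>r. F (u r) (y r)) has_integral (y s - x)) {0..s})) = ?y"
  proof (rule the_equality, intro conjI allI impI)
    fix s :: real assume s: "0 \<le> s"
    have "((\<lambda>r. F (u r) (y r)) has_integral (y s - x)) {0..s}" using y[of s] s by (auto simp: solves_def)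
    then show "((\<lambda>r. F (u r) (?y r)) has_integral (?y s - x)) {0..s}"
      using s by (subst has_integral_cong[where g = "\<lambda>r. F (u r) (y r)"]) auto
  next
    fix z assume z: "(\<forall>s<0. z s = x) \<and> (\<forall>s\<ge>0. ((\<lambda>r. F (u r) (z r)) has_integral (z s - x)) {0..s})"
    show "z = ?y"
    proof
      fix s
      have "z s = y s" if "0 \<le> s"
        by (rule solves_unique[OF lip K u, where x = x and T = s]) (use z y that in \<open>auto simp: solves_def\<close>)
      then show "z s = ?y s" using z by auto
    qed
  qed simp
  then show ?thesis unfolding sol_def using t by simp
qed

text \<open>One family of linear fields \<open>M w\<close> carries a control system on every level
  \<open>z\<close>; the bound \<open>K\<close> is a Lipschitz constant for all of them.\<close>

locale control_lift =
  fixes M :: "'c \<Rightarrow> ('b::euclidean_space \<times> real) endo" and \<Omega> :: "'c set" and K :: real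
  assumes nonempty: "\<Omega> \<noteq> {}"
    and norm_field: "w \<in> \<Omega> \<Longrightarrow> norm (M w) \<le> K"
    and snd_field: "snd (M w \<star> v) = 0"
    and rank_cond: "p \<noteq> 0 \<Longrightarrow> \<exists>Y\<in>lie_hull (M ` \<Omega>). Y \<star> p = (y, 0)"
begin

sublocale lifted_system "M ` \<Omega>"
  by standard (auto simp: snd_field rank_cond)

definition field :: "real \<Rightarrow> 'c \<Rightarrow> 'b \<Rightarrow> 'b" where
  "field z w x = fst (M w \<star> (x, z))"

abbreviation "controls \<equiv> pc_controls \<Omega>"

abbreviation "phi z \<equiv> sol (field z)"

lemma K_nonneg: "0 \<le> K"
  using nonempty norm_field norm_ge_zero order_trans by blast

lemma field_lipschitz:
  assumes "w \<in> \<Omega>" shows "norm (field z w x - field z w y) \<le> K * norm (x - y)"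
proof -
  have "field z w x - field z w y = fst (M w \<star> (x - y, 0))"
    unfolding field_def by (simp flip: endo_apply.diff_right fst_diff)
  also have "norm \<dots> \<le> norm (M w \<star> (x - y, 0))" by (metis norm_fst_le prod.collapse)
  also have "\<dots> \<le> K * norm (x - y)"
    using norm_endo_apply[of "M w" "(x - y, 0)"] norm_field[OF assms]
    by (simp add: norm_Pair) (meson mult_right_mono norm_ge_zero order_trans)
  finally show ?thesis .
qed

lemma linear_field_lipschitz:
  assumes "w \<in> \<Omega>" shows "norm (M w \<star> p - M w \<star> q) \<le> K * norm (p - q)"
  using norm_endo_apply[of "M w" "p - q"] norm_field[OF assms]
  by (simp add: endo_apply_simps) (meson mult_right_mono norm_ge_zero order_trans)

lemma exp_has_integral:
  assumes "a \<le> t"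
  shows "((\<lambda>r. M w \<star> exp ((r - a) *\<^sub>R M w) \<star> v) has_integral (exp ((t - a) *\<^sub>R M w) \<star> v - v)) {a..t}"
proof -
  have "((\<lambda>r. exp ((r - a) *\<^sub>R M w) \<star> v) has_vector_derivative M w \<star> exp ((r - a) *\<^sub>R M w) \<star> v) (at r within {a..t})" for r
  proof -
    have "((\<lambda>t. exp (t *\<^sub>R M w)) \<circ> (\<lambda>r. r - a) has_vector_derivative 1 *\<^sub>R (M w * exp ((r - a) *\<^sub>R M w))) (at r within {a..t})"
      by (intro vector_diff_chain_within has_vector_derivative_at_within[OF exp_scaleR_has_vector_derivative_left])
        (auto intro!: derivative_eq_intros simp: has_real_derivative_iff_has_vector_derivative[symmetric])
    from bounded_linear.has_vector_derivative[OF endo_apply.bounded_linear_left[of v] this]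
    show ?thesis by (simp add: o_def)
  qed
  from fundamental_theorem_of_calculus[OF assms this] show ?thesis by simp
qed

text \<open>Induction on the number of switching points inside \<open>(0, T)\<close>; a single
  exponential follows the last of them. Constancy is required only before \<open>T\<close> because
  the control may jump at the right end, and one point does not affect the integral.\<close>

lemma fundamental_solution_segment:
  assumes "finite S" "0 \<le> T" "\<And>t. 0 \<le> t \<Longrightarrow> u t \<in> \<Omega>"
    and "\<And>t t'. 0 \<le> t \<Longrightarrow> t \<le> t' \<Longrightarrow> t' < T \<Longrightarrow> S \<inter> {t<..t'} = {} \<Longrightarrow> u t' = u t"
  shows "\<exists>\<Phi>. (\<forall>t\<in>{0..T}. \<Phi> t \<in> semigroup_of (M ` \<Omega>)) \<and> (\<forall>v. solves (\<lambda>w. (\<star>) (M w)) u v T (\<lambda>t. \<Phi> t \<star> v))"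
  using assms(2,4)
proof (induction "card (S \<inter> {0<..<T})" arbitrary: T)
  case 0
  then have e: "S \<inter> {0<..<T} = {}" using assms(1) by (simp add: card_eq_0_iff)
  have c: "u r = u 0" if "0 \<le> r" "r < T" for r
    using that e by (intro 0(3)) auto
  show ?case
  proof (intro exI[of _ "\<lambda>t. exp (t *\<^sub>R M (u 0))"] conjI ballI allI)
    show "exp (t *\<^sub>R M (u 0)) \<in> semigroup_of (M ` \<Omega>)" if "t \<in> {0..T}" for t
      using that assms(3)[of 0] by (intro semigroup_of_exp) auto
    fix v
    show "solves (\<lambda>w. (\<star>) (M w)) u v T (\<lambda>t. exp (t *\<^sub>R M (u 0)) \<star> v)"
      unfolding solves_def
    proof
      fix s assume s: "s \<in> {0..T}"
      have "((\<lambda>r. M (u 0) \<star> exp (r *\<^sub>R M (u 0)) \<star> v) has_integral exp (s *\<^sub>R M (u 0)) \<star> v - v) {0..s}"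
        using exp_has_integral[of 0 s "u 0" v] s by simp
      then show "((\<lambda>r. M (u r) \<star> exp (r *\<^sub>R M (u 0)) \<star> v) has_integral exp (s *\<^sub>R M (u 0)) \<star> v - v) {0..s}"
      proof (rule has_integral_spike_finite[of "{T}", rotated 2])
        show "M (u r) \<star> exp (r *\<^sub>R M (u 0)) \<star> v = M (u 0) \<star> exp (r *\<^sub>R M (u 0)) \<star> v" if "r \<in> {0..s} - {T}" for r
          using c[of r] s that by auto
      qed simp
    qed
  qed
next
  case (Suc k)
  have fin: "finite (S \<inter> {0<..<T})" and ne: "S \<inter> {0<..<T} \<noteq> {}"
    using assms(1) Suc(2) by (auto simp: card_eq_0_iff)
  define \<tau> where "\<tau> = Max (S \<inter> {0<..<T})"
  have \<tau>: "\<tau> \<in> S" "0 < \<tau>" "\<tau> < T" using Max_in[OF fin ne] by (auto simp: \<tau>_def)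
  have \<tau>max: "s \<le> \<tau>" if "s \<in> S" "0 < s" "s < T" for s using Max_ge[OF fin, of s] that by (auto simp: \<tau>_def)
  have "S \<inter> {0<..<T} = insert \<tau> (S \<inter> {0<..<\<tau>})" using \<tau> \<tau>max by (force simp: order_less_le)
  then have "card (S \<inter> {0<..<T}) = Suc (card (S \<inter> {0<..<\<tau>}))" using assms(1) by simp
  then have "k = card (S \<inter> {0<..<\<tau>})" using Suc(2) by simp
  moreover have "u t' = u t" if "0 \<le> t" "t \<le> t'" "t' < \<tau>" "S \<inter> {t<..t'} = {}" for t t'
    using that \<tau> by (intro Suc.prems(2)) auto
  ultimately obtain \<Phi>
    where \<Phi>: "\<And>t. t \<in> {0..\<tau>} \<Longrightarrow> \<Phi> t \<in> semigroup_of (M ` \<Omega>)" "\<And>v. solves (\<lambda>w. (\<star>) (M w)) u v \<tau> (\<lambda>t. \<Phi> t \<star> v)"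
    using Suc.hyps(1)[of \<tau>] \<tau>(2) by (metis less_imp_le)
  have c: "u r = u \<tau>" if "\<tau> \<le> r" "r < T" for r
    using that \<tau> \<tau>max by (intro Suc.prems(2)) (auto, force)
  define \<Psi> where "\<Psi> t = (if t \<le> \<tau> then \<Phi> t else exp ((t - \<tau>) *\<^sub>R M (u \<tau>)) * \<Phi> \<tau>)" for t
  show ?case
  proof (intro exI[of _ \<Psi>] conjI ballI allI)
    show "\<Psi> t \<in> semigroup_of (M ` \<Omega>)" if "t \<in> {0..T}" for t
      using that \<tau> assms(3)[of \<tau>] \<Phi>(1) unfolding \<Psi>_def by (auto intro!: semigroup_of_mult semigroup_of_exp)
    fix v
    show "solves (\<lambda>w. (\<star>) (M w)) u v T (\<lambda>t. \<Psi> t \<star> v)"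
      unfolding solves_def
    proof
      fix s assume s: "s \<in> {0..T}"
      have low: "((\<lambda>r. M (u r) \<star> \<Psi> r \<star> v) has_integral \<Psi> s \<star> v - v) {0..s}" if "s \<in> {0..\<tau>}" for s
      proof -
        have "((\<lambda>r. M (u r) \<star> \<Phi> r \<star> v) has_integral \<Phi> s \<star> v - v) {0..s}"
          using \<Phi>(2)[of v] that unfolding solves_def by blast
        then have "((\<lambda>r. M (u r) \<star> \<Psi> r \<star> v) has_integral \<Phi> s \<star> v - v) {0..s}"
          by (rule has_integral_eq[rotated]) (use that in \<open>auto simp: \<Psi>_def\<close>)
        then show ?thesis using that by (simp add: \<Psi>_def)
      qed
      show "((\<lambda>r. M (u r) \<star> \<Psi> r \<star> v) has_integral \<Psi> s \<star> v - v) {0..s}"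
      proof (cases "s \<le> \<tau>")
        case True then show ?thesis using low s by simp
      next
        case False
        have \<Psi>e: "\<Psi> r = exp ((r - \<tau>) *\<^sub>R M (u \<tau>)) * \<Phi> \<tau>" if "\<tau> \<le> r" for r
          using that by (auto simp: \<Psi>_def)
        have "((\<lambda>r. M (u \<tau>) \<star> exp ((r - \<tau>) *\<^sub>R M (u \<tau>)) \<star> \<Phi> \<tau> \<star> v) has_integral
            exp ((s - \<tau>) *\<^sub>R M (u \<tau>)) \<star> \<Phi> \<tau> \<star> v - \<Phi> \<tau> \<star> v) {\<tau>..s}"
          using exp_has_integral[of \<tau> s "u \<tau>" "\<Phi> \<tau> \<star> v"] False by simp
        then have "((\<lambda>r. M (u r) \<star> \<Psi> r \<star> v) has_integral
            exp ((s - \<tau>) *\<^sub>R M (u \<tau>)) \<star> \<Phi> \<tau> \<star> v - \<Phi> \<tau> \<star> v) {\<tau>..s}"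
        proof (rule has_integral_spike_finite[of "{T}", rotated 2])
          show "M (u r) \<star> \<Psi> r \<star> v = M (u \<tau>) \<star> exp ((r - \<tau>) *\<^sub>R M (u \<tau>)) \<star> \<Phi> \<tau> \<star> v" if "r \<in> {\<tau>..s} - {T}" for r
            using c[of r] s that by (auto simp: \<Psi>e)
        qed simp
        from has_integral_combine[OF _ _ low[of \<tau>] this] show ?thesis using \<tau> False by (simp add: \<Psi>e)
      qed
    qed
  qed
qed

lemma fundamental_solution:
  assumes u: "u \<in> controls"
  obtains \<Phi> where "\<And>t. 0 \<le> t \<Longrightarrow> \<Phi> t \<in> semigroup_of (M ` \<Omega>)" "\<And>v T. solves (\<lambda>w. (\<star>) (M w)) u v T (\<lambda>t. \<Phi> t \<star> v)"
proof -
  have "\<exists>\<Phi>. (\<forall>t\<in>{0..T}. \<Phi> t \<in> semigroup_of (M ` \<Omega>)) \<and> (\<forall>v. solves (\<lambda>w. (\<star>) (M w)) u v T (\<lambda>t. \<Phi> t \<star> v))"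
    if T: "0 \<le> T" for T
  proof -
    obtain S where S: "finite S" "\<And>t t'. 0 \<le> t \<Longrightarrow> t \<le> t' \<Longrightarrow> t' \<le> T \<Longrightarrow> S \<inter> {t<..t'} = {} \<Longrightarrow> u t' = u t"
      using pc_controlsD(2)[OF u T] by metis
    show ?thesis
      by (rule fundamental_solution_segment[OF S(1) T pc_controlsD(1)[OF u]]) (auto intro: S(2))
  qed
  then obtain \<Phi> where \<Phi>: "\<And>T t. 0 \<le> T \<Longrightarrow> t \<in> {0..T} \<Longrightarrow> \<Phi> T t \<in> semigroup_of (M ` \<Omega>)"
    "\<And>T v. 0 \<le> T \<Longrightarrow> solves (\<lambda>w. (\<star>) (M w)) u v T (\<lambda>t. \<Phi> T t \<star> v)" by metis
  \<comment> \<open>By uniqueness the operators for different horizons agree where both are defined,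
    so the diagonal \<open>\<Phi> t t\<close> glues them together.\<close>
  have agree: "\<Phi> T t \<star> v = \<Phi> t t \<star> v" if "t \<in> {0..T}" for T t v
  proof (rule solves_unique[where F = "\<lambda>w. (\<star>) (M w)" and x = v and T = t and y = "\<lambda>s. \<Phi> T s \<star> v"
        and z = "\<lambda>s. \<Phi> t s \<star> v", OF linear_field_lipschitz K_nonneg pc_controlsD(1)[OF u]])
    show "solves (\<lambda>w. (\<star>) (M w)) u v t (\<lambda>t. \<Phi> T t \<star> v)"
      using \<Phi>(2)[of T v] that by (auto simp: solves_def)
    show "solves (\<lambda>w. (\<star>) (M w)) u v t (\<lambda>s. \<Phi> t s \<star> v)" "t \<in> {0..t}"
      using \<Phi>(2)[of t v] that by auto
  qed
  show thesis
  proof (rule that[of "\<lambda>t. \<Phi> t t"])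
    show "\<Phi> t t \<in> semigroup_of (M ` \<Omega>)" if "0 \<le> t" for t using \<Phi>(1) that by simp
    show "solves (\<lambda>w. (\<star>) (M w)) u v T (\<lambda>t. \<Phi> t t \<star> v)" for v T
      unfolding solves_def
    proof
      fix s assume s: "s \<in> {0..T}"
      then have "((\<lambda>r. M (u r) \<star> \<Phi> s r \<star> v) has_integral \<Phi> s s \<star> v - v) {0..s}"
        using \<Phi>(2)[of s v] by (auto simp: solves_def)
      then show "((\<lambda>r. M (u r) \<star> \<Phi> r r \<star> v) has_integral \<Phi> s s \<star> v - v) {0..s}"
        by (rule has_integral_eq[rotated]) (rule arg_cong[OF agree])
    qed
  qed
qed

lemma phi_fundamental:
  assumes u: "u \<in> controls"
  obtains \<Phi> where "\<And>t. 0 \<le> t \<Longrightarrow> \<Phi> t \<in> semigroup_of (M ` \<Omega>)"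
    "\<And>t z x. 0 \<le> t \<Longrightarrow> \<Phi> t \<star> (x, z) = (phi z t x u, z)"
    "\<And>T z x. solves (field z) u x T (\<lambda>t. phi z t x u)"
proof -
  obtain \<Phi> where \<Phi>: "\<And>t. 0 \<le> t \<Longrightarrow> \<Phi> t \<in> semigroup_of (M ` \<Omega>)" "\<And>v T. solves (\<lambda>w. (\<star>) (M w)) u v T (\<lambda>t. \<Phi> t \<star> v)"
    using fundamental_solution[OF u] by blast
  have sv: "solves (field z) u x T (\<lambda>t. fst (\<Phi> t \<star> (x, z)))" for T z x
    unfolding solves_def
  proof
    fix s assume s: "s \<in> {0..T}"
    then have "((\<lambda>r. M (u r) \<star> \<Phi> r \<star> (x, z)) has_integral \<Phi> s \<star> (x, z) - (x, z)) {0..s}"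
      using \<Phi>(2)[of "(x, z)" T] by (auto simp: solves_def)
    from has_integral_linear[OF this bounded_linear_fst]
    have "((\<lambda>r. fst (M (u r) \<star> \<Phi> r \<star> (x, z))) has_integral fst (\<Phi> s \<star> (x, z)) - x) {0..s}"
      by (simp add: o_def)
    then show "((\<lambda>r. field z (u r) (fst (\<Phi> r \<star> (x, z)))) has_integral fst (\<Phi> s \<star> (x, z)) - x) {0..s}"
    proof (rule has_integral_eq[rotated])
      fix r assume "r \<in> {0..s}"
      then have "snd (\<Phi> r \<star> (x, z)) = z" using snd_semigroup[OF \<Phi>(1)] by simp
      then show "fst (M (u r) \<star> \<Phi> r \<star> (x, z)) = field z (u r) (fst (\<Phi> r \<star> (x, z)))"
        unfolding field_def by (metis prod.collapse)
    qed
  qed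
  have eq: "phi z t x u = fst (\<Phi> t \<star> (x, z))" if "0 \<le> t" for t z x
    by (rule sol_eqI[OF field_lipschitz K_nonneg pc_controlsD(1)[OF u] sv that])
  show thesis
  proof
    show "\<Phi> t \<in> semigroup_of (M ` \<Omega>)" if "0 \<le> t" for t using \<Phi>(1) that .
    show "\<Phi> t \<star> (x, z) = (phi z t x u, z)" if "0 \<le> t" for t z x
      using eq[OF that] snd_semigroup[OF \<Phi>(1)[OF that]] by (metis prod.collapse snd_conv)
    show "solves (field z) u x T (\<lambda>t. phi z t x u)" for T z x
      unfolding solves_def
    proof
      fix s assume s: "s \<in> {0..T}"
      have "((\<lambda>r. field z (u r) (fst (\<Phi> r \<star> (x, z)))) has_integral fst (\<Phi> s \<star> (x, z)) - x) {0..s}"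
        using sv s unfolding solves_def by blast
      then have "((\<lambda>r. field z (u r) (phi z r x u)) has_integral fst (\<Phi> s \<star> (x, z)) - x) {0..s}"
        by (rule has_integral_eq[rotated]) (simp add: eq)
      then show "((\<lambda>r. field z (u r) (phi z r x u)) has_integral phi z s x u - x) {0..s}"
        using s by (simp add: eq)
    qed
  qed
qed

end

section \<open>Control sets\<close>

text \<open>Every point approximates the common point \<open>e\<close>, and \<open>e\<close>
  approximates every point. Continuity in the initial value makes approximate reachability
  transitive.\<close>

lemma cs_prop_Union:
  assumes cont: "\<And>t u. 0 \<le> t \<Longrightarrow> u \<in> U \<Longrightarrow> continuous_map X X (\<lambda>x. phi t x u)"
    and trans: "\<And>x y. y \<in> pos_orbit phi U x \<Longrightarrow> pos_orbit phi U y \<subseteq> pos_orbit phi U x"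
    and cs: "\<And>D. D \<in> \<D> \<Longrightarrow> cs_prop X phi U D" and e: "\<And>D. D \<in> \<D> \<Longrightarrow> e \<in> D" and ne: "\<D> \<noteq> {}"
  shows "cs_prop X phi U (\<Union>\<D>)"
proof -
  have cl: "y \<in> X closure_of pos_orbit phi U x"
    if ex: "e \<in> X closure_of pos_orbit phi U x" and ye: "y \<in> X closure_of pos_orbit phi U e" for x y
    unfolding in_closure_of
  proof (intro conjI allI impI)
    show "y \<in> topspace X" using ye by (simp add: in_closure_of)
    fix T assume T: "y \<in> T \<and> openin X T"
    then obtain t u where t: "0 \<le> t" "u \<in> U" "phi t e u \<in> T"
      using ye unfolding in_closure_of pos_orbit_def by blast
    let ?W = "{x \<in> topspace X. phi t x u \<in> T}"
    have "openin X ?W" using openin_continuous_map_preimage[OF cont[OF t(1,2)]] T by blast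
    moreover have "e \<in> ?W" using ex t by (simp add: in_closure_of)
    ultimately have "\<exists>b. b \<in> pos_orbit phi U x \<and> b \<in> ?W"
      using ex[unfolded in_closure_of] by (meson)
    then obtain b where b: "b \<in> pos_orbit phi U x" "phi t b u \<in> T" by blast
    have "phi t b u \<in> pos_orbit phi U b" unfolding pos_orbit_def using t by blast
    then show "\<exists>a. a \<in> pos_orbit phi U x \<and> a \<in> T" using trans[OF b(1)] b(2) by blast
  qed
  show ?thesis
    unfolding cs_prop_def
  proof (intro conjI ballI subsetI)
    show "\<Union>\<D> \<noteq> {}" using ne e by blast
    show "x \<in> topspace X" if "x \<in> \<Union>\<D>" for x using that cs unfolding cs_prop_def by blast
    show "\<exists>u\<in>U. \<forall>t\<ge>0. phi t x u \<in> \<Union>\<D>" if "x \<in> \<Union>\<D>" for x using that cs unfolding cs_prop_def by blast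
    fix x y assume "x \<in> \<Union>\<D>" "y \<in> \<Union>\<D>"
    then obtain D D' where "x \<in> D" "D \<in> \<D>" "y \<in> D'" "D' \<in> \<D>" by blast
    then have "e \<in> X closure_of pos_orbit phi U x" "y \<in> X closure_of pos_orbit phi U e"
      using cs[of D] cs[of D'] e[of D] e[of D'] unfolding cs_prop_def by blast+
    then show "y \<in> X closure_of pos_orbit phi U x" by (rule cl)
  qed
qed

lemma control_set_absorbs:
  assumes cont: "\<And>t u. 0 \<le> t \<Longrightarrow> u \<in> U \<Longrightarrow> continuous_map X X (\<lambda>x. phi t x u)"
    and trans: "\<And>x y. y \<in> pos_orbit phi U x \<Longrightarrow> pos_orbit phi U y \<subseteq> pos_orbit phi U x"
    and D: "control_set X phi U D" and E: "cs_prop X phi U E" and e: "e \<in> D" "e \<in> E"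
  shows "E \<subseteq> D"
proof -
  have "cs_prop X phi U (\<Union>{D, E})"
    by (rule cs_prop_Union[OF cont trans]) (use D E e in \<open>auto simp: control_set_def\<close>)
  then have "D \<union> E = D" using D unfolding control_set_def by auto
  then show ?thesis by blast
qed

lemma control_set_exists:
  assumes cont: "\<And>t u. 0 \<le> t \<Longrightarrow> u \<in> U \<Longrightarrow> continuous_map X X (\<lambda>x. phi t x u)"
    and trans: "\<And>x y. y \<in> pos_orbit phi U x \<Longrightarrow> pos_orbit phi U y \<subseteq> pos_orbit phi U x"
    and E: "cs_prop X phi U E"
  shows "\<exists>D. control_set X phi U D \<and> E \<subseteq> D"
proof -
  let ?D = "{D. cs_prop X phi U D \<and> E \<subseteq> D}"
  obtain e where e: "e \<in> E" using E unfolding cs_prop_def by blast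
  have "cs_prop X phi U (\<Union>?D)"
    by (rule cs_prop_Union[OF cont trans, where e = e]) (use E e in auto)
  then show ?thesis using E unfolding control_set_def by (intro exI[of _ "\<Union>?D"]) blast
qed

section \<open>Periodic points and classes of mutually reachable points\<close>

context lifted_system
begin

text \<open>Positive total time is demanded because the empty word returns trivially; only a genuine
  period can be repeated to fill all \<open>t \<ge> 0\<close>.\<close>

definition loop :: "'b \<times> real \<Rightarrow> bool" where
  "loop p \<longleftrightarrow> (\<exists>ps. (\<forall>(t, X)\<in>set ps. 0 \<le> t \<and> X \<in> Ms) \<and> 0 < sum_list (map fst ps) \<and> word_prod ps \<star> p = p)"

lemma word_time_nonneg: "\<forall>(t::real, X)\<in>set ps. 0 \<le> t \<and> X \<in> Ms \<Longrightarrow> 0 \<le> sum_list (map fst ps)"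
  by (induction ps) auto

lemma loop_mutual:
  assumes "loop p" "mutual p q" shows "loop q"
proof -
  obtain ps where ps: "\<forall>(t, X)\<in>set ps. 0 \<le> t \<and> X \<in> Ms" "0 < sum_list (map fst ps)" "word_prod ps \<star> p = p"
    using assms(1) unfolding loop_def by blast
  obtain qs rs where qs: "\<forall>(t, X)\<in>set qs. 0 \<le> t \<and> X \<in> Ms" "word_prod qs \<star> p = q"
    and rs: "\<forall>(t, X)\<in>set rs. 0 \<le> t \<and> X \<in> Ms" "word_prod rs \<star> q = p"
    using assms(2) unfolding mutual_def reach_def semigroup_of_def by blast
  show ?thesis unfolding loop_def
    by (intro exI[of _ "qs @ ps @ rs"])
      (use ps qs rs word_time_nonneg[OF qs(1)] word_time_nonneg[OF rs(1)] in \<open>auto simp: word_prod_append\<close>)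
qed

lemma regular_word_loop:
  assumes ps: "regular_word Ms ps" and k: "k \<in> semigroup_of Ms" and p: "(word_prod ps * k) \<star> p = p"
  shows "loop p"
proof -
  \<comment> \<open>The vector \<open>(b, 0)\<close> serves as point and as direction: the tangent
    space of the empty word is zero and cannot produce it, so a regular word is nonempty and takes
    positive time.\<close>
  obtain b :: 'b where "b \<in> Basis" using nonempty_Basis by blast
  then have b: "b \<noteq> 0" by auto
  then have "(b, 0::real) \<noteq> 0" by (simp add: zero_prod_def)
  then have "ps \<noteq> []" using regular_word_surjective[OF ps, of "(b, 0)" "(b, 0)"] by (auto simp: endo_apply_simps)
  then obtain t X ps' where ps': "ps = (t, X) # ps'" by (cases ps) auto
  have w: "ps \<in> words Ms" using ps by (simp add: regular_word_def)
  then have "0 < t" "0 \<le> sum_list (map fst ps')"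
    using word_time_nonneg[of ps'] words_nonneg[OF w] by (auto simp: ps' words_def)
  then have pos: "0 < sum_list (map fst ps)" by (simp add: ps')
  obtain qs where qs: "\<forall>(t, X)\<in>set qs. 0 \<le> t \<and> X \<in> Ms" "k = word_prod qs"
    using k unfolding semigroup_of_def by blast
  show ?thesis unfolding loop_def
    by (intro exI[of _ "ps @ qs"])
      (use pos p qs words_nonneg[OF w] word_time_nonneg[OF qs(1)] in \<open>auto simp: word_prod_append\<close>)
qed

end

context control_lift
begin

lemma phi_solves: "u \<in> controls \<Longrightarrow> solves (field z) u x T (\<lambda>t. phi z t x u)"
  by (rule phi_fundamental)

lemma phi_semigroup:
  assumes "u \<in> controls" "0 \<le> t"
  obtains H where "H \<in> semigroup_of (M ` \<Omega>)" "\<And>x z. H \<star> (x, z) = (phi z t x u, z)"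
  using phi_fundamental[OF assms(1)] assms(2) by metis

lemma phi_reach: "u \<in> controls \<Longrightarrow> 0 \<le> t \<Longrightarrow> reach (x, z) (phi z t x u, z)"
  unfolding reach_def by (metis phi_semigroup)

lemma phi_cocycle:
  assumes u: "u \<in> controls" and s: "0 \<le> s" and t: "0 \<le> t"
  shows "phi z (s + t) x u = phi z s (phi z t x u) (\<lambda>r. u (r + t))"
proof -
  have sh: "(\<lambda>r. u (r + t)) \<in> controls" by (rule pc_controls_shift[OF u t])
  let ?f = "\<lambda>r. field z (u r) (phi z r x u)"
  have hi: "(?f has_integral phi z r x u - x) {0..r}" if "0 \<le> r" for r
    using phi_solves[OF u, of z x r] that by (auto simp: solves_def)
  have "solves (field z) (\<lambda>r. u (r + t)) (phi z t x u) T (\<lambda>s. phi z (s + t) x u)" for T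
    unfolding solves_def
  proof
    fix s assume "s \<in> {0..T}"
    then have s: "0 \<le> s" by simp
    have "?f integrable_on {0..s + t}" using hi[of "s + t"] s t by auto
    then have i: "?f integrable_on {t..s + t}" by (rule integrable_on_subinterval) (use t in auto)
    from has_integral_combine[OF t _ hi[OF t] integrable_integral[OF i]] s
    have "(?f has_integral (phi z t x u - x + integral {t..s + t} ?f)) {0..s + t}" by simp
    from has_integral_unique[OF this hi] s t
    have "phi z t x u - x + integral {t..s + t} ?f = phi z (s + t) x u - x" by simp
    then have "integral {t..s + t} ?f = phi z (s + t) x u - phi z t x u" by (simp add: algebra_simps)
    then have "(?f has_integral phi z (s + t) x u - phi z t x u) {0 + t..s + t}"
      using integrable_integral[OF i] by simp
    then show "((\<lambda>r. field z (u (r + t)) (phi z (r + t) x u)) has_integral phi z (s + t) x u - phi z t x u) {0..s}"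
      unfolding has_integral_shift_Icc_real[symmetric] by (simp add: o_def add.commute)
  qed
  from sol_eqI[OF field_lipschitz K_nonneg pc_controlsD(1)[OF sh] this s] show ?thesis by simp
qed

lemma phi_cong:
  assumes u: "u \<in> controls" and v: "v \<in> controls" and T: "0 \<le> T" and eq: "\<And>r. 0 \<le> r \<Longrightarrow> r < T \<Longrightarrow> u r = v r"
  shows "phi z T x u = phi z T x v"
proof (rule solves_unique[where F = "field z" and x = x and T = T and y = "\<lambda>t. phi z t x u"
      and z = "\<lambda>t. phi z t x v", OF field_lipschitz K_nonneg pc_controlsD(1)[OF u] phi_solves[OF u]])
  show "solves (field z) u x T (\<lambda>t. phi z t x v)"
    unfolding solves_def
  proof
    fix s assume s: "s \<in> {0..T}"
    then have "((\<lambda>r. field z (v r) (phi z r x v)) has_integral phi z s x v - x) {0..s}"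
      using phi_solves[OF v, of z x T] by (auto simp: solves_def)
    then show "((\<lambda>r. field z (u r) (phi z r x v)) has_integral phi z s x v - x) {0..s}"
      by (rule has_integral_spike_finite[of "{T}", rotated 2]) (use s eq in auto)
  qed
qed (use T in auto)

lemma phi_const:
  assumes w: "w \<in> \<Omega>" and t: "0 \<le> t"
  shows "exp (t *\<^sub>R M w) \<star> (x, z) = (phi z t x (\<lambda>_. w), z)"
proof -
  have sn: "snd (exp (r *\<^sub>R M w) \<star> (x, z)) = z" for r
    using snd_exp_generator[of "M w" r "(x, z)"] w by simp
  have "phi z t x (\<lambda>_. w) = fst (exp (t *\<^sub>R M w) \<star> (x, z))"
  proof (rule sol_eqI[OF field_lipschitz K_nonneg _ _ t])
    show "solves (field z) (\<lambda>_. w) x T (\<lambda>t. fst (exp (t *\<^sub>R M w) \<star> (x, z)))" for T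
      unfolding solves_def
    proof
      fix s assume "s \<in> {0..T}"
      then have "((\<lambda>r. M w \<star> exp (r *\<^sub>R M w) \<star> (x, z)) has_integral exp (s *\<^sub>R M w) \<star> (x, z) - (x, z)) {0..s}"
        using exp_has_integral[of 0 s w "(x, z)"] by simp
      from has_integral_linear[OF this bounded_linear_fst]
      have "((\<lambda>r. fst (M w \<star> exp (r *\<^sub>R M w) \<star> (x, z))) has_integral fst (exp (s *\<^sub>R M w) \<star> (x, z)) - x) {0..s}"
        by (simp add: o_def)
      moreover have "(fst (exp (r *\<^sub>R M w) \<star> (x, z)), z) = exp (r *\<^sub>R M w) \<star> (x, z)" for r
        using sn by (metis prod.collapse)
      ultimately show "((\<lambda>r. field z w (fst (exp (r *\<^sub>R M w) \<star> (x, z)))) has_integral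
          fst (exp (s *\<^sub>R M w) \<star> (x, z)) - x) {0..s}"
        by (simp add: field_def)
    qed
  qed (use w in auto)
  then show ?thesis using sn[of t] by (metis prod.collapse)
qed

lemma word_control:
  assumes "\<forall>(t, X)\<in>set ps. 0 \<le> t \<and> X \<in> M ` \<Omega>"
  shows "\<exists>u\<in>controls. \<forall>x z. word_prod ps \<star> (x, z) = (phi z (sum_list (map fst ps)) x u, z)"
  using assms
proof (induction ps)
  case Nil
  obtain w where w: "w \<in> \<Omega>" using nonempty by blast
  then show ?case using phi_const[OF w, of 0] pc_controls_const[OF w]
    by (intro bexI[of _ "\<lambda>_. w"]) simp_all
next
  case (Cons a ps)
  obtain t w where a: "a = (t, M w)" "0 \<le> t" "w \<in> \<Omega>" using Cons.prems by (cases a) auto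
  obtain u where u: "u \<in> controls" "\<And>x z. word_prod ps \<star> (x, z) = (phi z (sum_list (map fst ps)) x u, z)"
    using Cons.IH Cons.prems by auto
  let ?T = "sum_list (map fst ps)"
  have T: "0 \<le> ?T" using word_time_nonneg[of ps] Cons.prems by auto
  \<comment> \<open>The tail of the word acts first, so its control \<open>u\<close> runs up to
    \<open>?T\<close> and the head letter \<open>w\<close> takes over afterwards.\<close>
  let ?v = "\<lambda>r. if r < ?T then u r else w"
  have v: "?v \<in> controls" by (rule pc_controls_switch[OF u(1) a(3)])
  have "word_prod (a # ps) \<star> (x, z) = (phi z (sum_list (map fst (a # ps))) x ?v, z)" for x z
  proof -
    have "phi z ?T x ?v = phi z ?T x u" using T by (intro phi_cong[OF v u(1)]) auto
    then have "phi z (t + ?T) x ?v = phi z t (phi z ?T x u) (\<lambda>r. ?v (r + ?T))"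
      using phi_cocycle[OF v a(2) T] by simp
    also have "\<dots> = phi z t (phi z ?T x u) (\<lambda>_. w)"
      by (intro phi_cong[OF pc_controls_shift[OF v T] pc_controls_const[OF a(3)] a(2)]) auto
    finally show ?thesis using phi_const[OF a(3,2)] by (simp add: a(1) u(2))
  qed
  then show ?case using v by blast
qed

lemma pos_orbit_iff: "y \<in> pos_orbit (phi z) controls x \<longleftrightarrow> reach (x, z) (y, z)"
proof
  assume "y \<in> pos_orbit (phi z) controls x"
  then show "reach (x, z) (y, z)" unfolding pos_orbit_def using phi_reach by auto
next
  assume "reach (x, z) (y, z)"
  then obtain ps where ps: "\<forall>(t, X)\<in>set ps. 0 \<le> t \<and> X \<in> M ` \<Omega>" "word_prod ps \<star> (x, z) = (y, z)"
    unfolding reach_def semigroup_of_def by blast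
  then obtain u where "u \<in> controls" "phi z (sum_list (map fst ps)) x u = y"
    using word_control[OF ps(1)] by auto
  then show "y \<in> pos_orbit (phi z) controls x"
    unfolding pos_orbit_def using word_time_nonneg[OF ps(1)] by blast
qed

lemma pos_orbit_trans:
  "y \<in> pos_orbit (phi z) controls x \<Longrightarrow> pos_orbit (phi z) controls y \<subseteq> pos_orbit (phi z) controls x"
  using reach_trans by (auto simp: pos_orbit_iff)

lemma continuous_phi:
  assumes "u \<in> controls" "0 \<le> t" shows "continuous_on UNIV (\<lambda>x. phi z t x u)"
proof -
  obtain H where "\<And>x z. H \<star> (x, z) = (phi z t x u, z)"
    using phi_semigroup[OF assms] by metis
  then have "(\<lambda>x. phi z t x u) = (\<lambda>x. fst (H \<star> (x, z)))" by simp
  moreover have "continuous_on UNIV \<dots>" by (intro continuous_intros endo_apply.continuous_on)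
  ultimately show ?thesis by metis
qed

text \<open>Repeat the return word periodically. From any time on, the trajectory comes back to
  \<open>x\<close> at some later multiple of the period, so it never leaves the class of
  \<open>x\<close>.\<close>

lemma loop_viable:
  assumes "loop (x, z)"
  shows "\<exists>u\<in>controls. \<forall>t\<ge>0. mutual (x, z) (phi z t x u, z)"
proof -
  obtain ps where ps: "\<forall>(t, X)\<in>set ps. 0 \<le> t \<and> X \<in> M ` \<Omega>" "0 < sum_list (map fst ps)"
    "word_prod ps \<star> (x, z) = (x, z)" using assms unfolding loop_def by blast
  define \<sigma> where "\<sigma> = sum_list (map fst ps)"
  have \<sigma>: "0 < \<sigma>" using ps by (simp add: \<sigma>_def)
  obtain v where v: "v \<in> controls" "phi z \<sigma> x v = x"
    using word_control[OF ps(1)] ps(3) by (auto simp: \<sigma>_def)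
  let ?u = "periodic_ext \<sigma> v"
  have u: "?u \<in> controls" by (rule pc_controls_periodic_ext[OF v(1) \<sigma>])
  have x\<sigma>: "phi z \<sigma> x ?u = x"
    using phi_cong[OF u v(1), of \<sigma>] \<sigma> v(2) by (simp add: periodic_ext_eq)
  have shift: "(\<lambda>r. ?u (r + \<sigma>)) = ?u" using \<sigma> by (simp add: periodic_ext_period)
  have xk: "phi z (real k * \<sigma>) x ?u = x" for k
  proof (induction k)
    case 0
    have "((\<lambda>r. field z (?u r) (phi z r x ?u)) has_integral phi z 0 x ?u - x) {0}"
      using phi_solves[OF u, of z x 0] by (simp add: solves_def)
    from has_integral_unique[OF this has_integral_refl(2)] show ?case by simp
  next
    case (Suc k)
    have "phi z (real k * \<sigma> + \<sigma>) x ?u = phi z (real k * \<sigma>) (phi z \<sigma> x ?u) ?u"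
      using phi_cocycle[OF u, of "real k * \<sigma>" \<sigma> z x] \<sigma> shift by simp
    then show ?case using Suc x\<sigma> by (simp add: algebra_simps)
  qed
  show ?thesis
  proof (intro bexI[OF _ u] allI impI)
    fix t :: real assume t: "0 \<le> t"
    obtain k :: nat where k: "t / \<sigma> \<le> real k" using real_arch_simple by blast
    then have k: "0 \<le> real k * \<sigma> - t" using \<sigma> by (simp add: field_simps)
    have "x = phi z (real k * \<sigma> - t) (phi z t x ?u) (\<lambda>r. ?u (r + t))"
      using phi_cocycle[OF u k t] xk[of k] by simp
    then have "reach (phi z t x ?u, z) (x, z)"
      using phi_reach[OF pc_controls_shift[OF u t] k] by metis
    then show "mutual (x, z) (phi z t x ?u, z)" unfolding mutual_def using phi_reach[OF u t] by blast
  qed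
qed

text \<open>The class need not be maximal; it is the seed that is enlarged to a control set or
  absorbed by a given one.\<close>

lemma mutual_class_cs_prop:
  assumes l: "loop (x, z)" and X: "\<And>y. mutual (x, z) (y, z) \<Longrightarrow> y \<in> topspace X"
  shows "cs_prop X (phi z) controls {y. mutual (x, z) (y, z)}"
  unfolding cs_prop_def
proof (intro conjI ballI)
  show "{y. mutual (x, z) (y, z)} \<noteq> {}" using mutual_refl by blast
  show "{y. mutual (x, z) (y, z)} \<subseteq> topspace X" using X by blast
  fix y assume "y \<in> {y. mutual (x, z) (y, z)}"
  then have y: "mutual (x, z) (y, z)" by simp
  show "\<exists>u\<in>controls. \<forall>t\<ge>0. phi z t y u \<in> {y. mutual (x, z) (y, z)}"
    using loop_viable[OF loop_mutual[OF l y]] mutual_trans[OF y] by blast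
  have "{y. mutual (x, z) (y, z)} \<subseteq> topspace X \<inter> pos_orbit (phi z) controls y"
    using X mutual_trans[OF mutual_sym[OF y]] by (auto simp: pos_orbit_iff mutual_def)
  then show "{y. mutual (x, z) (y, z)} \<subseteq> X closure_of pos_orbit (phi z) controls y"
    using closure_of_subset_Int by (rule subset_trans)
qed

lemma continuous_map_affine: "0 \<le> t \<Longrightarrow> u \<in> controls \<Longrightarrow> continuous_map euclidean euclidean (\<lambda>x. phi z t x u)"
  using continuous_phi by simp

lemma continuous_map_homogeneous:
  assumes "0 \<le> t" "u \<in> controls"
  shows "continuous_map (top_of_set (UNIV - {0})) (top_of_set (UNIV - {0})) (\<lambda>x. phi 0 t x u)"
proof -
  have "phi 0 t x u \<noteq> 0" if "x \<noteq> 0" for x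
    using reach_zero_iff[OF phi_reach[OF assms(2,1), of x 0]] that by (simp add: zero_prod_def)
  then show ?thesis
    using continuous_on_subset[OF continuous_phi[OF assms(2,1)]]
    by (auto simp: continuous_map_in_subtopology continuous_map_iff_continuous2)
qed

end

section \<open>Analytic families of words\<close>

text \<open>Restrictions of entire functions to the real axis: closed under the operations that form
  a determinant, and with isolated zeros unless identically zero.\<close>

definition entire_ext :: "(real \<Rightarrow> real) \<Rightarrow> bool" where
  "entire_ext f \<longleftrightarrow> (\<exists>F. F holomorphic_on UNIV \<and> (\<forall>x. F (of_real x) = complex_of_real (f x)))"

lemma entire_ext_const: "entire_ext (\<lambda>_. c)"
  unfolding entire_ext_def by (intro exI[of _ "\<lambda>_. of_real c"]) auto

lemma entire_ext_add: "entire_ext f \<Longrightarrow> entire_ext g \<Longrightarrow> entire_ext (\<lambda>x. f x + g x)"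
  unfolding entire_ext_def by (metis (no_types, lifting) holomorphic_on_add of_real_add)

lemma entire_ext_diff: "entire_ext f \<Longrightarrow> entire_ext g \<Longrightarrow> entire_ext (\<lambda>x. f x - g x)"
  unfolding entire_ext_def by (metis (no_types, lifting) holomorphic_on_diff of_real_diff)

lemma entire_ext_mult: "entire_ext f \<Longrightarrow> entire_ext g \<Longrightarrow> entire_ext (\<lambda>x. f x * g x)"
  unfolding entire_ext_def by (metis (no_types, lifting) holomorphic_on_mult of_real_mult)

lemma entire_ext_sum: "(\<And>i. i \<in> I \<Longrightarrow> entire_ext (f i)) \<Longrightarrow> entire_ext (\<lambda>x. \<Sum>i\<in>I. f i x)"
  by (induction I rule: infinite_finite_induct) (auto intro: entire_ext_const entire_ext_add)

lemma entire_ext_prod: "(\<And>i. i \<in> I \<Longrightarrow> entire_ext (f i)) \<Longrightarrow> entire_ext (\<lambda>x. \<Prod>i\<in>I. f i x)"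
  by (induction I rule: infinite_finite_induct) (auto intro: entire_ext_const entire_ext_mult)

lemma entire_ext_power_series:
  fixes c :: "nat \<Rightarrow> real"
  assumes "\<And>t::real. summable (\<lambda>n. \<bar>c n\<bar> * t ^ n)"
  shows "entire_ext (\<lambda>l. \<Sum>n. c n * (a * l + b) ^ n)"
proof -
  have sm: "summable (\<lambda>n. of_real (c n) * z ^ n)" for z :: complex
    by (rule summable_norm_cancel) (use assms[of "norm z"] in \<open>simp add: norm_mult norm_power\<close>)
  define G :: "complex \<Rightarrow> complex" where "G z = (\<Sum>n. of_real (c n) * z ^ n)" for z
  have "G holomorphic_on UNIV"
    unfolding holomorphic_on_def field_differentiable_def G_def
    using termdiffs_strong_converges_everywhere[OF sm] by (metis has_field_derivative_at_within)
  then have "(G \<circ> (\<lambda>z. of_real a * z + of_real b)) holomorphic_on UNIV"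
    by (intro holomorphic_on_compose_gen[of _ _ _ UNIV] holomorphic_intros) auto
  moreover have "G (of_real t) = of_real (\<Sum>n. c n * t ^ n)" for t
  proof -
    have "summable (\<lambda>n. c n * t ^ n)"
      by (rule summable_norm_cancel) (use assms[of "\<bar>t\<bar>"] in \<open>simp add: abs_mult power_abs\<close>)
    then show ?thesis unfolding G_def by (simp add: suminf_of_real)
  qed
  ultimately show ?thesis
    unfolding entire_ext_def
    by (intro exI[of _ "G \<circ> (\<lambda>z. of_real a * z + of_real b)"])
      (simp flip: of_real_mult of_real_add)
qed

lemma entire_ext_exp:
  fixes X :: "'a::euclidean_space endo"
  shows "entire_ext (\<lambda>l. (exp ((a * l + b) *\<^sub>R X) \<star> p) \<bullet> q)"
proof -
  let ?c = "\<lambda>n. ((X ^ n \<star> p) \<bullet> q) / fact n"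
  have "(exp (t *\<^sub>R X) \<star> p) \<bullet> q = (\<Sum>n. ?c n * t ^ n)" for t
  proof -
    have "(\<lambda>n. (t *\<^sub>R X) ^ n /\<^sub>R fact n) sums exp (t *\<^sub>R X)" by (rule exp_converges)
    moreover have "bounded_linear (\<lambda>Y. (Y \<star> p) \<bullet> q)"
      by (intro bounded_linear_compose[OF bounded_linear_inner_left] endo_apply.bounded_linear_left)
    ultimately have "(\<lambda>n. (((t *\<^sub>R X) ^ n /\<^sub>R fact n) \<star> p) \<bullet> q) sums ((exp (t *\<^sub>R X) \<star> p) \<bullet> q)"
      by (rule bounded_linear.sums[rotated])
    moreover have "(((t *\<^sub>R X) ^ n /\<^sub>R fact n) \<star> p) \<bullet> q = ?c n * t ^ n" for n
      by (simp add: scaleR_power endo_apply_simps divide_inverse mult_ac)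
    ultimately show ?thesis by (simp add: sums_iff)
  qed
  moreover have "entire_ext (\<lambda>l. \<Sum>n. ?c n * (a * l + b) ^ n)"
  proof (rule entire_ext_power_series)
    fix t :: real
    have "norm (\<bar>?c n\<bar> * t ^ n) \<le> norm p * norm q * ((norm X * \<bar>t\<bar>) ^ n /\<^sub>R fact n)" for n
    proof -
      have "\<bar>(X ^ n \<star> p) \<bullet> q\<bar> \<le> norm (X ^ n \<star> p) * norm q" by (rule Cauchy_Schwarz_ineq2)
      also have "\<dots> \<le> norm (X ^ n) * norm p * norm q"
        by (intro mult_right_mono norm_endo_apply) simp
      also have "\<dots> \<le> norm X ^ n * norm p * norm q"
        by (intro mult_right_mono norm_power_ineq) simp_all
      finally have "\<bar>(X ^ n \<star> p) \<bullet> q\<bar> * (\<bar>t\<bar> ^ n / fact n) \<le> norm X ^ n * norm p * norm q * (\<bar>t\<bar> ^ n / fact n)"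
        by (intro mult_right_mono) auto
      then show ?thesis by (simp add: abs_mult power_abs power_mult_distrib divide_inverse mult_ac)
    qed
    then show "summable (\<lambda>n. \<bar>?c n\<bar> * t ^ n)"
      by (rule summable_comparison_test'[where N = 0, rotated]) (intro summable_mult summable_exp_generic)
  qed
  ultimately show ?thesis by simp
qed

text \<open>A list entry \<open>(a, b, X)\<close> stands for a letter \<open>X\<close> whose time \<open>a l + b\<close> depends on the parameter \<open>l\<close>.\<close>

definition word_at :: "(real \<times> real \<times> 'a endo) list \<Rightarrow> real \<Rightarrow> (real \<times> 'a::euclidean_space endo) list" where
  "word_at qs l = map (\<lambda>(a, b, X). (a * l + b, X)) qs"

lemma word_at_simps [simp]:
  "word_at [] l = []" "word_at ((a, b, X) # qs) l = (a * l + b, X) # word_at qs l"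
  "word_at (ps @ qs) l = word_at ps l @ word_at qs l"
  by (simp_all add: word_at_def)

lemma entire_ext_word: "entire_ext (\<lambda>l. (word_prod (word_at qs l) \<star> p) \<bullet> q)"
proof (induction qs arbitrary: p q)
  case Nil then show ?case by (simp add: entire_ext_const)
next
  case (Cons a qs)
  obtain c d X where a: "a = (c, d, X)" by (cases a)
  have "(word_prod (word_at (a # qs) l) \<star> p) \<bullet> q
      = (\<Sum>b\<in>Basis. ((word_prod (word_at qs l) \<star> p) \<bullet> b) * ((exp ((c * l + d) *\<^sub>R X) \<star> b) \<bullet> q))" for l
  proof -
    have "word_prod (word_at (a # qs) l) \<star> p
        = exp ((c * l + d) *\<^sub>R X) \<star> (\<Sum>b\<in>Basis. ((word_prod (word_at qs l) \<star> p) \<bullet> b) *\<^sub>R b)"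
      by (simp add: a euclidean_representation)
    then show ?thesis by (simp add: endo_apply_simps inner_sum_left)
  qed
  then show ?case
    by (simp only:) (intro entire_ext_sum entire_ext_mult entire_ext_exp Cons.IH)
qed

lemma continuous_word_at: "continuous_on UNIV (\<lambda>l. word_prod (word_at qs l))"
proof (induction qs)
  case (Cons a qs)
  obtain c d X where a: "a = (c, d, X)" by (cases a)
  have "continuous_on UNIV (\<lambda>l. exp ((c * l + d) *\<^sub>R X))"
    by (rule continuous_on_compose2[OF continuous_on_exp_scaleR[of UNIV]]) (auto intro!: continuous_intros)
  then show ?case using Cons by (simp add: a continuous_on_mult)
qed simp

text \<open>By the identity theorem a nonzero value at 0 already excludes zeros from a punctured
  neighbourhood of 1.\<close>

lemma entire_ext_nonzero_near_1:
  assumes "entire_ext f" "f 0 \<noteq> 0"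
  shows "\<exists>l::nat \<Rightarrow> real. l \<longlonglongrightarrow> 1 \<and> (\<forall>k. 1/2 < l k \<and> l k < 1 \<and> f (l k) \<noteq> 0)"
proof -
  obtain F where F: "F holomorphic_on UNIV" "\<And>x. F (of_real x) = complex_of_real (f x)"
    using assms(1) unfolding entire_ext_def by blast
  have "F 0 \<noteq> 0" using F(2)[of 0] assms(2) by simp
  then have "\<forall>\<^sub>F w in at 1. F w \<noteq> 0 \<and> w \<in> UNIV"
    by (intro non_zero_neighbour_alt[OF F(1), of 1 0]) auto
  then obtain d where d: "d > 0" "\<And>w. w \<noteq> 1 \<Longrightarrow> dist w 1 < d \<Longrightarrow> F w \<noteq> 0"
    unfolding eventually_at by auto
  define e where "e = min d 1"
  have e: "0 < e" "e \<le> d" "e \<le> 1" using d by (auto simp: e_def)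
  \<comment> \<open>The offset 3 keeps \<open>e / (k + 3)\<close> below both \<open>e\<close> and
    \<open>1/2\<close>, so the points lie in \<open>(1/2, 1)\<close> and within the zero-free
    neighbourhood.\<close>
  let ?l = "\<lambda>k. 1 - e / (real k + 3)"
  have s: "0 < e / (real k + 3)" "e / (real k + 3) < e" "e / (real k + 3) < 1/2" for k
  proof -
    have "0 < e * (real k + 2)" using e by simp
    then show "0 < e / (real k + 3)" "e / (real k + 3) < e" "e / (real k + 3) < 1/2"
      using e by (auto simp: field_simps)
  qed
  have "f (?l k) \<noteq> 0" for k
  proof -
    have "dist (complex_of_real (?l k)) (of_real 1) = dist (?l k) 1" by (rule dist_of_real)
    then have "dist (complex_of_real (?l k)) 1 < d" using s[of k] e by (simp add: dist_real_def)
    moreover have "complex_of_real (?l k) \<noteq> 1" using s(1)[of k] unfolding of_real_eq_1_iff by linarith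
    ultimately show ?thesis using d(2)[of "of_real (?l k)"] F(2)[of "?l k"] by auto
  qed
  moreover have "?l \<longlonglongrightarrow> 1" by real_asymp
  moreover have "1/2 < ?l k \<and> ?l k < 1" for k using s(1,3)[of k] by linarith
  ultimately show ?thesis by blast
qed

text \<open>\<open>L l\<close> is the identity minus the action on the level 0. Its determinant is a
  polynomial in matrix coefficients of the word, hence entire in \<open>l\<close>.\<close>

lemma no_eigenvalue_one_near_1:
  fixes qs :: "(real \<times> real \<times> ((real^'n) \<times> real) endo) list"
  defines "L \<equiv> \<lambda>l x. x - fst (word_prod (word_at qs l) \<star> (x, 0))"
  assumes "inj (L 0)"
  shows "\<exists>l::nat \<Rightarrow> real. l \<longlonglongrightarrow> 1 \<and> (\<forall>k. 1/2 < l k \<and> l k < 1 \<and> surj (L (l k)))"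
proof -
  have lin: "linear (L l)" for l
  proof -
    have "(x + y, 0::real) = (x, 0) + (y, 0)" "(c *\<^sub>R x, 0::real) = c *\<^sub>R (x, 0)" for x y :: "real^'n" and c
      by simp_all
    then show ?thesis unfolding L_def linear_iff
      by (simp only: endo_apply.add_right endo_apply.scaleR_right fst_add fst_scaleR) (simp add: algebra_simps)
  qed
  have "entire_ext (\<lambda>l. matrix (L l) $ i $ j)" for i j
  proof -
    have "matrix (L l) $ i $ j = axis j 1 $ i - (word_prod (word_at qs l) \<star> (axis j 1, 0)) \<bullet> (axis i 1, 0)" for l
      by (simp add: matrix_def L_def inner_prod_def inner_axis)
    then show ?thesis by (simp only:) (intro entire_ext_diff entire_ext_const entire_ext_word)
  qed
  then have "entire_ext (\<lambda>l. det (matrix (L l)))"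
    unfolding det_def by (intro entire_ext_sum entire_ext_mult entire_ext_const entire_ext_prod)
  moreover have "det (matrix (L 0)) \<noteq> 0" using det_nz_iff_inj[OF lin] assms by blast
  ultimately obtain l where "l \<longlonglongrightarrow> 1" "\<forall>k. 1/2 < l k \<and> l k < 1 \<and> det (matrix (L (l k))) \<noteq> 0"
    using entire_ext_nonzero_near_1 by blast
  then show ?thesis
    using det_nz_iff_inj[OF lin] linear_injective_imp_surjective[OF lin] by blast
qed

section \<open>Periodic points and control sets\<close>

text \<open>At \<open>l = 0\<close> the first two blocks cancel and the word is \<open>gs\<close>, at \<open>l = 1\<close> it is
  \<open>ps @ rev ps @ qs\<close>, and for \<open>1/2 < l \<le> 1\<close> all times are nonnegative while the block \<open>ps\<close> stays fixed.\<close>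

definition connecting :: "(real \<times> 'a endo) list \<Rightarrow> (real \<times> 'a endo) list \<Rightarrow> (real \<times> 'a endo) list
    \<Rightarrow> (real \<times> real \<times> 'a::euclidean_space endo) list" where
  "connecting ps qs gs = map (\<lambda>(t, X). (0, t, X)) ps @ map (\<lambda>(t, X). (2 * t, - t, X)) (rev ps)
     @ map (\<lambda>(t, X). (t, 0, X)) qs @ map (\<lambda>(t, X). (- t, t, X)) gs"

lemma word_prod_zero_times: "word_prod (map (\<lambda>(t, X). (0, X)) ps) = 1"
  by (induction ps) auto

lemma connecting_at:
  "word_at (connecting ps qs gs) l = ps @ map (\<lambda>(t, X). ((2 * l - 1) * t, X)) (rev ps)
     @ map (\<lambda>(t, X). (l * t, X)) qs @ map (\<lambda>(t, X). ((1 - l) * t, X)) gs"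
proof -
  have "map ((\<lambda>(a, b, X). (a * l + b, X)) \<circ> (\<lambda>(t, X). (0, t, X))) ps = ps" by (auto intro!: map_idI)
  then show ?thesis
    unfolding connecting_def word_at_def by (auto simp: algebra_simps)
qed

lemma connecting_0: "word_prod (word_at (connecting ps qs gs) 0) = word_prod gs"
proof -
  have "map (\<lambda>(t, X). ((2 * 0 - 1) * t, X)) (rev ps) = negate_times (rev ps)" by (simp add: negate_times_def)
  moreover have "map (\<lambda>(t, X). (0 * t, X)) qs = map (\<lambda>(t, X). (0, X)) qs" by simp
  moreover have "map (\<lambda>(t, X). ((1 - 0) * t, X)) gs = gs" by (auto intro!: map_idI)
  ultimately show ?thesis
    by (simp only: connecting_at word_prod_append word_prod_negate_times word_prod_zero_times
        mult.assoc[symmetric] word_prod_inv mult_1_left mult_1_right)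
qed

lemma connecting_1:
  "word_prod (word_at (connecting ps qs gs) 1) = word_prod ps * (word_prod (rev ps) * word_prod qs)"
proof -
  have "map (\<lambda>(t, X). ((2 * 1 - 1) * t, X)) (rev ps) = rev ps" "map (\<lambda>(t, X). (1 * t, X)) qs = qs"
    by (auto intro!: map_idI)
  moreover have "map (\<lambda>(t, X). ((1 - 1) * t, X)) gs = map (\<lambda>(t, X). (0, X)) gs" by simp
  ultimately show ?thesis
    by (simp only: connecting_at word_prod_append word_prod_zero_times mult_1_right)
qed

lemma connecting_semigroup:
  assumes "\<forall>(t, X)\<in>set ps. 0 \<le> t \<and> X \<in> Ms" "\<forall>(t, X)\<in>set qs. 0 \<le> t \<and> X \<in> Ms"
    "\<forall>(t, X)\<in>set gs. 0 \<le> t \<and> X \<in> Ms" and l: "1/2 < l" "l \<le> 1"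
  shows "\<exists>k\<in>semigroup_of Ms. word_prod (word_at (connecting ps qs gs) l) = word_prod ps * k"
proof -
  let ?w = "map (\<lambda>(t, X). ((2 * l - 1) * t, X)) (rev ps) @ map (\<lambda>(t, X). (l * t, X)) qs
    @ map (\<lambda>(t, X). ((1 - l) * t, X)) gs"
  have "word_prod ?w \<in> semigroup_of Ms"
    unfolding semigroup_of_def using assms by (intro imageI) fastforce
  then show ?thesis unfolding connecting_at word_prod_append[of ps] by blast
qed

lemma proj_line_scaleR:
  fixes x :: "'a::real_vector"
  assumes "c \<noteq> 0" shows "proj_line (c *\<^sub>R x) = proj_line x"
proof -
  have "r *\<^sub>R x = (r / c) *\<^sub>R (c *\<^sub>R x)" for r using assms by simp
  then have "r *\<^sub>R x \<in> proj_line (c *\<^sub>R x)" for r unfolding proj_line_def by blast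
  moreover have "r *\<^sub>R (c *\<^sub>R x) \<in> proj_line x" for r unfolding proj_line_def scaleR_scaleR by blast
  ultimately show ?thesis unfolding proj_line_def[of x] proj_line_def[of "c *\<^sub>R x"]
    by (auto simp: proj_line_def)
qed

context control_lift
begin

lemma word_small:
  fixes x :: 'b and ps :: "(real \<times> ('b \<times> real) endo) list"
  assumes "(exp (weight ps) - 1) * norm x < \<rho>"
  shows "dist (fst (word_prod ps \<star> (x, 0))) x < \<rho>"
proof -
  have "norm (fst (word_prod ps \<star> (x, 0)) - x) = norm (fst ((word_prod ps - 1) \<star> (x, 0)))"
    by (simp add: endo_apply_simps)
  also have "\<dots> \<le> norm ((word_prod ps - 1) \<star> (x, 0))" by (metis norm_fst_le prod.collapse)
  also have "\<dots> \<le> norm (word_prod ps - 1) * norm (x, 0::real)" by (rule norm_endo_apply)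
  also have "\<dots> \<le> (exp (weight ps) - 1) * norm x"
    using norm_word_prod_minus_one[of ps] by (simp add: norm_Pair mult_right_mono)
  finally show ?thesis using assms by (simp add: dist_norm)
qed

text \<open>The word \<open>ps\<close> is so short that \<open>x1 = word_inv ps \<star> x\<close>
  and \<open>x' = word_prod (ps @ rev ps) \<star> x\<close> stay in \<open>Dh\<close>. A control set
  provides only approximate reachability of \<open>x1\<close> from \<open>x'\<close>; the regular
  word turns it into exact reachability of \<open>x\<close>, which closes the cycle.\<close>

lemma homogeneous_fixed_point:
  assumes Dh: "control_set (top_of_set (UNIV - {0})) (phi 0) controls Dh" and x: "x \<in> interior Dh"
  obtains ps qs x' where "regular_word (M ` \<Omega>) ps" "\<forall>(t, X)\<in>set qs. 0 \<le> t \<and> X \<in> M ` \<Omega>"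
    "x' \<in> Dh" "(word_prod ps * (word_prod (rev ps) * word_prod qs)) \<star> (x', 0) = (x', 0)"
proof -
  have cs: "cs_prop (top_of_set (UNIV - {0})) (phi 0) controls Dh" using Dh by (simp add: control_set_def)
  then have nz: "Dh \<subseteq> UNIV - {0}" by (simp add: cs_prop_def)
  obtain \<rho> where \<rho>: "\<rho> > 0" "ball x \<rho> \<subseteq> Dh" using x mem_interior by blast
  have x0: "x \<noteq> 0" using \<rho> nz by (metis DiffD2 centre_in_ball insertI1 subsetD)
  \<comment> \<open>The factor 2 pays for \<open>ps @ rev ps\<close>, which has twice the weight of
    \<open>ps\<close>.\<close>
  have "((\<lambda>e. (exp (2 * e) - 1) * norm x) \<longlongrightarrow> (exp (2 * 0) - 1) * norm x) (at_right 0)"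
    by (intro tendsto_intros)
  then have "\<forall>\<^sub>F e in at_right 0. (exp (2 * e) - 1) * norm x < \<rho>"
    using \<rho>(1) by (auto dest: order_tendstoD)
  then have "\<forall>\<^sub>F e in at_right 0. (exp (2 * e) - 1) * norm x < \<rho> \<and> 0 < e"
    using eventually_at_right_less[of "0::real"] by (rule eventually_conj)
  then obtain e where e: "(exp (2 * e) - 1) * norm x < \<rho>" "0 < e"
    using eventually_happens'[OF trivial_limit_at_right_real] by blast
  obtain ps where ps: "regular_word (M ` \<Omega>) ps" "weight ps < e" using regular_word_exists[OF e(2)] by blast
  have w: "ps \<in> words (M ` \<Omega>)" using ps by (simp add: regular_word_def)
  have small: "(exp (weight qs) - 1) * norm x < \<rho>" if "weight qs \<le> 2 * e" for qs :: "(real \<times> ('b \<times> real) endo) list"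
  proof -
    have "(exp (weight qs) - 1) * norm x \<le> (exp (2 * e) - 1) * norm x"
      using that by (intro mult_right_mono) auto
    then show ?thesis using e(1) by linarith
  qed
  have wn: "snd ` set ps \<subseteq> M ` \<Omega>" using words_snd[OF w] .
  define x1 where "x1 = fst (word_inv ps \<star> (x, 0))"
  define x' where "x' = fst (word_prod (ps @ rev ps) \<star> (x, 0))"
  have x1e: "word_inv ps \<star> (x, 0) = (x1, 0)" using snd_word(2)[OF wn, of "(x, 0)"] by (simp add: x1_def prod_eq_iff)
  have x'e: "word_prod (ps @ rev ps) \<star> (x, 0) = (x', 0)"
    using snd_word(1)[of "ps @ rev ps" "(x, 0)"] wn by (auto simp: x'_def prod_eq_iff)
  have "dist x1 x < \<rho>"
  proof -
    have "dist (fst (word_prod (negate_times (rev ps)) \<star> (x, 0))) x < \<rho>"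
      by (rule word_small, rule small) (use ps(2) e(2) in \<open>simp add: weight_negate_times weight_rev\<close>)
    then show ?thesis by (simp add: word_prod_negate_times x1_def)
  qed
  then have x1D: "x1 \<in> Dh" using \<rho> by (auto simp: dist_commute)
  have "dist x' x < \<rho>" unfolding x'_def
    by (rule word_small, rule small) (use ps(2) in \<open>simp add: weight_append weight_rev\<close>)
  then have x'D: "x' \<in> Dh" using \<rho> by (auto simp: dist_commute)
  obtain d where d: "d > 0" "\<And>y. dist y x1 < d \<Longrightarrow> reach (y, 0) (x, 0)"
    using backward_open[OF ps(1), of "(x, 0)"] x0 unfolding x1_def by (auto simp: zero_prod_def)
  have cl: "x1 \<in> top_of_set (UNIV - {0}) closure_of pos_orbit (phi 0) controls x'"
    using cs x1D x'D unfolding cs_prop_def by blast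
  have "openin (top_of_set (UNIV - {0})) ((UNIV - {0}) \<inter> ball x1 d)" by blast
  moreover have "x1 \<in> (UNIV - {0}) \<inter> ball x1 d" using x1D nz d by auto
  ultimately have "\<exists>y. y \<in> pos_orbit (phi 0) controls x' \<and> y \<in> (UNIV - {0}) \<inter> ball x1 d"
    using cl[unfolded in_closure_of] by meson
  then obtain y where "y \<in> pos_orbit (phi 0) controls x'" "dist y x1 < d" by (auto simp: dist_commute)
  then have "reach (x', 0) (x, 0)" using d(2) reach_trans by (metis pos_orbit_iff)
  then obtain qs where qs: "\<forall>(t, X)\<in>set qs. 0 \<le> t \<and> X \<in> M ` \<Omega>" "word_prod qs \<star> (x', 0) = (x, 0)"
    unfolding reach_def semigroup_of_def by blast
  have "(word_prod ps * (word_prod (rev ps) * word_prod qs)) \<star> (x', 0) = (x', 0)"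
    using x'e by (simp add: qs(2) word_prod_append)
  then show thesis using that ps(1) qs(1) x'D by blast
qed

lemma affine_control_set_at_fixed_point:
  assumes "regular_word (M ` \<Omega>) ps" "k \<in> semigroup_of (M ` \<Omega>)" "(word_prod ps * k) \<star> (y, 1) = (y, 1)"
  shows "\<exists>D. control_set euclidean (phi 1) controls D \<and> y \<in> interior D"
proof -
  have "(y, 1::real) \<noteq> 0" by (simp add: zero_prod_def)
  from fixed_point_locally_controllable[OF assms this]
  obtain e where e: "e > 0" "\<And>z. dist z y < e \<Longrightarrow> mutual (y, 1) (z, 1)" by auto
  have "cs_prop euclidean (phi 1) controls {z. mutual (y, 1) (z, 1)}"
    by (rule mutual_class_cs_prop[OF regular_word_loop[OF assms]]) simp
  then obtain D where D: "control_set euclidean (phi 1) controls D" "{z. mutual (y, 1) (z, 1)} \<subseteq> D"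
    using control_set_exists[OF continuous_map_affine pos_orbit_trans] by blast
  have "ball y e \<subseteq> D" using D(2) e(2) by (auto simp: dist_commute)
  then show ?thesis using D(1) e(1) mem_interior by blast
qed

end

locale control_lift_vec = control_lift M \<Omega> K
  for M :: "'c \<Rightarrow> ((real^'n) \<times> real) endo" and \<Omega> :: "'c set" and K :: real
begin

text \<open>The equation is \<open>y - L y = b\<close>, where \<open>L\<close> is the action of
  \<open>H\<close> on the level 0 and \<open>b\<close> is the image of the origin of the level
  1.\<close>

lemma affine_fixed_point_exists:
  assumes "surj (\<lambda>x. x - fst (H \<star> (x, 0)))" and snd_H: "\<And>v. snd (H \<star> v) = snd v"
  shows "\<exists>y::real^'n. H \<star> (y, 1) = (y, 1)"
proof -
  obtain y where y: "y - fst (H \<star> (y, 0)) = fst (H \<star> (0, 1))"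
    using surjD[OF assms(1), of "fst (H \<star> (0, 1))"] by metis
  have "H \<star> (y, 1) = H \<star> (y, 0) + H \<star> (0, 1)" by (simp flip: endo_apply.add_right)
  then have "fst (H \<star> (y, 1)) = y" using y by (simp add: algebra_simps)
  then show ?thesis using snd_H[of "(y, 1)"] by (intro exI[of _ y]) (simp add: prod_eq_iff)
qed

lemma approximating_fixed_points:
  assumes ps: "regular_word (M ` \<Omega>) ps"
    and qs: "\<forall>(t, X)\<in>set qs. 0 \<le> t \<and> X \<in> M ` \<Omega>" and gs: "\<forall>(t, X)\<in>set gs. 0 \<le> t \<and> X \<in> M ` \<Omega>"
    and no_eig: "\<And>v. word_prod gs \<star> (v, 0) = (v, 0) \<Longrightarrow> v = 0"
  obtains l :: "nat \<Rightarrow> real" and y where "l \<longlonglongrightarrow> 1"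
    "\<And>k. word_prod (word_at (connecting ps qs gs) (l k)) \<star> (y k, 1) = (y k, 1)"
    "\<And>k. \<exists>D. control_set euclidean (phi 1) controls D \<and> y k \<in> interior D"
proof -
  let ?H = "\<lambda>l. word_prod (word_at (connecting ps qs gs) l)"
  have w: "ps \<in> words (M ` \<Omega>)" using ps by (simp add: regular_word_def)
  let ?L = "\<lambda>l x. x - fst (?H l \<star> (x, 0))"
  have "inj (?L 0)"
  proof (rule injI)
    fix a b assume eq: "?L 0 a = ?L 0 b"
    have "word_prod gs \<in> semigroup_of (M ` \<Omega>)" unfolding semigroup_of_def using gs by blast
    then have "snd (word_prod gs \<star> (a - b, 0)) = 0" using snd_semigroup by simp
    moreover have "fst (word_prod gs \<star> (a - b, 0)) = fst (word_prod gs \<star> (a, 0)) - fst (word_prod gs \<star> (b, 0))"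
      by (simp flip: endo_apply.diff_right fst_diff)
    moreover have "fst (word_prod gs \<star> (a, 0)) - fst (word_prod gs \<star> (b, 0)) = a - b"
      using eq unfolding connecting_0 by (simp add: algebra_simps)
    ultimately have "word_prod gs \<star> (a - b, 0) = (a - b, 0)" by (simp add: prod_eq_iff)
    from no_eig[OF this] show "a = b" by simp
  qed
  from no_eigenvalue_one_near_1[OF this] obtain l
    where l: "l \<longlonglongrightarrow> 1" "\<And>k. 1/2 < l k \<and> l k < 1 \<and> surj (?L (l k))" by blast
  have "\<exists>k\<in>semigroup_of (M ` \<Omega>). ?H (l n) = word_prod ps * k" for n
    using l(2)[of n] by (intro connecting_semigroup[OF words_nonneg[OF w] qs gs]) auto
  then obtain k where k: "\<And>n. k n \<in> semigroup_of (M ` \<Omega>)" "\<And>n. ?H (l n) = word_prod ps * k n" by metis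
  have "snd (?H (l n) \<star> v) = snd v" for n v
    unfolding k(2) using snd_semigroup[OF semigroup_of_mult[OF word_prod_in_semigroup[OF w] k(1)]] .
  then have "\<exists>y. ?H (l n) \<star> (y, 1) = (y, 1)" for n
    using affine_fixed_point_exists l(2) by blast
  then obtain y where y: "\<And>n. ?H (l n) \<star> (y n, 1) = (y n, 1)" by metis
  have "\<exists>D. control_set euclidean (phi 1) controls D \<and> y n \<in> interior D" for n
    using affine_control_set_at_fixed_point[OF ps k(1)] y[of n] unfolding k(2) by blast
  with l(1) y show thesis by (rule that)
qed

text \<open>Convergence of the rescaled points to \<open>(z, 0)\<close> expresses accumulation at
  infinity by vectors alone. Membership is asked of the line of \<open>z\<close>, because
  \<open>z\<close> may point opposite to the vectors of \<open>Dh\<close>.\<close>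

lemma control_set_direction_at_infinity:
  assumes Dh: "control_set (top_of_set (UNIV - {0})) (phi 0) controls Dh" and int: "interior Dh \<noteq> {}"
    and G: "G \<in> semigroup_of (M ` \<Omega>)" and no_eig: "\<And>v. G \<star> (v, 0) = (v, 0) \<Longrightarrow> v = 0"
    and fin: "finite {D. control_set euclidean (phi 1) controls D \<and> interior D \<noteq> {}}"
  shows "\<exists>D z Y r. control_set euclidean (phi 1) controls D \<and> interior D \<noteq> {} \<and> z \<noteq> 0
    \<and> proj_line z \<in> proj_line ` Dh \<and> (\<forall>n::nat. Y n \<in> D \<and> r n > 0) \<and> (\<lambda>n. r n *\<^sub>R (Y n, 1::real)) \<longlonglongrightarrow> (z, 0)"
proof -
  obtain x where x: "x \<in> interior Dh" using int by blast
  obtain ps qs x' where ps: "regular_word (M ` \<Omega>) ps" and qs: "\<forall>(t, X)\<in>set qs. 0 \<le> t \<and> X \<in> M ` \<Omega>"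
    and x': "x' \<in> Dh" and fx': "(word_prod ps * (word_prod (rev ps) * word_prod qs)) \<star> (x', 0) = (x', 0)"
    by (rule homogeneous_fixed_point[OF Dh x])
  obtain gs where gs: "\<forall>(t, X)\<in>set gs. 0 \<le> t \<and> X \<in> M ` \<Omega>" "G = word_prod gs"
    using G unfolding semigroup_of_def by blast
  have x'0: "x' \<noteq> 0" using Dh x' unfolding control_set_def cs_prop_def by auto
  have w: "ps \<in> words (M ` \<Omega>)" using ps by (simp add: regular_word_def)
  define H where "H l = word_prod (word_at (connecting ps qs gs) l)" for l
  define k where "k = word_prod (rev ps) * word_prod qs"
  have H1: "H 1 = word_prod ps * k" by (simp add: H_def k_def connecting_1)
  have kS: "k \<in> semigroup_of (M ` \<Omega>)"
  proof -
    have "rev ps \<in> words (M ` \<Omega>)" using w by (simp add: words_def)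
    moreover have "word_prod qs \<in> semigroup_of (M ` \<Omega>)" unfolding semigroup_of_def using qs by blast
    ultimately show ?thesis unfolding k_def using word_prod_in_semigroup semigroup_of_mult by blast
  qed
  have fx'H: "(word_prod ps * k) \<star> (x', 0) = (x', 0)" using fx' by (simp add: k_def)
  have contH: "continuous_on UNIV H" unfolding H_def by (rule continuous_word_at)
  obtain l y0 where l0: "l \<longlonglongrightarrow> 1" "\<And>n. H (l n) \<star> (y0 n, 1) = (y0 n, 1)"
    "\<And>n. \<exists>D. control_set euclidean (phi 1) controls D \<and> y0 n \<in> interior D"
    using approximating_fixed_points[OF ps qs gs(1)] no_eig unfolding gs(2) H_def by metis
  obtain Dn where Dn: "\<And>n. control_set euclidean (phi 1) controls (Dn n)" "\<And>n. y0 n \<in> interior (Dn n)"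
    using l0(3) by metis
  have "finite (range Dn)"
    by (rule finite_subset[OF _ fin]) (use Dn in auto)
  then obtain n0 where n0: "infinite {n. Dn n = Dn n0}"
    using pigeonhole_infinite[of UNIV Dn] by auto
  define D where "D = Dn n0"
  have csD: "control_set euclidean (phi 1) controls D" and intD: "interior D \<noteq> {}"
    unfolding D_def using Dn by auto
  obtain r0 :: "nat \<Rightarrow> nat" where r0: "strict_mono r0" "\<And>n. r0 n \<in> {n. Dn n = Dn n0}"
    using infinite_enumerate[OF n0] by blast
  define y where "y n = y0 (r0 n)" for n
  have yD: "y n \<in> D" for n
    using r0(2)[of n] Dn(2)[of "r0 n"] interior_subset unfolding y_def D_def by auto
  have ly: "(\<lambda>n. l (r0 n)) \<longlonglongrightarrow> 1" using LIMSEQ_subseq_LIMSEQ[OF l0(1) r0(1)] by (simp add: o_def)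
  have Hy: "H (l (r0 n)) \<star> (y n, 1) = (y n, 1)" for n unfolding y_def by (rule l0(2))
  \<comment> \<open>Stated for any \<open>s\<close> tending to infinity, since the indices chosen in
    the unbounded case need not increase.\<close>
  have limH: "(\<lambda>n. H (l (r0 (s n)))) \<longlonglongrightarrow> word_prod ps * k" if "filterlim s at_top sequentially" for s
  proof -
    have "(\<lambda>n. l (r0 (s n))) \<longlonglongrightarrow> 1" by (rule filterlim_compose[OF ly that])
    moreover have "isCont H 1" using contH by (simp add: continuous_on_eq_continuous_at)
    ultimately show ?thesis using isCont_tendsto_compose H1 by metis
  qed
  show ?thesis
  proof (cases "bounded (range y)")
    case True
    obtain ylim s where s: "strict_mono (s :: nat \<Rightarrow> nat)" "(y \<circ> s) \<longlonglongrightarrow> ylim"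
      using bounded_imp_convergent_subsequence[OF True] by blast
    have "(\<lambda>n. H (l (r0 (s n))) \<star> (y (s n), 1)) \<longlonglongrightarrow> (word_prod ps * k) \<star> (ylim, 1)"
      using s by (intro endo_apply.tendsto limH tendsto_intros) (auto simp: o_def filterlim_subseq)
    moreover have "(\<lambda>n. (y (s n), 1::real)) \<longlonglongrightarrow> (ylim, 1)"
      using s by (intro tendsto_intros) (auto simp: o_def)
    ultimately have fy: "(word_prod ps * k) \<star> (ylim, 1) = (ylim, 1)"
      unfolding Hy by (rule LIMSEQ_unique)
    have "(ylim, 1::real) \<noteq> 0" by (simp add: zero_prod_def)
    from fixed_point_locally_controllable[OF ps kS fy this]
    obtain e where e: "e > 0" "\<And>z. dist z ylim < e \<Longrightarrow> mutual (ylim, 1) (z, 1)" by auto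
    obtain n where "dist (y (s n)) ylim < e"
      using s(2) e(1) unfolding lim_sequentially by (auto simp: o_def)
    then have mu: "mutual (ylim, 1) (y (s n), 1)" by (rule e(2))
    \<comment> \<open>The class of \<open>ylim\<close> contains some \<open>y (s n)\<close>, which
      lies in \<open>D\<close>; by maximality \<open>D\<close> swallows the whole class.\<close>
    have "cs_prop euclidean (phi 1) controls {z. mutual (ylim, 1) (z, 1)}"
      by (rule mutual_class_cs_prop[OF regular_word_loop[OF ps kS fy]]) simp
    from control_set_absorbs[OF continuous_map_affine pos_orbit_trans csD this yD, of "s n"] mu
    have sub: "{z. mutual (ylim, 1) (z, 1)} \<subseteq> D" by simp
    have line: "ylim + c *\<^sub>R x' \<in> D" for c
    proof -
      have "mutual (ylim, 1) (ylim + c *\<^sub>R x', 1)"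
      proof (rule fixed_segment_mutual[OF ps kS fy])
        have "(ylim + c *\<^sub>R x', 1::real) = (ylim, 1) + c *\<^sub>R (x', 0)" by simp
        then show "(word_prod ps * k) \<star> (ylim + c *\<^sub>R x', 1) = (ylim + c *\<^sub>R x', 1)"
          using fy fx'H by (simp only: endo_apply.add_right endo_apply.scaleR_right)
        show "0 \<notin> closed_segment (ylim, 1::real) (ylim + c *\<^sub>R x', 1)"
          by (auto simp: in_segment zero_prod_def algebra_simps)
      qed simp
      then show ?thesis using sub by blast
    qed
    \<comment> \<open>Along the line, the factor \<open>1 / (n + 1)\<close> makes the base point
      \<open>ylim\<close> vanish in the limit and leaves the direction \<open>x'\<close>.\<close>
    let ?r = "\<lambda>n. inverse (real (Suc n))"
    have "(\<lambda>n. (?r n *\<^sub>R ylim + x', ?r n)) \<longlonglongrightarrow> (0 *\<^sub>R ylim + x', 0)"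
      by (intro tendsto_intros LIMSEQ_inverse_real_of_nat)
    moreover have "?r n *\<^sub>R (ylim + real (Suc n) *\<^sub>R x', 1::real) = (?r n *\<^sub>R ylim + x', ?r n)" for n
      by (simp add: scaleR_add_right del: of_nat_Suc)
    ultimately have "(\<lambda>n. ?r n *\<^sub>R (ylim + real (Suc n) *\<^sub>R x', 1::real)) \<longlonglongrightarrow> (x', 0)"
      by (simp only: scaleR_zero_left add_0_left)
    then show ?thesis using csD intD x'0 x' line
      by (intro exI[of _ D] exI[of _ x'] exI[of _ "\<lambda>n. ylim + real (Suc n) *\<^sub>R x'"] exI[of _ ?r]) auto
  next
    case False
    \<comment> \<open>\<open>n \<ge> N\<close> sends the chosen indices to infinity, and the summand
      1 keeps the norms positive for the normalisation.\<close>
    have "\<exists>n\<ge>N. real N + 1 < norm (y n)" for N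
    proof (rule ccontr)
      assume "\<not> ?thesis"
      then have le: "norm (y n) \<le> real N + 1" if "N \<le> n" for n using that by (meson not_less)
      have "y n \<in> y ` {..<N} \<union> cball 0 (real N + 1)" for n using le[of n] by (cases "n < N") auto
      then have "range y \<subseteq> y ` {..<N} \<union> cball 0 (real N + 1)" by blast
      moreover have "bounded (y ` {..<N} \<union> cball 0 (real N + 1))" by (simp add: finite_imp_bounded)
      ultimately show False using False bounded_subset by blast
    qed
    then obtain s where s: "\<And>N. N \<le> s N" "\<And>N. real N + 1 < norm (y (s N))" by metis
    have stop: "filterlim s at_top sequentially"
      using filterlim_at_top_mono[OF filterlim_ident[of sequentially]] s(1) by (auto simp: eventually_sequentially)
    let ?z = "\<lambda>n. y (s n) /\<^sub>R norm (y (s n))"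
    have ny: "0 < norm (y (s n))" for n using s(2)[of n] by linarith
    have nz: "norm (?z n) = 1" for n using ny[of n] by simp
    have "bounded (range ?z)" unfolding bounded_iff using nz by (intro exI[of _ 1]) auto
    then obtain z s' where s': "strict_mono (s' :: nat \<Rightarrow> nat)" "(?z \<circ> s') \<longlonglongrightarrow> z"
      using bounded_imp_convergent_subsequence by blast
    have "(\<lambda>n. norm ((?z \<circ> s') n)) \<longlonglongrightarrow> norm z" by (intro tendsto_norm s')
    then have "norm z = 1" using nz by (simp add: o_def LIMSEQ_const_iff)
    then have z0: "z \<noteq> 0" by auto
    let ?r = "\<lambda>n. inverse (norm (y (s (s' n))))"
    have tops': "filterlim s' at_top sequentially" by (rule filterlim_subseq[OF s'(1)])
    have top': "filterlim (\<lambda>n. s (s' n)) at_top sequentially"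
      by (rule filterlim_compose[OF stop tops'])
    have "?r \<longlonglongrightarrow> 0"
    proof (rule tendsto_inverse_0_at_top, rule filterlim_at_top_mono)
      show "filterlim (\<lambda>n. real (s' n)) at_top sequentially"
        by (rule filterlim_compose[OF filterlim_real_sequentially tops'])
      show "\<forall>\<^sub>F n in sequentially. real (s' n) \<le> norm (y (s (s' n)))"
        using s(2) by (intro always_eventually allI) (smt (verit))
    qed
    then have lim: "(\<lambda>n. ?r n *\<^sub>R (y (s (s' n)), 1::real)) \<longlonglongrightarrow> (z, 0)"
      using s'(2) by (auto simp: o_def intro!: tendsto_intros)
    have "(\<lambda>n. H (l (r0 (s (s' n)))) \<star> (?r n *\<^sub>R (y (s (s' n)), 1))) \<longlonglongrightarrow> (word_prod ps * k) \<star> (z, 0)"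
      by (intro endo_apply.tendsto limH top' lim)
    then have "(\<lambda>n. ?r n *\<^sub>R (y (s (s' n)), 1)) \<longlonglongrightarrow> (word_prod ps * k) \<star> (z, 0)"
      by (simp only: endo_apply.scaleR_right Hy)
    then have fz: "(word_prod ps * k) \<star> (z, 0) = (z, 0)" using lim LIMSEQ_unique by blast
    have "proj_line z \<in> proj_line ` Dh"
    \<comment> \<open>If the segment meets 0, then \<open>z\<close> is a negative multiple of
      \<open>x'\<close> and spans the same line. Otherwise a segment of fixed points joins the two
      and \<open>z\<close> itself lies in \<open>Dh\<close>.\<close>
    proof (cases "0 \<in> closed_segment (x', 0::real) (z, 0)")
      case True
      then obtain c where "(1 - c) *\<^sub>R x' + c *\<^sub>R z = 0" by (auto simp: in_segment zero_prod_def)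
      then have c: "c *\<^sub>R z = (c - 1) *\<^sub>R x'" by (simp add: algebra_simps add_eq_0_iff)
      have "c \<noteq> 0" using c x'0 by auto
      then have zc: "z = ((c - 1) / c) *\<^sub>R x'" 
        using arg_cong[OF c, of "scaleR (inverse c)"] by (simp add: divide_inverse_commute)
      then have "(c - 1) / c \<noteq> 0" using z0 by auto
      then have "proj_line z = proj_line x'" unfolding zc by (rule proj_line_scaleR)
      then show ?thesis using x' by blast
    next
      case False
      have "mutual (x', 0) (z, 0)" by (rule fixed_segment_mutual[OF ps kS fx'H fz _ False]) simp
      moreover have "cs_prop (top_of_set (UNIV - {0})) (phi 0) controls {z. mutual (x', 0) (z, 0)}"
        by (rule mutual_class_cs_prop[OF regular_word_loop[OF ps kS fx'H]])
          (use x'0 reach_zero_iff in \<open>auto simp: mutual_def zero_prod_def\<close>)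
      from control_set_absorbs[OF continuous_map_homogeneous pos_orbit_trans Dh this x']
      have "{z. mutual (x', 0) (z, 0)} \<subseteq> Dh" using mutual_refl by blast
      ultimately show ?thesis by blast
    qed
    then show ?thesis using csD intD z0 yD lim ny
      by (intro exI[of _ D] exI[of _ z] exI[of _ "\<lambda>n. y (s (s' n))"] exI[of _ ?r]) auto
  qed
qed

end

section \<open>The affine system\<close>

definition lift_affine :: "(real^'n) \<times> (real^'n^'n) \<Rightarrow> ((real^'n) \<times> real) endo" where
  "lift_affine f = Endo (\<lambda>p. (snd f *v fst p + snd p *\<^sub>R fst f, 0))"

lemma lift_affine_apply: "lift_affine f \<star> (x, z) = (snd f *v x + z *\<^sub>R fst f, 0)"
proof -
  have "linear (\<lambda>p. (snd f *v fst p + snd p *\<^sub>R fst f, 0::real))"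
    by (auto simp: linear_iff matrix_vector_right_distrib scaleR_matrix_vector_assoc algebra_simps
        matrix_vector_mult_scaleR)
  then show ?thesis by (simp add: lift_affine_def Endo_apply)
qed

lemma linear_lift_affine: "linear lift_affine"
proof -
  have "lift_affine (f + g) = lift_affine f + lift_affine g" for f g
    by (rule endo_eqI, case_tac v)
      (simp add: lift_affine_apply endo_apply_simps matrix_vector_mult_add_rdistrib algebra_simps)
  moreover have "lift_affine (c *\<^sub>R f) = c *\<^sub>R lift_affine f" for c f
    by (rule endo_eqI, case_tac v)
      (simp add: lift_affine_apply endo_apply_simps scaleR_matrix_vector_assoc algebra_simps)
  ultimately show ?thesis unfolding linear_iff by blast
qed

text \<open>The bracket of vector fields is the commutator of the matrices in reversed order;
  \<open>lie_hull\<close> is closed under both orders.\<close>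

lemma lift_affine_bracket:
  "lift_affine (aff_bracket f g) = lift_affine g * lift_affine f - lift_affine f * lift_affine g"
  by (rule endo_eqI, case_tac v)
    (simp add: lift_affine_apply endo_apply_simps aff_bracket_def matrix_vector_mult_diff_rdistrib
      matrix_vector_right_distrib matrix_vector_mul_assoc matrix_vector_mult_scaleR algebra_simps)

lemma lift_affine_lie_gen: "f \<in> lie_gen G \<Longrightarrow> lift_affine f \<in> lie_hull (lift_affine ` G)"
proof (induction rule: lie_gen.induct)
  case zero then show ?case by (simp add: linear_0[OF linear_lift_affine] lie_hull.zero)
next
  case (add f g) then show ?case by (simp add: linear_add[OF linear_lift_affine] lie_hull.add)
next
  case (scale f c) then show ?case by (simp add: linear_scale[OF linear_lift_affine] lie_hull.scale)
next
  case (bracket f g) then show ?case by (simp add: lift_affine_bracket lie_hull.bracket)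
qed (auto intro: lie_hull.gen)

text \<open>Taking the linear part respects brackets, so each homogeneous Lie element lifts to an
  affine one with the same linear part. On the level 0 the translation part is invisible, so one Lie
  algebra serves both systems.\<close>

lemma lie_gen_hom_gens:
  assumes "f \<in> lie_gen (hom_gens A B \<Omega>)"
  shows "fst f = 0 \<and> (\<exists>f'\<in>lie_gen (aff_gens A B C d \<Omega>). snd f' = snd f)"
  using assms
proof (induction rule: lie_gen.induct)
  case (gen f)
  then obtain w where "w \<in> \<Omega>" "f = (0, A_of A B w)" by (auto simp: hom_gens_def)
  then have "(C *v w + d, A_of A B w) \<in> lie_gen (aff_gens A B C d \<Omega>)"
    by (auto simp: aff_gens_def intro: lie_gen.gen)
  then show ?case using \<open>f = _\<close> by force
next
  case zero then show ?case using lie_gen.zero by fastforce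
next
  case (add f g) then show ?case using lie_gen.add by (metis add_0_left fst_add snd_add)
next
  case (scale f c) then show ?case using lie_gen.scale by (metis fst_scaleR scaleR_zero_right snd_scaleR)
next
  case (bracket f g)
  then obtain f' g' where "f' \<in> lie_gen (aff_gens A B C d \<Omega>)" "snd f' = snd f"
    "g' \<in> lie_gen (aff_gens A B C d \<Omega>)" "snd g' = snd g" by blast
  then show ?case using bracket lie_gen.bracket[of f' _ g'] by (force simp: aff_bracket_def)
qed

text \<open>For \<open>z \<noteq> 0\<close> the lifted field at \<open>(x, z)\<close> is
  \<open>z\<close> times the affine field at \<open>x / z\<close>; for \<open>z = 0\<close> it is
  the homogeneous field at \<open>x\<close>.\<close>

lemma lift_affine_rank_condition:
  assumes aff: "ARC_on (aff_gens A B C d \<Omega>) UNIV" and hom: "ARC_on (hom_gens A B \<Omega>) (UNIV - {0})"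
    and p: "p \<noteq> 0"
  shows "\<exists>Y\<in>lie_hull (lift_affine ` aff_gens A B C d \<Omega>). Y \<star> p = (y, 0)"
proof -
  obtain x z where xz: "p = (x, z)" by (cases p)
  have "\<exists>f\<in>lie_gen (aff_gens A B C d \<Omega>). lift_affine f \<star> (x, z) = (y, 0)"
  proof (cases "z = 0")
    case True
    then have "x \<noteq> 0" using p xz by (simp add: zero_prod_def)
    then obtain f where f: "f \<in> lie_gen (hom_gens A B \<Omega>)" "y = snd f *v x + fst f"
      using hom unfolding ARC_on_def by blast
    from lie_gen_hom_gens[OF f(1)] obtain f' where "f' \<in> lie_gen (aff_gens A B C d \<Omega>)" "snd f' = snd f" "fst f = 0"
      by blast
    then show ?thesis using f True by (intro bexI[of _ f']) (auto simp: lift_affine_apply)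
  next
    case False
    have "y /\<^sub>R z \<in> {snd f *v (x /\<^sub>R z) + fst f |f. f \<in> lie_gen (aff_gens A B C d \<Omega>)}"
      using aff unfolding ARC_on_def by blast
    then obtain f where f: "f \<in> lie_gen (aff_gens A B C d \<Omega>)" "y /\<^sub>R z = snd f *v (x /\<^sub>R z) + fst f" by blast
    have "y = z *\<^sub>R (y /\<^sub>R z)" using False by simp
    also have "\<dots> = snd f *v x + z *\<^sub>R fst f"
      unfolding f(2) using False by (simp add: scaleR_add_right matrix_vector_mult_scaleR)
    finally show ?thesis using f(1) by (intro bexI[of _ f]) (auto simp: lift_affine_apply)
  qed
  then show ?thesis using lift_affine_lie_gen xz by blast
qed

text \<open>The lifted generators depend affinely on \<open>w\<close>, so the bounded control range
  yields a uniform bound.\<close>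

lemma lift_affine_generators_bounded:
  assumes "bounded \<Omega>"
  shows "\<exists>K. \<forall>w\<in>\<Omega>. norm (lift_affine (C *v w + d, A_of A B w)) \<le> K"
proof -
  let ?L = "\<lambda>w. lift_affine (C *v w, \<Sum>i\<in>UNIV. (w $ i) *\<^sub>R B i)"
  have "linear (\<lambda>w. (C *v w, \<Sum>i\<in>UNIV. (w $ i) *\<^sub>R B i))"
    by (simp add: linear_iff matrix_vector_right_distrib matrix_vector_mult_scaleR algebra_simps
        sum.distrib scaleR_sum_right)
  from linear_compose[OF this linear_lift_affine] have "bounded_linear ?L"
    by (simp add: o_def linear_conv_bounded_linear)
  then have "bounded (?L ` \<Omega>)" using assms by (intro bounded_linear_image)
  then obtain K where K: "\<And>w. w \<in> \<Omega> \<Longrightarrow> norm (?L w) \<le> K" unfolding bounded_iff by auto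
  have "lift_affine (C *v w + d, A_of A B w) = lift_affine (d, A) + ?L w" for w
    by (simp add: A_of_def add.commute flip: linear_add[OF linear_lift_affine])
  then have "norm (lift_affine (C *v w + d, A_of A B w)) \<le> norm (lift_affine (d, A)) + K" if "w \<in> \<Omega>" for w
    using K[OF that] norm_triangle_ineq[of "lift_affine (d, A)" "?L w"] by simp
  then show ?thesis by blast
qed

section \<open>The quotient topology of projective space and limits at infinity\<close>

lemma openin_proj_topology:
  "openin proj_topology W \<longleftrightarrow> W \<subseteq> proj_space \<and> open {x. x \<noteq> 0 \<and> proj_line x \<in> W}"
proof -
  have "istopology (\<lambda>W. W \<subseteq> proj_space \<and> open {x::'a. x \<noteq> 0 \<and> proj_line x \<in> W})"
    unfolding istopology_def
  proof (intro conjI allI impI)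
    fix S T :: "'a set set"
    assume "S \<subseteq> proj_space \<and> open {x. x \<noteq> 0 \<and> proj_line x \<in> S}" "T \<subseteq> proj_space \<and> open {x. x \<noteq> 0 \<and> proj_line x \<in> T}"
    moreover have "{x. x \<noteq> 0 \<and> proj_line x \<in> S \<inter> T} = {x. x \<noteq> 0 \<and> proj_line x \<in> S} \<inter> {x. x \<noteq> 0 \<and> proj_line x \<in> T}"
      by blast
    ultimately show "S \<inter> T \<subseteq> proj_space" "open {x. x \<noteq> 0 \<and> proj_line x \<in> S \<inter> T}" by (blast, simp add: open_Int)
  next
    fix \<K> :: "'a set set set"
    assume \<K>: "\<forall>S\<in>\<K>. S \<subseteq> proj_space \<and> open {x. x \<noteq> 0 \<and> proj_line x \<in> S}"
    then show "\<Union>\<K> \<subseteq> proj_space" by blast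
    have "{x. x \<noteq> 0 \<and> proj_line x \<in> \<Union>\<K>} = (\<Union>S\<in>\<K>. {x. x \<noteq> 0 \<and> proj_line x \<in> S})" by blast
    then show "open {x. x \<noteq> 0 \<and> proj_line x \<in> \<Union>\<K>}" using \<K> by (simp add: open_UN)
  qed
  then show ?thesis unfolding proj_topology_def by (simp add: topology_inverse')
qed

lemma topspace_proj_topology: "topspace proj_topology = (proj_space :: 'a::real_normed_vector set set)"
proof -
  have "{x::'a. x \<noteq> 0 \<and> proj_line x \<in> proj_space} = - {0}" by (auto simp: proj_space_def)
  then have "openin proj_topology (proj_space :: 'a set set)" by (simp add: openin_proj_topology open_Compl)
  then show ?thesis using openin_proj_topology openin_topspace openin_subset by (metis subset_antisym)
qed

text \<open>Rescaling does not change lines, so the limit is in the closure. A line in the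
  hyperplane at infinity contains no vector \<open>(x, 1)\<close>, so it is not in the set itself
  and therefore belongs to the frontier.\<close>

lemma boundary_inf_limit:
  fixes z :: "'a::real_normed_vector"
  assumes z: "z \<noteq> 0" and Y: "\<And>n::nat. Y n \<in> D" "\<And>n. r n > 0"
    and lim: "(\<lambda>n. r n *\<^sub>R (Y n, 1::real)) \<longlonglongrightarrow> (z, 0)"
  shows "proj_line (z, 0) \<in> boundary_inf D"
proof -
  let ?S = "{proj_line (x, 1::real) | x. x \<in> D}"
  have z0: "(z, 0::real) \<noteq> 0" using z by (simp add: zero_prod_def)
  have "proj_line (z, 0) \<in> proj_topology closure_of ?S"
    unfolding in_closure_of
  proof (intro conjI allI impI)
    show "proj_line (z, 0::real) \<in> topspace proj_topology"
      unfolding topspace_proj_topology proj_space_def mem_Collect_eq using z0 by (intro exI[of _ "(z, 0)"] conjI refl)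
    fix W :: "('a \<times> real) set set" assume W: "proj_line (z, 0) \<in> W \<and> openin proj_topology W"
    then have "open {x. x \<noteq> 0 \<and> proj_line x \<in> W}" "(z, 0) \<in> {x. x \<noteq> 0 \<and> proj_line x \<in> W}"
      using z0 by (auto simp: openin_proj_topology)
    from topological_tendstoD[OF lim this] obtain n where "proj_line (r n *\<^sub>R (Y n, 1::real)) \<in> W"
      by (auto simp: eventually_sequentially)
    then have "proj_line (Y n, 1::real) \<in> W" using Y(2)[of n] proj_line_scaleR[of "r n" "(Y n, 1::real)"] by auto
    then show "\<exists>a. a \<in> ?S \<and> a \<in> W" using Y(1) by blast
  qed
  moreover have "proj_line (z, 0) \<notin> ?S"
  proof
    assume "proj_line (z, 0) \<in> ?S"
    then obtain x where "proj_line (z, 0) = proj_line (x, 1::real)" by blast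
    moreover have "(x, 1::real) \<in> proj_line (x, 1)" unfolding proj_line_def mem_Collect_eq by (intro exI[of _ 1]) simp
    ultimately have "(x, 1::real) \<in> proj_line (z, 0)" by simp
    then show False unfolding proj_line_def by simp
  qed
  ultimately have "proj_line (z, 0) \<in> proj_topology frontier_of ?S"
    unfolding frontier_of_def using interior_of_subset[of proj_topology ?S] by (meson DiffI subsetD)
  then show ?thesis unfolding boundary_inf_def P_inf_def using z by blast
qed

lemma emb_inf_proj_line: "emb_inf (proj_line z) = proj_line (z, 0)"
  unfolding emb_inf_def proj_line_def by auto

theorem theorem6p4:
  fixes A :: "real^'n^'n" and B :: "'m::finite \<Rightarrow> real^'n^'n"
    and C :: "real^'m^'n" and d :: "real^'n" and \<Omega> :: "(real^'m) set"
    and u :: "real \<Rightarrow> real^'m" and \<sigma> :: real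
  assumes bounded: "bounded \<Omega>" and zero_in: "0 \<in> \<Omega>"
    and ARC_aff: "ARC_on (aff_gens A B C d \<Omega>) UNIV"
    and ARC_hom: "ARC_on (hom_gens A B \<Omega>) (UNIV - {0})"
    and sigma_pos: "\<sigma> > 0"
    and u_pc: "u \<in> pc_controls \<Omega>"
    and u_periodic: "\<forall>t\<ge>0. u (t + \<sigma>) = u t"
    and g_u: "\<exists>g. g \<in> sys_sg_time A B C d \<Omega> \<sigma> \<inter>
                   lie_interior (gen_group (sys_sg A B C d \<Omega>)) (sys_sg A B C d \<Omega>) \<and>
                   (\<forall>x. aff_act g x = sol (aff_field A B C d) \<sigma> x u)"
    and no_eig1: "\<forall>v. sol (hom_field A B) \<sigma> v u = v \<longrightarrow> v = 0"
    and fin: "finite {D. control_set euclidean (sol (aff_field A B C d)) (pc_controls \<Omega>) D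
                         \<and> interior D \<noteq> {}}"
  shows "\<forall>Dh. control_set (subtopology euclidean (UNIV - {0})) (sol (hom_field A B)) (pc_controls \<Omega>) Dh
              \<and> interior Dh \<noteq> {} \<longrightarrow>
           (\<forall>PD. control_set proj_topology (proj_flow (sol (hom_field A B))) (pc_controls \<Omega>) PD
                 \<and> proj_line ` Dh \<subseteq> PD \<longrightarrow>
              (\<exists>D. control_set euclidean (sol (aff_field A B C d)) (pc_controls \<Omega>) D
                   \<and> interior D \<noteq> {} \<and> boundary_inf D \<inter> emb_inf ` PD \<noteq> {}))"
proof (intro allI impI)
  fix Dh PD
  assume Dh: "control_set (subtopology euclidean (UNIV - {0})) (sol (hom_field A B)) (pc_controls \<Omega>) Dh
      \<and> interior Dh \<noteq> {}"
    and PD: "control_set proj_topology (proj_flow (sol (hom_field A B))) (pc_controls \<Omega>) PD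
      \<and> proj_line ` Dh \<subseteq> PD"
  define M where "M w = lift_affine (C *v w + d, A_of A B w)" for w
  have M_image: "M ` \<Omega> = lift_affine ` aff_gens A B C d \<Omega>"
    unfolding M_def aff_gens_def by blast
  obtain K where K: "\<And>w. w \<in> \<Omega> \<Longrightarrow> norm (M w) \<le> K"
    using lift_affine_generators_bounded[OF bounded, of C d A B] unfolding M_def by blast
  interpret control_lift_vec M \<Omega> K
  proof
    show "\<Omega> \<noteq> {}" using zero_in by blast
    show "norm (M w) \<le> K" if "w \<in> \<Omega>" for w using K[OF that] .
    show "snd (M w \<star> v) = 0" for w v unfolding M_def by (cases v) (simp add: lift_affine_apply)
    show "\<exists>Y\<in>lie_hull (M ` \<Omega>). Y \<star> p = (y, 0)" if "p \<noteq> 0" for p y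
      unfolding M_image by (rule lift_affine_rank_condition[OF ARC_aff ARC_hom that])
  qed
  have field_1: "field 1 = aff_field A B C d" and field_0: "field 0 = hom_field A B"
    by (auto simp: fun_eq_iff field_def M_def lift_affine_apply aff_field_def hom_field_def)
  \<comment> \<open>\<open>G\<close> is the lifted time-\<sigma> map of \<open>u\<close>; its fixed
    vectors on the level 0 are those which \<open>no_eig1\<close> forces to vanish.\<close>
  obtain G where G: "G \<in> semigroup_of (M ` \<Omega>)" "\<And>x z. G \<star> (x, z) = (phi z \<sigma> x u, z)"
    using phi_semigroup[OF u_pc, of \<sigma>] sigma_pos by (metis less_imp_le)
  have no_eig: "v = 0" if "G \<star> (v, 0) = (v, 0)" for v
    using that no_eig1 unfolding G(2) field_0 by simp
  have "\<exists>D z Y r. control_set euclidean (phi 1) (pc_controls \<Omega>) D \<and> interior D \<noteq> {} \<and> z \<noteq> 0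
    \<and> proj_line z \<in> proj_line ` Dh \<and> (\<forall>n::nat. Y n \<in> D \<and> r n > 0) \<and> (\<lambda>n. r n *\<^sub>R (Y n, 1::real)) \<longlonglongrightarrow> (z, 0)"
    by (rule control_set_direction_at_infinity[OF _ _ G(1) no_eig])
      (use Dh fin in \<open>simp_all add: field_0 field_1\<close>)
  then obtain D z Y r where D: "control_set euclidean (phi 1) (pc_controls \<Omega>) D" "interior D \<noteq> {}" "z \<noteq> 0"
    and zD: "proj_line z \<in> proj_line ` Dh"
    and Y: "\<And>n::nat. Y n \<in> D" "\<And>n. r n > 0" "(\<lambda>n. r n *\<^sub>R (Y n, 1::real)) \<longlonglongrightarrow> (z, 0)"
    by blast
  have "proj_line (z, 0) \<in> boundary_inf D" by (rule boundary_inf_limit[OF D(3) Y])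
  moreover have "proj_line (z, 0) \<in> emb_inf ` PD"
    using zD PD unfolding emb_inf_proj_line[symmetric] by blast
  ultimately show "\<exists>D. control_set euclidean (sol (aff_field A B C d)) (pc_controls \<Omega>) D
      \<and> interior D \<noteq> {} \<and> boundary_inf D \<inter> emb_inf ` PD \<noteq> {}"
    using D(1,2) unfolding field_1 by blast
qed

end
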